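(* Let $X$ be a locally compact second countable space and let $\zeta$ be a locally finite random measure on $X$. (a) (Case $\alpha=1$.) $\zeta$ is strictly $1$-stable if and only if $\zeta$ is deterministic. (b) (Case $\alpha\in(0,1)$.) $\zeta$ is strictly $\alpha$-stable if and only if its Laplace functional is given by $$L_\zeta[h]=\exp\Bigl\{-\int_{\mathbb{M}\setminus\{0\}}\bigl(1-e^{-\langle h,\mu\rangle}\bigr)\,\Lambda(d\mu)\Bigr\},\qquad h\in \mathrm{BM}(X),$$ where $\Lambda$ is a Lévy measure, that is, a Radon measure on $\mathbb{M}\setminus\{0\}$ such that $$\int_{\mathbb{M}\setminus\{0\}}\bigl(1-e^{-\langle h,\mu\rangle}\bigr)\,\Lambda(d\mu)<\infty\quad\text{for all } h\in \mathrm{BM}(X),$$ and $\Lambda$ is homogeneous of order $-\alpha$, that is, $\Lambda(tA)=t^{-\alpha}\Lambda(A)$ for all measurable $A\subset\mathbb{M}\setminus\{0\}$ and all $t>0$.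
   Context: $X$ is a locally compact second countable (Hausdorff) space with Borel $\sigma$-algebra $\mathcal{B}$; $\mathcal{B}_0$ is the family of relatively compact Borel sets. $\mathbb{M}$ is the family of (non-negative) Radon measures on $X$, i.e. measures on $\mathcal{B}$ that are finite on $\mathcal{B}_0$, with the $\sigma$-algebra generated by the maps $\mu\mapsto\mu(B)$, $B\in\mathcal{B}$ (and with the vague topology when a topology on $\mathbb{M}$ is needed). $0$ denotes the zero measure and $tA=\{t\mu:\mu\in A\}$. A random measure is a random element of $\mathbb{M}$. $\mathrm{BM}(X)$ is the set of non-negative bounded measurable functions $h:X\to\mathbb{R}_+$ with compact support; $\langle h,\mu\rangle=\int_X h\,d\mu$. The Laplace functional of a random measure $\zeta$ is $L_\zeta[h]=\mathbf{E}\exp\{-\langle h,\zeta\rangle\}$, $h\in\mathrm{BM}(X)$. Strict $\alpha$-stability: a random measure $\zeta$ is strictly $\alpha$-stable if $t^{1/\alpha}\zeta'+(1-t)^{1/\alpha}\zeta''\overset{\mathcal D}{=}\zeta$ for all $0\le t\le 1$, where $\zeta',\zeta''$ are independent copies of $\zeta$ and $\overset{\mathcal D}{=}$ is equality in distribution. *)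

theory Defs
  imports "HOL-Probability.Probability"
begin

(* A Radon measure in the sense "finite on relatively compact measurable sets", for a topology T
   on the carrier of the measurable space S. This single definition is used both for measures on
   the ground space and for measures on the space of measures without the zero measure. *)
definition radon_measure_on :: "'b topology \<Rightarrow> 'b measure \<Rightarrow> 'b measure \<Rightarrow> bool" where
  "radon_measure_on T S \<mu> \<longleftrightarrow>
     sets \<mu> = sets S \<and> (\<forall>B\<in>sets S. compactin T (T closure_of B) \<longrightarrow> emeasure \<mu> B < \<infinity>)"

definition radon_measures :: "'a::topological_space measure set" where
  "radon_measures = {\<mu>. radon_measure_on euclidean borel \<mu>}"

(* The sigma-algebra generated by the evaluation maps; same pattern as subprob_algebra. *)
definition radon_algebra :: "'a::topological_space measure measure" where
  "radon_algebra = (SUP B \<in> sets borel. vimage_algebra radon_measures (\<lambda>\<mu>. emeasure \<mu> B) borel)"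

definition random_measure :: "'o measure \<Rightarrow> ('o \<Rightarrow> 'a::topological_space measure) \<Rightarrow> bool" where
  "random_measure P \<zeta> \<longleftrightarrow> prob_space P \<and> \<zeta> \<in> measurable P radon_algebra"

definition vague_topology :: "'a::topological_space measure topology" where
  "vague_topology = topology_generated_by
     {{\<mu> \<in> radon_measures. (\<integral>x. f x \<partial>\<mu>) \<in> U} | (f :: 'a \<Rightarrow> real) U.
        continuous_on UNIV f \<and> compact (closure {x. f x \<noteq> 0}) \<and> open U}"

abbreviation zero_measure :: "'a::topological_space measure" where
  "zero_measure \<equiv> null_measure borel"

definition nonzero_radon_algebra :: "'a::topological_space measure measure" where
  "nonzero_radon_algebra = restrict_space radon_algebra (radon_measures - {zero_measure})"

definition nonzero_vague_topology :: "'a::topological_space measure topology" where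
  "nonzero_vague_topology = subtopology vague_topology (radon_measures - {zero_measure})"

definition BM :: "('a::topological_space \<Rightarrow> real) set" where
  "BM = {h \<in> borel_measurable borel. (\<forall>x. 0 \<le> h x) \<and> bounded (range h) \<and>
           compact (closure {x. h x \<noteq> 0})}"

(* For h in BM and a Radon measure, h is integrable, so the Bochner integral is the usual one. *)
definition pairing :: "('a \<Rightarrow> real) \<Rightarrow> 'a measure \<Rightarrow> real" where
  "pairing h \<mu> = (\<integral>x. h x \<partial>\<mu>)"

definition laplace_functional ::
    "'o measure \<Rightarrow> ('o \<Rightarrow> 'a measure) \<Rightarrow> ('a \<Rightarrow> real) \<Rightarrow> real" where
  "laplace_functional P \<zeta> h = (\<integral>\<omega>. exp (- pairing h (\<zeta> \<omega>)) \<partial>P)"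

definition add_measure :: "'a measure \<Rightarrow> 'a measure \<Rightarrow> 'a measure" where
  "add_measure \<mu> \<nu> = measure_of (space \<mu>) (sets \<mu>) (\<lambda>B. emeasure \<mu> B + emeasure \<nu> B)"

definition stable_combination :: "real \<Rightarrow> real \<Rightarrow> 'a measure \<Rightarrow> 'a measure \<Rightarrow> 'a measure" where
  "stable_combination \<alpha> t \<mu> \<nu> =
     add_measure (scale_measure (ennreal (t powr (1 / \<alpha>))) \<mu>)
                 (scale_measure (ennreal ((1 - t) powr (1 / \<alpha>))) \<nu>)"

(* The two independent copies are the canonical ones on the product space. The lemma
   strictly_stable_iff_indep_copies below shows that any other choice gives the same notion. *)
definition strictly_stable ::
    "real \<Rightarrow> 'o measure \<Rightarrow> ('o \<Rightarrow> 'a::topological_space measure) \<Rightarrow> bool" where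
  "strictly_stable \<alpha> P \<zeta> \<longleftrightarrow>
     (\<forall>t\<in>{0..1}. distr (P \<Otimes>\<^sub>M P) radon_algebra (\<lambda>(\<omega>', \<omega>''). stable_combination \<alpha> t (\<zeta> \<omega>') (\<zeta> \<omega>''))
                = distr P radon_algebra \<zeta>)"

definition deterministic :: "'o measure \<Rightarrow> ('o \<Rightarrow> 'a::topological_space measure) \<Rightarrow> bool" where
  "deterministic P \<zeta> \<longleftrightarrow> (\<exists>\<mu>\<in>radon_measures. AE \<omega> in P. \<zeta> \<omega> = \<mu>)"

definition levy_measure :: "'a::topological_space measure measure \<Rightarrow> bool" where
  "levy_measure \<Lambda> \<longleftrightarrow>
     radon_measure_on nonzero_vague_topology nonzero_radon_algebra \<Lambda> \<and>
     (\<forall>h\<in>BM. (\<integral>\<^sup>+\<mu>. ennreal (1 - exp (- pairing h \<mu>)) \<partial>\<Lambda>) < \<infinity>)"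

definition homogeneous :: "real \<Rightarrow> 'a measure measure \<Rightarrow> bool" where
  "homogeneous a \<Lambda> \<longleftrightarrow>
     (\<forall>A\<in>sets \<Lambda>. \<forall>t>0.
        emeasure \<Lambda> (scale_measure (ennreal t) ` A) = ennreal (t powr a) * emeasure \<Lambda> A)"

lemma radon_measures_iff:
  "\<mu> \<in> radon_measures \<longleftrightarrow>
     sets \<mu> = sets borel \<and> (\<forall>B\<in>sets borel. compact (closure B) \<longrightarrow> emeasure \<mu> B < \<infinity>)"
  by (simp add: radon_measures_def radon_measure_on_def)

lemma space_radon_algebra: "space radon_algebra = radon_measures"
  by (auto simp: radon_algebra_def space_Sup_eq_UN)

lemma measurable_emeasure_radon_algebra:
  "B \<in> sets borel \<Longrightarrow> (\<lambda>\<mu>. emeasure \<mu> B) \<in> borel_measurable radon_algebra"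
  by (auto intro!: measurable_Sup1 measurable_vimage_algebra1 simp: radon_algebra_def)

lemma measurable_radon_algebra:
  "(\<And>x. x \<in> space N \<Longrightarrow> K x \<in> radon_measures) \<Longrightarrow>
   (\<And>B. B \<in> sets borel \<Longrightarrow> (\<lambda>x. emeasure (K x) B) \<in> borel_measurable N) \<Longrightarrow>
   K \<in> measurable N radon_algebra"
  by (auto intro!: measurable_Sup2 measurable_vimage_algebra2 simp: radon_algebra_def)

lemma sets_add_measure [simp]: "sets (add_measure \<mu> \<nu>) = sets \<mu>"
  by (simp add: add_measure_def)

lemma emeasure_add_measure:
  assumes "sets \<nu> = sets \<mu>" "B \<in> sets \<mu>"
  shows "emeasure (add_measure \<mu> \<nu>) B = emeasure \<mu> B + emeasure \<nu> B"
proof (rule emeasure_measure_of[OF add_measure_def])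
  show "countably_additive (sets (add_measure \<mu> \<nu>)) (\<lambda>B. emeasure \<mu> B + emeasure \<nu> B)"
  proof (rule countably_additiveI)
    fix A :: "nat \<Rightarrow> 'a set"
    assume A: "range A \<subseteq> sets (add_measure \<mu> \<nu>)" "disjoint_family A"
    have "(\<Sum>i. emeasure \<mu> (A i) + emeasure \<nu> (A i)) = (\<Sum>i. emeasure \<mu> (A i)) + (\<Sum>i. emeasure \<nu> (A i))"
      by (rule suminf_add[symmetric]) auto
    then show "(\<Sum>i. emeasure \<mu> (A i) + emeasure \<nu> (A i)) = emeasure \<mu> (\<Union>i. A i) + emeasure \<nu> (\<Union>i. A i)"
      using A assms by (simp add: suminf_emeasure)
  qed
qed (use assms sets.sets_into_space in \<open>auto simp: positive_def\<close>)

lemma stable_combination_radon: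
  assumes "\<mu> \<in> radon_measures" "\<nu> \<in> radon_measures"
  shows "stable_combination \<alpha> t \<mu> \<nu> \<in> radon_measures"
  using assms unfolding stable_combination_def radon_measures_iff
  by (auto simp: emeasure_add_measure ennreal_mult_less_top)

lemma measurable_stable_combination:
  "(\<lambda>(\<mu>, \<nu>). stable_combination \<alpha> t \<mu> \<nu>)
     \<in> measurable (radon_algebra \<Otimes>\<^sub>M radon_algebra) radon_algebra"
proof (rule measurable_radon_algebra)
  fix B :: "'a set" assume B: "B \<in> sets borel"
  note [measurable] = measurable_emeasure_radon_algebra[OF B]
  have "(\<lambda>p. ennreal (t powr (1 / \<alpha>)) * emeasure (fst p) B
              + ennreal ((1 - t) powr (1 / \<alpha>)) * emeasure (snd p) B)
          \<in> borel_measurable (radon_algebra \<Otimes>\<^sub>M radon_algebra)"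
    by measurable
  also have "?this \<longleftrightarrow> (\<lambda>p. emeasure (case p of (\<mu>, \<nu>) \<Rightarrow> stable_combination \<alpha> t \<mu> \<nu>) B)
          \<in> borel_measurable (radon_algebra \<Otimes>\<^sub>M radon_algebra)"
    using B
    by (intro measurable_cong)
       (auto simp: space_pair_measure space_radon_algebra radon_measures_iff
          stable_combination_def emeasure_add_measure)
  finally show "(\<lambda>p. emeasure (case p of (\<mu>, \<nu>) \<Rightarrow> stable_combination \<alpha> t \<mu> \<nu>) B)
          \<in> borel_measurable (radon_algebra \<Otimes>\<^sub>M radon_algebra)" .
qed (auto simp: space_pair_measure space_radon_algebra intro: stable_combination_radon)

lemma strictly_stable_iff_indep_copies:
  fixes \<zeta> :: "'o \<Rightarrow> 'a::topological_space measure" and \<zeta>' \<zeta>'' :: "'q \<Rightarrow> 'a measure"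
  assumes \<zeta>: "random_measure P \<zeta>"
    and Q: "prob_space Q"
    and indep: "prob_space.indep_var Q radon_algebra \<zeta>' radon_algebra \<zeta>''"
    and copies: "distr Q radon_algebra \<zeta>' = distr P radon_algebra \<zeta>"
      "distr Q radon_algebra \<zeta>'' = distr P radon_algebra \<zeta>"
  shows "strictly_stable \<alpha> P \<zeta> \<longleftrightarrow>
     (\<forall>t\<in>{0..1}. distr Q radon_algebra (\<lambda>\<omega>. stable_combination \<alpha> t (\<zeta>' \<omega>) (\<zeta>'' \<omega>))
                = distr P radon_algebra \<zeta>)"
proof -
  interpret P: prob_space P using \<zeta> by (simp add: random_measure_def)
  interpret Q: prob_space Q by fact
  interpret PP: pair_prob_space P P ..
  have m [measurable]: "\<zeta> \<in> measurable P radon_algebra"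
    using \<zeta> by (simp add: random_measure_def)
  have q [measurable]: "\<zeta>' \<in> measurable Q radon_algebra" "\<zeta>'' \<in> measurable Q radon_algebra"
    using indep Q.indep_var_distribution_eq by blast+
  interpret D: prob_space "distr P radon_algebra \<zeta>" by (rule P.prob_space_distr) (rule m)
  have QQ: "distr Q (radon_algebra \<Otimes>\<^sub>M radon_algebra) (\<lambda>\<omega>. (\<zeta>' \<omega>, \<zeta>'' \<omega>))
            = distr P radon_algebra \<zeta> \<Otimes>\<^sub>M distr P radon_algebra \<zeta>"
    using indep copies by (simp add: Q.indep_var_distribution_eq)
  have PP: "distr (P \<Otimes>\<^sub>M P) (radon_algebra \<Otimes>\<^sub>M radon_algebra) (\<lambda>(x, y). (\<zeta> x, \<zeta> y))
            = distr P radon_algebra \<zeta> \<Otimes>\<^sub>M distr P radon_algebra \<zeta>"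
    by (rule pair_measure_distr[symmetric]) (use m D.sigma_finite_measure_axioms in auto)
  have "distr (P \<Otimes>\<^sub>M P) radon_algebra (\<lambda>(x, y). stable_combination \<alpha> t (\<zeta> x) (\<zeta> y))
      = distr Q radon_algebra (\<lambda>\<omega>. stable_combination \<alpha> t (\<zeta>' \<omega>) (\<zeta>'' \<omega>))" for t
  proof -
    let ?c = "\<lambda>(\<mu>, \<nu>). stable_combination \<alpha> t \<mu> \<nu>"
    have "distr (P \<Otimes>\<^sub>M P) radon_algebra (\<lambda>(x, y). stable_combination \<alpha> t (\<zeta> x) (\<zeta> y))
        = distr (distr (P \<Otimes>\<^sub>M P) (radon_algebra \<Otimes>\<^sub>M radon_algebra) (\<lambda>(x, y). (\<zeta> x, \<zeta> y))) radon_algebra ?c"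
      by (subst distr_distr[OF measurable_stable_combination])
         (auto simp: comp_def case_prod_unfold)
    also have "\<dots> = distr (distr Q (radon_algebra \<Otimes>\<^sub>M radon_algebra) (\<lambda>\<omega>. (\<zeta>' \<omega>, \<zeta>'' \<omega>))) radon_algebra ?c"
      by (simp only: PP QQ)
    also have "\<dots> = distr Q radon_algebra (\<lambda>\<omega>. stable_combination \<alpha> t (\<zeta>' \<omega>) (\<zeta>'' \<omega>))"
      by (subst distr_distr[OF measurable_stable_combination]) (auto simp: comp_def)
    finally show ?thesis .
  qed
  then show ?thesis by (simp add: strictly_stable_def)
qed

end

theory Submission
  imports Defs
begin

text \<open>
  For \<open>\<alpha> = 1\<close>, stability at \<open>t = 1/2\<close> says that \<open>exp (- \<langle>h, \<zeta>\<rangle>)\<close> has variance 0 for every \<open>h\<close>.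

  For \<open>\<alpha> < 1\<close> write the Laplace functional as \<open>exp (- \<phi>)\<close>; stability forces \<open>\<phi> (c h) = c\<^sup>\<alpha> \<phi> h\<close>, and the
  converse direction of (b) is the observation that homogeneity of \<open>\<Lambda>\<close> gives this scaling. To construct
  \<open>\<Lambda>\<close>, fix a strictly positive weight \<open>g\<close> with \<open>\<langle>g, \<zeta>\<rangle> < \<infinity>\<close> almost surely. The measure
  \<open>(1 - exp (- \<langle>g, \<mu>\<rangle>)) \<Lambda> (d\<mu>)\<close> should be finite with Laplace functional \<open>\<phi> (g + h) - \<phi> h\<close>. Up to
  normalization this is the limit of the laws \<open>Q\<^sub>n\<close> obtained by tilting the law of \<open>2 powr (- n / \<alpha>) \<zeta>\<close> by the same
  factor. No compactness is needed: \<open>Q\<^sub>n\<close> is the convolution of \<open>Q\<^sub>n\<^sub>+\<^sub>1\<close> with a further tilted law, so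
  Kolmogorov's theorem yields random measures with laws \<open>Q\<^sub>n\<close> that decrease in \<open>n\<close>, and the limit exists pointwise.
  Dividing by the weight, a geometric series turns the differences of \<open>\<phi>\<close> into a telescoping sum with value
  \<open>\<phi> h\<close>; the remainder vanishes because \<open>\<alpha> < 1\<close>.
\<close>

section \<open>Measures, their sums and Laplace transforms\<close>

text \<open>The exponent has to be known at functions such as \<open>h + n g\<close>, and a strictly
  positive weight lies outside \<open>BM\<close> unless the space is compact. Laplace transforms are
  therefore taken at measurable functions with values in \<open>ennreal\<close>, with the
  exponential of minus infinity read as 0, and the exponent is studied on functions bounded by a
  multiple of \<open>g\<close>. Positivity of \<open>g\<close> makes its pairing vanish only at the
  zero measure, so dividing by the weight is harmless elsewhere. An atom of the limit law at the
  zero measure would correspond to a deterministic drift, the case \<alpha> = 1. The estimate (n +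
  C)^\<alpha> - n^\<alpha> -> 0 excludes it and also closes the telescoping sum. Kolmogorov's
  theorem is applied to sequences in a Polish space, so measures are coded by countable families of
  reals through a measurable map with a measurable left inverse. Homogeneity is not read off the
  construction: the image of \<Lambda> under a scaling and the corresponding multiple of \<Lambda>
  have the same exponent, and the exponent determines a Levy measure.\<close>

definition eneg :: "ennreal \<Rightarrow> real" where
  "eneg x = (if x = \<top> then 0 else exp (- enn2real x))"

lemma eneg_ennreal: "0 \<le> x \<Longrightarrow> eneg (ennreal x) = exp (- x)"
  by (simp add: eneg_def)

lemma eneg_nonneg [simp]: "0 \<le> eneg x" and eneg_le_1 [simp]: "eneg x \<le> 1"
  and eneg_0 [simp]: "eneg 0 = 1" and eneg_top [simp]: "eneg \<top> = 0"
  by (auto simp: eneg_def)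

lemma abs_eneg [simp]: "\<bar>eneg x\<bar> = eneg x"
  by simp

lemma eneg_eq_1_iff [simp]: "eneg x = 1 \<longleftrightarrow> x = 0"
  by (cases x) (auto simp: eneg_ennreal)

lemma eneg_less_1: "x \<noteq> 0 \<Longrightarrow> eneg x < 1"
  using eneg_le_1[of x] by (metis eneg_eq_1_iff order_le_imp_less_or_eq)

lemma eneg_eq_0_iff [simp]: "eneg x = 0 \<longleftrightarrow> x = \<top>"
  by (auto simp: eneg_def)

lemma eneg_add: "eneg (x + y) = eneg x * eneg y"
  by (cases x; cases y) (auto simp: eneg_ennreal exp_add exp_diff ennreal_plus[symmetric] simp del: ennreal_plus
      , auto simp: exp_minus field_simps)

lemma eneg_mult_of_nat: "eneg (of_nat n * x) = eneg x ^ n"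
  by (induction n) (auto simp: eneg_add distrib_right)

lemma eneg_antimono: "x \<le> y \<Longrightarrow> eneg y \<le> eneg x"
  by (cases x; cases y) (auto simp: eneg_ennreal top_unique)

lemma eneg_measurable [measurable]: "eneg \<in> borel_measurable borel"
  unfolding eneg_def by measurable

lemma tendsto_eneg:
  assumes "(f \<longlongrightarrow> x) F" "x < \<top>"
  shows "((\<lambda>n. eneg (f n)) \<longlongrightarrow> eneg x) F"
proof -
  have "eventually (\<lambda>n. f n < \<top>) F"
    using assms by (rule order_tendstoD)
  then have ev: "eventually (\<lambda>n. exp (- enn2real (f n)) = eneg (f n)) F"
    by eventually_elim (auto simp: eneg_def)
  have "((\<lambda>n. exp (- enn2real (f n))) \<longlongrightarrow> exp (- enn2real x)) F"
    using assms by (intro tendsto_intros tendsto_enn2real[of _ "enn2real x"]) auto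
  moreover have "exp (- enn2real x) = eneg x"
    using assms by (auto simp: eneg_def)
  ultimately show ?thesis
    using ev by (simp add: Lim_transform_eventually)
qed

lemma measurable_nn_integral_radon_algebra:
  fixes h :: "'a::topological_space \<Rightarrow> ennreal"
  assumes "h \<in> borel_measurable borel"
  shows "(\<lambda>\<mu>. \<integral>\<^sup>+x. h x \<partial>\<mu>) \<in> borel_measurable radon_algebra"
  using assms
proof induction
  case (cong f g)
  moreover have "(\<lambda>\<mu>. \<integral>\<^sup>+x. f x \<partial>\<mu>) = (\<lambda>\<mu>. \<integral>\<^sup>+x. g x \<partial>\<mu>)" if "\<And>x. f x = g x"
    using that by auto
  ultimately show ?case by simp
next
  case (set B)
  have "(\<lambda>\<mu>. emeasure \<mu> B) \<in> borel_measurable radon_algebra"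
    using set by (rule measurable_emeasure_radon_algebra)
  also have "?this \<longleftrightarrow> ?case"
    using set by (intro measurable_cong) (auto simp: space_radon_algebra radon_measures_iff nn_integral_indicator)
  finally show ?case .
next
  case (mult u c)
  have [measurable]: "(\<lambda>\<mu>. integral\<^sup>N \<mu> u) \<in> borel_measurable radon_algebra" by (rule mult)
  have "(\<lambda>\<mu>. c * \<integral>\<^sup>+x. u x \<partial>\<mu>) \<in> borel_measurable radon_algebra" by measurable
  also have "?this \<longleftrightarrow> ?case"
    using mult by (intro measurable_cong)
      (auto simp: space_radon_algebra radon_measures_iff nn_integral_cmult cong: measurable_cong_sets)
  finally show ?case .
next
  case (add u v)
  have [measurable]: "(\<lambda>\<mu>. integral\<^sup>N \<mu> u) \<in> borel_measurable radon_algebra" by (rule add)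
  have [measurable]: "(\<lambda>\<mu>. integral\<^sup>N \<mu> v) \<in> borel_measurable radon_algebra" by (rule add)
  have "(\<lambda>\<mu>. (\<integral>\<^sup>+x. v x \<partial>\<mu>) + \<integral>\<^sup>+x. u x \<partial>\<mu>) \<in> borel_measurable radon_algebra" by measurable
  also have "?this \<longleftrightarrow> ?case"
    using add by (intro measurable_cong)
      (auto simp: space_radon_algebra radon_measures_iff nn_integral_add cong: measurable_cong_sets)
  finally show ?case .
next
  case (seq U)
  have [measurable]: "(\<lambda>\<mu>. integral\<^sup>N \<mu> (U i)) \<in> borel_measurable radon_algebra" for i by (rule seq)
  have "(\<lambda>\<mu>. SUP i. \<integral>\<^sup>+x. U i x \<partial>\<mu>) \<in> borel_measurable radon_algebra" by measurable
  also have "?this \<longleftrightarrow> ?case"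
  proof (intro measurable_cong)
    fix \<mu> :: "'a measure" assume "\<mu> \<in> space radon_algebra"
    then have "sets \<mu> = sets borel" by (simp add: space_radon_algebra radon_measures_iff)
    then have [measurable]: "U i \<in> borel_measurable \<mu>" for i
      using seq(1)[of i] by (simp cong: measurable_cong_sets)
    show "(SUP i. \<integral>\<^sup>+x. U i x \<partial>\<mu>) = (\<integral>\<^sup>+x. (SUP i. U i) x \<partial>\<mu>)"
      using nn_integral_monotone_convergence_SUP[OF \<open>incseq U\<close>, of \<mu>] by (simp add: SUP_apply image_comp)
  qed
  finally show ?case .
qed

lemma nn_integral_add_measure:
  assumes "sets \<nu> = sets \<mu>" "h \<in> borel_measurable \<mu>"
  shows "(\<integral>\<^sup>+x. h x \<partial>add_measure \<mu> \<nu>) = (\<integral>\<^sup>+x. h x \<partial>\<mu>) + (\<integral>\<^sup>+x. h x \<partial>\<nu>)"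
  using assms(2)
proof induction
  have [measurable_cong]: "sets (add_measure \<mu> \<nu>) = sets \<mu>" "sets \<nu> = sets \<mu>" using assms by auto
  have sp: "space (add_measure \<mu> \<nu>) = space \<mu>" "space \<nu> = space \<mu>"
    by (intro sets_eq_imp_space_eq; simp add: assms)+
  {
    case (cong f g)
    then show ?case using sp by (metis (no_types, lifting) nn_integral_cong)
  next
    case (set A)
    then show ?case using assms by (simp add: emeasure_add_measure)
  next
    case (mult u c)
    then show ?case by (simp add: nn_integral_cmult distrib_left)
  next
    case (add u v)
    then show ?case by (simp add: nn_integral_add ac_simps)
  next
    case (seq U)
    then have [measurable]: "U i \<in> borel_measurable \<mu>" for i by simp
    have inc: "incseq (\<lambda>i. \<integral>\<^sup>+x. U i x \<partial>\<rho>)" for \<rho>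
      using \<open>incseq U\<close> by (auto simp: incseq_def le_fun_def intro!: nn_integral_mono)
    show ?case
      using \<open>incseq U\<close> inc
      by (simp add: image_comp nn_integral_monotone_convergence_SUP ennreal_SUP_add seq)
  }
qed

lemma add_measure_radon:
  "\<mu> \<in> radon_measures \<Longrightarrow> \<nu> \<in> radon_measures \<Longrightarrow> add_measure \<mu> \<nu> \<in> radon_measures"
  by (auto simp: radon_measures_iff emeasure_add_measure)

lemma scale_measure_radon:
  "\<mu> \<in> radon_measures \<Longrightarrow> scale_measure (ennreal c) \<mu> \<in> radon_measures"
  by (auto simp: radon_measures_iff ennreal_mult_less_top)

lemma sets_radon: "\<mu> \<in> radon_measures \<Longrightarrow> sets \<mu> = sets borel"
  by (simp add: radon_measures_iff)

lemma measurable_add_measure [measurable]: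
  "(\<lambda>(\<mu>, \<nu>). add_measure \<mu> \<nu>) \<in> measurable (radon_algebra \<Otimes>\<^sub>M radon_algebra) radon_algebra"
proof (rule measurable_radon_algebra)
  fix B :: "'a set" assume B: "B \<in> sets borel"
  note [measurable] = measurable_emeasure_radon_algebra[OF B]
  have "(\<lambda>p. emeasure (fst p) B + emeasure (snd p) B) \<in> borel_measurable (radon_algebra \<Otimes>\<^sub>M radon_algebra)"
    by measurable
  also have "?this \<longleftrightarrow> (\<lambda>p. emeasure (case p of (\<mu>, \<nu>) \<Rightarrow> add_measure \<mu> \<nu>) B)
          \<in> borel_measurable (radon_algebra \<Otimes>\<^sub>M radon_algebra)"
    using B by (intro measurable_cong)
       (auto simp: space_pair_measure space_radon_algebra sets_radon emeasure_add_measure)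
  finally show "(\<lambda>p. emeasure (case p of (\<mu>, \<nu>) \<Rightarrow> add_measure \<mu> \<nu>) B)
          \<in> borel_measurable (radon_algebra \<Otimes>\<^sub>M radon_algebra)" .
qed (auto simp: space_pair_measure space_radon_algebra intro: add_measure_radon)

lemma measurable_scale_measure [measurable]:
  "scale_measure (ennreal c) \<in> measurable radon_algebra radon_algebra"
proof (rule measurable_radon_algebra)
  fix B :: "'a set" assume B: "B \<in> sets borel"
  note [measurable] = measurable_emeasure_radon_algebra[OF B]
  have "(\<lambda>\<mu>. ennreal c * emeasure \<mu> B) \<in> borel_measurable radon_algebra"
    by measurable
  then show "(\<lambda>\<mu>. emeasure (scale_measure (ennreal c) \<mu>) B) \<in> borel_measurable radon_algebra"
    by simp
qed (auto simp: space_radon_algebra intro: scale_measure_radon)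

lemma nn_integral_radon_add:
  assumes "\<mu> \<in> radon_measures" "\<nu> \<in> radon_measures" "h \<in> borel_measurable borel"
  shows "(\<integral>\<^sup>+x. h x \<partial>add_measure \<mu> \<nu>) = (\<integral>\<^sup>+x. h x \<partial>\<mu>) + (\<integral>\<^sup>+x. h x \<partial>\<nu>)"
  using assms by (intro nn_integral_add_measure) (auto simp: sets_radon cong: measurable_cong_sets)

lemma nn_integral_radon_scale:
  assumes "\<mu> \<in> radon_measures" "h \<in> borel_measurable borel"
  shows "(\<integral>\<^sup>+x. h x \<partial>scale_measure c \<mu>) = c * (\<integral>\<^sup>+x. h x \<partial>\<mu>)"
  using assms by (intro nn_integral_scale_measure) (auto simp: sets_radon cong: measurable_cong_sets)

lemma measure_eq_0_iff_null_measure: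
  assumes "sets \<mu> = sets borel"
  shows "emeasure \<mu> UNIV = 0 \<longleftrightarrow> \<mu> = null_measure borel"
proof
  assume "emeasure \<mu> UNIV = 0"
  then have "emeasure \<mu> B = 0" for B
    by (metis assms emeasure_mono sets.top space_borel subset_UNIV le_zero_eq)
  then show "\<mu> = null_measure borel"
    using assms by (intro measure_eqI) auto
qed simp

lemma zero_measure_radon [simp]: "zero_measure \<in> radon_measures"
  by (auto simp: radon_measures_iff)

text \<open>Being nonzero is a condition on a single evaluation map, the total mass.\<close>

lemma nonzero_radon_sets [measurable]: "radon_measures - {zero_measure} \<in> sets radon_algebra"
proof -
  have "{\<mu>\<in>space radon_algebra. emeasure \<mu> UNIV \<noteq> 0} \<in> sets radon_algebra"
    using measurable_emeasure_radon_algebra[of UNIV] by measurable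
  also have "{\<mu>\<in>space radon_algebra. emeasure \<mu> UNIV \<noteq> 0} = radon_measures - {zero_measure}"
    by (auto simp: space_radon_algebra sets_radon measure_eq_0_iff_null_measure[OF sets_radon])
  finally show ?thesis .
qed

lemma space_nonzero_radon_algebra: "space nonzero_radon_algebra = radon_measures - {zero_measure}"
  by (auto simp: nonzero_radon_algebra_def space_restrict_space space_radon_algebra)

lemma sets_nonzero_radon_algebra_iff:
  "A \<in> sets nonzero_radon_algebra \<longleftrightarrow> A \<in> sets radon_algebra \<and> A \<subseteq> radon_measures - {zero_measure}"
  unfolding nonzero_radon_algebra_def
  by (subst sets_restrict_space_iff) (auto simp: space_radon_algebra Int_absorb2)

section \<open>Uniqueness of Laplace functionals\<close>

text \<open>Weierstrass: equality on powers of \<open>X\<close> passes to polynomials, and a uniform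
  approximation of \<open>f\<close> on the unit interval costs at most its error times the total
  masses. The bounded factor \<open>G\<close> is carried along so that the result can be used for
  one variable after another.\<close>

lemma integral_continuous_eq_of_moments:
  fixes A B :: "'b measure" and G X :: "'b \<Rightarrow> real" and f :: "real \<Rightarrow> real"
  assumes fin: "finite_measure A" "finite_measure B" and sets [measurable_cong]: "sets B = sets A"
    and [measurable]: "X \<in> borel_measurable A" "G \<in> borel_measurable A"
    and X: "\<And>x. 0 \<le> X x" "\<And>x. X x \<le> 1" and G: "\<And>x. \<bar>G x\<bar> \<le> 1"
    and eq: "\<And>n. (\<integral>x. X x ^ n * G x \<partial>A) = (\<integral>x. X x ^ n * G x \<partial>B)"
    and f: "continuous_on UNIV f"
  shows "(\<integral>x. f (X x) * G x \<partial>A) = (\<integral>x. f (X x) * G x \<partial>B)"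
proof -
  interpret A: finite_measure A by fact
  interpret B: finite_measure B by fact
  have f01: "continuous_on {0..1} f" using f continuous_on_subset by blast
  have fm [measurable]: "f \<in> borel_measurable borel"
    using f by (rule borel_measurable_continuous_onI)
  obtain K where K: "\<And>x. x \<in> {0..1} \<Longrightarrow> \<bar>f x\<bar> \<le> K"
    using compact_imp_bounded[OF compact_continuous_image[OF f01]] by (auto simp: bounded_iff simp del: atLeastAtMost_iff)
  have int: "integrable M (\<lambda>x. f (X x) * G x)" if "finite_measure M" "sets M = sets A" for M
  proof -
    interpret finite_measure M by fact
    note [measurable_cong] = that(2)
    show ?thesis
    proof (rule integrable_const_bound[where B=K])
      have "\<bar>f (X x)\<bar> * \<bar>G x\<bar> \<le> K * 1" for x
        using X G K[of "X x"] by (intro mult_mono) (auto intro: order_trans[OF abs_ge_zero])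
      then show "AE x in M. norm (f (X x) * G x) \<le> K"
        by (auto simp: abs_mult)
    qed simp
  qed
  have intn: "integrable M (\<lambda>x. X x ^ n * G x)" if "finite_measure M" "sets M = sets A" for M n
  proof -
    interpret finite_measure M by fact
    note [measurable_cong] = that(2)
    show ?thesis
      using X G
      by (intro integrable_const_bound[where B=1]) (auto simp: abs_mult power_le_one intro!: AE_I2 mult_le_one)
  qed
  have close: "\<bar>(\<integral>x. f (X x) * G x \<partial>M) - (\<integral>x. p (X x) * G x \<partial>M)\<bar> \<le> e * measure M (space M)"
    if M: "finite_measure M" "sets M = sets A" and p: "\<And>x. x \<in> {0..1} \<Longrightarrow> \<bar>f x - p x\<bar> \<le> e"
      and ip: "integrable M (\<lambda>x. p (X x) * G x)" for M p e
  proof -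
    interpret finite_measure M by fact
    have "\<bar>(\<integral>x. f (X x) * G x \<partial>M) - (\<integral>x. p (X x) * G x \<partial>M)\<bar> = \<bar>\<integral>x. (f (X x) - p (X x)) * G x \<partial>M\<bar>"
      using ip int[OF M] by (subst Bochner_Integration.integral_diff[symmetric]) (auto simp: algebra_simps)
    also have "\<dots> \<le> (\<integral>x. \<bar>(f (X x) - p (X x)) * G x\<bar> \<partial>M)"
      by simp
    also have "\<dots> \<le> (\<integral>x. e \<partial>M)"
    proof (rule integral_mono)
      show "integrable M (\<lambda>x. \<bar>(f (X x) - p (X x)) * G x\<bar>)"
        using Bochner_Integration.integrable_diff[OF int[OF M] ip] by (simp add: algebra_simps)
      fix x
      have "\<bar>f (X x) - p (X x)\<bar> * \<bar>G x\<bar> \<le> e * 1"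
        using X G p[of "X x"] by (intro mult_mono) (auto intro: order_trans[OF abs_ge_zero p[of 0]])
      then show "\<bar>(f (X x) - p (X x)) * G x\<bar> \<le> e" by (simp add: abs_mult)
    qed auto
    also have "\<dots> = e * measure M (space M)" by simp
    finally show ?thesis .
  qed
  let ?d = "\<bar>(\<integral>x. f (X x) * G x \<partial>A) - (\<integral>x. f (X x) * G x \<partial>B)\<bar>"
  have "?d \<le> 0 + e" if "e > 0" for e
  proof -
    \<comment> \<open>The summand 1 keeps the divisor positive when both measures vanish.\<close>
    let ?K = "measure A (space A) + measure B (space B) + 1"
    have K0: "?K > 0" by (simp add: add_nonneg_pos)
    define d where "d = e / ?K"
    have d: "d > 0" using that K0 by (simp add: d_def)
    obtain p where p: "polynomial_function p" "\<And>x. x \<in> {0..1} \<Longrightarrow> \<bar>f x - p x\<bar> < d"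
      using Stone_Weierstrass_polynomial_function[OF _ f01 d] by (metis compact_Icc real_norm_def)
    then obtain a n where pa: "p = (\<lambda>x. \<Sum>i\<le>n. a i * x ^ i)"
      using real_polynomial_function_iff_sum real_polynomial_function_eq by metis
    have ps: "(\<lambda>x. p (X x) * G x) = (\<lambda>x. \<Sum>i\<le>n. a i * (X x ^ i * G x))"
      by (auto simp: pa sum_distrib_right mult.assoc)
    have ip: "integrable M (\<lambda>x. p (X x) * G x)" if "finite_measure M" "sets M = sets A" for M
      unfolding ps using intn[OF that] by (intro Bochner_Integration.integrable_sum integrable_mult_right) auto
    have "(\<integral>x. p (X x) * G x \<partial>A) = (\<integral>x. p (X x) * G x \<partial>B)"
      unfolding ps using intn[OF fin(1)] intn[OF fin(2) sets] eq by (simp add: Bochner_Integration.integral_sum)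
    then have "?d \<le> d * measure A (space A) + d * measure B (space B)"
      using close[OF fin(1) refl less_imp_le[OF p(2)] ip[OF fin(1) refl]]
            close[OF fin(2) sets less_imp_le[OF p(2)] ip[OF fin(2) sets]] by linarith
    also have "\<dots> \<le> d * ?K" using d by (simp add: algebra_simps)
    also have "\<dots> = e" using K0 by (simp add: d_def)
    finally show ?thesis by simp
  qed
  then have "?d \<le> 0" by (rule field_le_epsilon)
  then show ?thesis by simp
qed

text \<open>The indicator of a closed half-line is the pointwise limit of continuous ramps of slope
  \<open>k\<close>, and dominated convergence applies because the measures are finite.\<close>

lemma integral_indicator_eq_of_moments:
  fixes A B :: "'b measure" and G X :: "'b \<Rightarrow> real"
  assumes fin: "finite_measure A" "finite_measure B" and sets [measurable_cong]: "sets B = sets A"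
    and [measurable]: "X \<in> borel_measurable A" "G \<in> borel_measurable A"
    and X: "\<And>x. 0 \<le> X x" "\<And>x. X x \<le> 1" and G: "\<And>x. \<bar>G x\<bar> \<le> 1"
    and eq: "\<And>n. (\<integral>x. X x ^ n * G x \<partial>A) = (\<integral>x. X x ^ n * G x \<partial>B)"
  shows "(\<integral>x. indicator {c..} (X x) * G x \<partial>A) = (\<integral>x. indicator {c..} (X x) * G x \<partial>B)"
proof -
  define f where "f k x = max 0 (min 1 (1 + real k * (x - c)))" for k x
  have lim: "(\<lambda>k. f k x) \<longlonglongrightarrow> indicator {c..} x" for x
  proof (cases "x < c")
    case True
    have "eventually (\<lambda>k. f k x = 0) sequentially"
    proof -
      obtain N where N: "1 / (c - x) < real N" using reals_Archimedean2 by blast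
      show ?thesis
      proof (rule eventually_sequentiallyI[of N])
        fix k assume "N \<le> k"
        then have "1 / (c - x) < real k" using N by linarith
        then have "1 < real k * (c - x)" using True by (simp add: field_simps)
        then show "f k x = 0" by (simp add: f_def algebra_simps)
      qed
    qed
    then show ?thesis using True by (simp add: tendsto_eventually)
  qed (auto simp: f_def indicator_def)
  have [measurable]: "f k \<in> borel_measurable borel" for k unfolding f_def by measurable
  have L: "(\<lambda>k. \<integral>x. f k (X x) * G x \<partial>M) \<longlonglongrightarrow> (\<integral>x. indicator {c..} (X x) * G x \<partial>M)"
    if "finite_measure M" "sets M = sets A" for M
  proof (rule integral_dominated_convergence[where w="\<lambda>_. 1"])
    interpret finite_measure M by fact
    show "integrable M (\<lambda>_. 1::real)" by simp
    note [measurable_cong] = that(2)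
    show "(\<lambda>x. indicat_real {c..} (X x) * G x) \<in> borel_measurable M" "(\<lambda>x. f k (X x) * G x) \<in> borel_measurable M" for k
      by measurable
    show "AE x in M. (\<lambda>k. f k (X x) * G x) \<longlonglongrightarrow> indicat_real {c..} (X x) * G x"
      by (intro AE_I2 tendsto_intros lim)
    show "AE x in M. norm (f k (X x) * G x) \<le> 1" for k
      using G by (auto simp: abs_mult f_def intro!: mult_le_one)
  qed
  have "(\<integral>x. f k (X x) * G x \<partial>A) = (\<integral>x. f k (X x) * G x \<partial>B)" for k
    by (rule integral_continuous_eq_of_moments[OF fin sets _ _ X G eq]) (auto simp: f_def intro!: continuous_intros)
  then show ?thesis
    using L[OF fin(1) refl] L[OF fin(2) sets] by (simp add: LIMSEQ_unique)
qed

text \<open>Indicators are adjoined one at a time, each as a limit of polynomials in an element of the class.\<close>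

theorem finite_measure_eq_of_multiplicative_class:
  fixes A B :: "'b measure" and \<H> :: "('b \<Rightarrow> real) set"
  assumes fin: "finite_measure A" "finite_measure B" and sets [measurable_cong]: "sets B = sets A"
    and meas: "\<And>X. X \<in> \<H> \<Longrightarrow> X \<in> borel_measurable A"
    and bnd: "\<And>X x. X \<in> \<H> \<Longrightarrow> 0 \<le> X x" "\<And>X x. X \<in> \<H> \<Longrightarrow> X x \<le> 1"
    and one: "(\<lambda>_. 1) \<in> \<H>" and mult: "\<And>X Y. X \<in> \<H> \<Longrightarrow> Y \<in> \<H> \<Longrightarrow> (\<lambda>x. X x * Y x) \<in> \<H>"
    and eq: "\<And>X. X \<in> \<H> \<Longrightarrow> (\<integral>x. X x \<partial>A) = (\<integral>x. X x \<partial>B)"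
    and gen: "sets A \<subseteq> sigma_sets (space A) {{x\<in>space A. c \<le> X x} | X c. X \<in> \<H>}"
  shows "A = B"
proof -
  interpret A: finite_measure A by fact
  interpret B: finite_measure B by fact
  have sp: "space B = space A" using sets by (rule sets_eq_imp_space_eq)
  define ind where "ind xs x = prod_list (map (\<lambda>p. indicator {snd p..} (fst p x) :: real) xs)" for xs :: "(('b \<Rightarrow> real) \<times> real) list" and x :: 'b
  have ind01: "0 \<le> ind xs x" "ind xs x \<le> 1" for xs x
    by (induction xs) (auto simp: ind_def indicator_def)
  have ind_meas: "fst ` set xs \<subseteq> \<H> \<Longrightarrow> ind xs \<in> borel_measurable A" for xs
  proof (induction xs)
    case (Cons y ys)
    obtain X c where y: "y = (X, c)" by (cases y)
    have [measurable]: "X \<in> borel_measurable A" "ind ys \<in> borel_measurable A"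
      using Cons y meas by auto
    have "ind (y # ys) = (\<lambda>x. indicator {c..} (X x) * ind ys x)"
      by (auto simp: ind_def y)
    then show ?case by simp
  qed (simp add: ind_def[abs_def])
  \<comment> \<open>\<open>Y\<close> is arbitrary in the induction: for the head \<open>X\<close> of
    the list, the factors \<open>X ^ n * Y\<close> are again members of the class, so the hypothesis
    for the tail supplies all the moments.\<close>
  have main: "(\<integral>x. Y x * ind xs x \<partial>A) = (\<integral>x. Y x * ind xs x \<partial>B)" if "fst ` set xs \<subseteq> \<H>" "Y \<in> \<H>" for xs Y
    using that
  proof (induction xs arbitrary: Y)
    case Nil
    then show ?case using eq by (simp add: ind_def)
  next
    case (Cons y ys)
    obtain X c where y: "y = (X, c)" by (cases y)
    have XH: "X \<in> \<H>" "fst ` set ys \<subseteq> \<H>" using Cons y by auto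
    note [measurable] = meas[OF XH(1)] ind_meas[OF XH(2)] meas[OF Cons(3)]
    have pow: "(\<lambda>x. X x ^ n * Y x) \<in> \<H>" for n
    proof (induction n)
      case (Suc n)
      show ?case using mult[OF XH(1) Suc] by (simp add: mult.assoc)
    qed (use Cons in simp)
    have "(\<integral>x. indicator {c..} (X x) * (Y x * ind ys x) \<partial>A) = (\<integral>x. indicator {c..} (X x) * (Y x * ind ys x) \<partial>B)"
    proof (rule integral_indicator_eq_of_moments[OF fin sets])
      show "\<bar>Y x * ind ys x\<bar> \<le> 1" for x
        using bnd Cons(3) ind01 by (auto simp: abs_mult intro!: mult_le_one)
      show "(\<integral>x. X x ^ n * (Y x * ind ys x) \<partial>A) = (\<integral>x. X x ^ n * (Y x * ind ys x) \<partial>B)" for n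
        using Cons(1)[OF XH(2) pow[of n]] by (simp add: mult.assoc)
    qed (use bnd XH in auto)
    then show ?case by (simp add: y ind_def algebra_simps)
  qed
  \<comment> \<open>Finite conjunctions of such conditions form a generator that is stable under
    intersection; the empty list contributes the whole space.\<close>
  define E where "E = {{x\<in>space A. \<forall>p\<in>set xs. snd p \<le> fst p x} | xs :: (('b \<Rightarrow> real) \<times> real) list. fst ` set xs \<subseteq> \<H>}"
  have eqE: "emeasure A S = emeasure B S" and ES: "S \<in> sets A" if "S \<in> E" for S
  proof -
    obtain xs :: "(('b \<Rightarrow> real) \<times> real) list" where xs: "fst ` set xs \<subseteq> \<H>" "S = {x\<in>space A. \<forall>p\<in>set xs. snd p \<le> fst p x}"
      using \<open>S \<in> E\<close> unfolding E_def by auto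
    have ind: "ind xs x = indicator S x" if "x \<in> space A" for x
      using that unfolding xs(2) by (induction xs) (auto simp: ind_def indicator_def)
    have "{x\<in>space A. ind xs x = 1} \<in> sets A" using ind_meas[OF xs(1)] by measurable
    also have "{x\<in>space A. ind xs x = 1} = S"
    proof -
      have "S \<subseteq> space A" using xs(2) by blast
      then show ?thesis using ind by (auto simp: indicator_eq_1_iff)
    qed
    finally show S: "S \<in> sets A" .
    have "measure A S = (\<integral>x. 1 * ind xs x \<partial>A)"
      using S ind by (subst Bochner_Integration.integral_cong[OF refl, of _ _ "indicator S"]) (auto simp: Int_absorb2 sets.sets_into_space)
    also have "\<dots> = (\<integral>x. 1 * ind xs x \<partial>B)" using main[OF xs(1) one] by simp
    also have "\<dots> = measure B S"
      using S ind sets sp by (subst Bochner_Integration.integral_cong[OF refl, of _ _ "indicator S"]) (auto simp: Int_absorb2 sets.sets_into_space)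
    finally show "emeasure A S = emeasure B S"
      by (simp add: A.emeasure_eq_measure B.emeasure_eq_measure)
  qed
  have spE: "space A \<in> E" unfolding E_def by (intro CollectI exI[of _ "[]"]) auto
  have "Int_stable E"
  proof (rule Int_stableI)
    fix a b assume "a \<in> E" "b \<in> E"
    then obtain xs ys :: "(('b \<Rightarrow> real) \<times> real) list" where "fst ` set xs \<subseteq> \<H>" "a = {x\<in>space A. \<forall>p\<in>set xs. snd p \<le> fst p x}"
      "fst ` set ys \<subseteq> \<H>" "b = {x\<in>space A. \<forall>p\<in>set ys. snd p \<le> fst p x}" unfolding E_def mem_Collect_eq by auto
    then show "a \<inter> b \<in> E" unfolding E_def by (intro CollectI exI[of _ "xs @ ys"]) auto
  qed
  moreover have "sets A = sigma_sets (space A) E"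
  proof
    have "{{x\<in>space A. c \<le> X x} | X c. X \<in> \<H>} \<subseteq> E"
    proof safe
      fix X c assume "X \<in> \<H>"
      then show "{x\<in>space A. c \<le> X x} \<in> E" unfolding E_def by (intro CollectI exI[of _ "[(X, c)]"]) auto
    qed
    then show "sets A \<subseteq> sigma_sets (space A) E"
      using gen sigma_sets_mono' by (metis (no_types, lifting) subset_trans)
    show "sigma_sets (space A) E \<subseteq> sets A"
      using ES by (intro sets.sigma_sets_subset) auto
  qed
  ultimately show ?thesis
  proof (intro measure_eqI_generator_eq[where E=E and \<Omega>="space A" and A="\<lambda>_. space A"])
    show "E \<subseteq> Pow (space A)" using ES sets.sets_into_space by blast
    show "sets B = sigma_sets (space A) E" using sets \<open>sets A = sigma_sets (space A) E\<close> by (rule trans)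
    show "range (\<lambda>_::nat. space A) \<subseteq> E" using spE by auto
  qed (use eqE in \<open>auto simp del: Collect_mem_eq\<close>)
qed

section \<open>Exhaustions and cutoff functions on locally compact second countable Hausdorff
  spaces\<close>

lemma Hausdorff_euclidean: "Hausdorff_space (euclidean :: 'a::t2_space topology)"
  using hausdorff by (auto simp: Hausdorff_space_def disjnt_def)

lemma compact_exhaustion:
  assumes "locally_compact_space (euclidean :: 'a::{second_countable_topology, t2_space} topology)"
  obtains K :: "nat \<Rightarrow> 'a::{second_countable_topology, t2_space} set" where "\<And>n. compact (K n)" "\<And>n. K n \<subseteq> interior (K (Suc n))" "(\<Union>n. K n) = UNIV"
proof -
  have lc: "\<exists>U V. open U \<and> compact V \<and> x \<in> U \<and> U \<subseteq> V" for x :: 'a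
    using assms by (auto simp: locally_compact_space_def)
  then obtain U V where UV: "\<And>x::'a. open (U x)" "\<And>x::'a. compact (V x)" "\<And>x. x \<in> U x" "\<And>x. U x \<subseteq> V x"
    by metis
  obtain F where F: "F \<subseteq> range U" "countable F" "\<Union>F = \<Union>(range U)"
    using Lindelof[of "range U"] UV(1) by auto
  have FU: "\<Union>F = UNIV" using F(3) UV(3) by auto
  then have Fne: "F \<noteq> {}" by auto
  define W where "W = from_nat_into F"
  have W: "range W = F" using Fne F(2) by (simp add: W_def range_from_nat_into)
  have Wc: "\<exists>C. compact C \<and> W n \<subseteq> C" "open (W n)" for n
  proof -
    have "W n \<in> range U" using W F by auto
    then obtain x where x: "W n = U x" by auto
    show "\<exists>C. compact C \<and> W n \<subseteq> C" unfolding x using UV(2,4) by (intro exI[of _ "V x"]) simp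
    show "open (W n)" unfolding x by (rule UV(1))
  qed
  from Wc(1) obtain C where C: "\<And>n. compact (C n)" "\<And>n. W n \<subseteq> C n" by metis
  have step: "\<exists>m. S \<subseteq> (\<Union>i<m. W i)" if "compact S" for S
  proof -
    obtain T where T: "T \<subseteq> UNIV" "finite T" "S \<subseteq> (\<Union>i\<in>T. W i)"
    proof (rule compactE_image[OF \<open>compact S\<close>])
      show "S \<subseteq> (\<Union>i\<in>UNIV. W i)" using W FU by auto
    qed (use Wc in auto)
    then obtain m where "T \<subseteq> {..<m}" using finite_nat_iff_bounded by auto
    then have "(\<Union>i\<in>T. W i) \<subseteq> (\<Union>i<m. W i)" by (rule UN_mono) simp
    then show ?thesis using T(3) by (intro exI[of _ m]) simp
  qed
  \<comment> \<open>The chosen number makes the open sets \<open>W i\<close> cover the previous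
    stage, which puts it into the interior of the next one. The lower bound \<open>Suc n\<close>
    forces every \<open>C n\<close> in eventually, so that the stages exhaust the space.\<close>
  define K where "K = rec_nat {} (\<lambda>n S. \<Union>i< max (Suc n) (SOME m. S \<subseteq> (\<Union>i<m. W i)). C i)"
  have KS: "K (Suc n) = (\<Union>i< max (Suc n) (SOME m. K n \<subseteq> (\<Union>i<m. W i)). C i)" and K0: "K 0 = {}" for n
    by (simp_all add: K_def)
  have Kc: "compact (K n)" for n
    by (cases n) (auto simp: K0 KS C intro!: compact_UN)
  have Kint: "K n \<subseteq> interior (K (Suc n))" for n
  proof -
    let ?m = "SOME m. K n \<subseteq> (\<Union>i<m. W i)"
    have "K n \<subseteq> (\<Union>i<?m. W i)" using someI_ex[OF step[OF Kc]] .
    also have "\<dots> \<subseteq> interior (K (Suc n))"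
    proof (rule interior_maximal)
      show "(\<Union>i<?m. W i) \<subseteq> K (Suc n)" unfolding KS using C(2) by force
    qed (use Wc in auto)
    finally show ?thesis .
  qed
  have "\<exists>n. x \<in> K n" for x
  proof -
    have "x \<in> \<Union>(range W)" using FU W by simp
    then obtain n where "x \<in> W n" by blast
    then have "x \<in> K (Suc n)" unfolding KS using C(2)[of n] by (auto intro!: exI[of _ n])
    then show ?thesis by blast
  qed
  then have "(\<Union>n. K n) = UNIV" by auto
  then show thesis using Kc Kint by (intro that[of K])
qed

lemma interior_exhaustion_mono:
  assumes "\<And>n. K n \<subseteq> interior (K (Suc n))"
  shows "m \<le> n \<Longrightarrow> K m \<subseteq> K n"
  using lift_Suc_mono_le[of K m n] assms interior_subset by blast

lemma compact_subset_exhaustion: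
  assumes "\<And>n. K n \<subseteq> interior (K (Suc n))" "(\<Union>n. K n) = UNIV" "compact C"
  obtains n where "C \<subseteq> K n"
proof -
  have "x \<in> (\<Union>n. interior (K n))" for x
  proof -
    have "x \<in> (\<Union>n. K n)" using assms(2) by simp
    then obtain n where "x \<in> K n" by blast
    then show ?thesis using assms(1)[of n] by blast
  qed
  then have cov: "C \<subseteq> (\<Union>n\<in>UNIV. interior (K n))" by blast
  obtain T where T: "finite T" "C \<subseteq> (\<Union>n\<in>T. interior (K n))"
    by (rule compactE_image[OF assms(3) _ cov]) auto
  obtain m where "T \<subseteq> {..<m}" using T(1) finite_nat_iff_bounded by auto
  have "C \<subseteq> K m"
  proof
    fix x assume "x \<in> C"
    then obtain n where n: "n \<in> T" "x \<in> interior (K n)" using T(2) by blast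
    have "K n \<subseteq> K m" using \<open>T \<subseteq> {..<m}\<close> n(1) by (intro interior_exhaustion_mono[where K=K, OF assms(1)]) auto
    then show "x \<in> K m" using n(2) interior_subset by blast
  qed
  then show thesis using that by blast
qed

lemma locally_compact_regular:
  fixes x :: "'a::{second_countable_topology, t2_space}"
  assumes lc: "locally_compact_space (euclidean :: 'a topology)" and "open U" "x \<in> U"
  obtains V where "open V" "x \<in> V" "compact (closure V)" "closure V \<subseteq> U"
proof -
  have "Hausdorff_space (euclidean :: 'a topology)" by (rule Hausdorff_euclidean)
  then have nb: "neighbourhood_base_of (\<lambda>C. compactin euclidean C) (euclidean :: 'a topology)"
    using lc locally_compact_space_neighbourhood_base by blast
  then obtain V C where VC: "open V" "compact C" "x \<in> V" "V \<subseteq> C" "C \<subseteq> U"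
    using assms(2,3) unfolding neighbourhood_base_of by (metis open_openin compactin_euclidean_iff)
  have "closure V \<subseteq> C" using VC compact_imp_closed closure_minimal by blast
  moreover have "compact (closure V)"
    using compact_Int_closed[OF VC(2) closed_closure[of V]] calculation by (simp add: Int_absorb1)
  ultimately show thesis using that VC by blast
qed

text \<open>Urysohn's lemma between \<open>K\<close> and the complement of the interior of a larger
  compact stage, which confines the support.\<close>

lemma compact_cutoff:
  assumes lc: "locally_compact_space (euclidean :: 'a::{second_countable_topology, t2_space} topology)" and "compact K"
  obtains f :: "'a::{second_countable_topology, t2_space} \<Rightarrow> real" where "continuous_on UNIV f" "compact (closure {x. f x \<noteq> 0})"
    "\<And>x. 0 \<le> f x" "\<And>x. f x \<le> 1" "\<And>x. x \<in> K \<Longrightarrow> f x = 1"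
proof -
  obtain C :: "nat \<Rightarrow> 'a set" where C: "\<And>n. compact (C n)" "\<And>n. C n \<subseteq> interior (C (Suc n))" "(\<Union>n. C n) = UNIV"
    using compact_exhaustion[OF lc] by blast
  obtain n where n: "K \<subseteq> C n" using compact_subset_exhaustion[OF C(2,3) assms(2)] by blast
  let ?T = "- interior (C (Suc n))"
  have "completely_regular_space (euclidean :: 'a topology)"
    using lc by (rule locally_compact_regular_imp_completely_regular_space) (simp add: Hausdorff_euclidean)
  moreover have "disjnt K ?T" using n C(2)[of n] by (auto simp: disjnt_def)
  ultimately obtain f where f: "continuous_map (euclidean::'a topology) (top_of_set {0..1::real}) f" "f ` ?T \<subseteq> {0}" "f ` K \<subseteq> {1}"
    using Urysohn_completely_regular_compact_closed[of "0::real" 1 euclidean K ?T] assms(2) by auto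
  have "{x. f x \<noteq> 0} \<subseteq> C (Suc n)" using f(2) interior_subset by fastforce
  then have sub: "closure {x. f x \<noteq> 0} \<subseteq> C (Suc n)"
    using C(1) by (intro closure_minimal compact_imp_closed)
  have "compact (C (Suc n) \<inter> closure {x. f x \<noteq> 0})"
    using C(1) by (intro compact_Int_closed) auto
  then have "compact (closure {x. f x \<noteq> 0})" using sub by (simp add: Int_absorb1)
  moreover have "continuous_on UNIV f" "\<And>x. f x \<in> {0..1}"
    using f(1) by (auto simp: continuous_map_in_subtopology)
  ultimately show thesis
    using f(3) by (intro that[of f]) auto
qed

section \<open>Coding measures by sequences of reals\<close>

text \<open>Base 3 with digits 0 and 1 only: a tail is at most 1/2, so no carry occurs and each
  digit can be read off with a floor. Binary expansions would be ambiguous.\<close>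

definition ternary_code :: "(nat \<Rightarrow> bool) \<Rightarrow> real" where
  "ternary_code b = (\<Sum>k. of_bool (b k) / 3 ^ Suc k)"

definition ternary_digit :: "nat \<Rightarrow> real \<Rightarrow> bool" where
  "ternary_digit k r \<longleftrightarrow> \<lfloor>3 ^ Suc k * r\<rfloor> mod 3 = 1"

lemma summable_ternary: "summable (\<lambda>k. of_bool (b k) / 3 ^ Suc k :: real)"
proof (rule summable_comparison_test)
  show "\<exists>N. \<forall>n\<ge>N. norm (of_bool (b n) / 3 ^ Suc n :: real) \<le> (1/3) ^ n"
    by (auto simp: power_divide field_simps of_bool_def)
  show "summable (\<lambda>n. (1/3) ^ n :: real)" by (rule summable_geometric) simp
qed

lemma ternary_code_bounds: "0 \<le> ternary_code b" "ternary_code b \<le> 1 / 2"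
proof -
  show "0 \<le> ternary_code b"
    unfolding ternary_code_def by (intro suminf_nonneg summable_ternary) auto
  have g: "(\<lambda>n. (1/3) * (1/3) ^ n :: real) sums ((1/3) * (1 / (1 - 1/3)))"
    by (intro sums_mult geometric_sums) simp
  have "ternary_code b \<le> (\<Sum>n. (1/3) * (1/3) ^ n)"
    unfolding ternary_code_def using sums_summable[OF g]
    by (intro suminf_le summable_ternary) (auto simp: power_divide of_bool_def)
  also have "\<dots> = 1 / 2" using sums_unique[OF g] by simp
  finally show "ternary_code b \<le> 1 / 2" .
qed

lemma ternary_code_shift: "3 * ternary_code b = of_bool (b 0) + ternary_code (\<lambda>k. b (Suc k))"
proof -
  have "ternary_code b = of_bool (b 0) / 3 + (\<Sum>k. of_bool (b (Suc k)) / 3 ^ Suc (Suc k))"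
    unfolding ternary_code_def using suminf_split_head[OF summable_ternary[of b]] by simp
  also have "(\<Sum>k. of_bool (b (Suc k)) / 3 ^ Suc (Suc k) :: real) = ternary_code (\<lambda>k. b (Suc k)) / 3"
    unfolding ternary_code_def using suminf_divide[OF summable_ternary[of "\<lambda>k. b (Suc k)"], of 3]
    by (simp add: field_simps)
  finally show ?thesis by simp
qed

lemma ternary_digit_code [simp]: "ternary_digit k (ternary_code b) = b k"
proof -
  have "\<exists>z::int. 3 ^ k * ternary_code b = of_int z + ternary_code (\<lambda>i. b (i + k))"
  proof (induction k)
    case (Suc k)
    then obtain z :: int where z: "3 ^ k * ternary_code b = of_int z + ternary_code (\<lambda>i. b (i + k))" by blast
    have "3 ^ Suc k * ternary_code b = 3 * (3 ^ k * ternary_code b)" by simp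
    also have "\<dots> = of_int (3 * z + of_bool (b k)) + ternary_code (\<lambda>i. b (i + Suc k))"
      unfolding z using ternary_code_shift[of "\<lambda>i. b (i + k)"] by simp
    finally show ?case by blast
  qed (auto intro: exI[of _ 0])
  then obtain z :: int where z: "3 ^ k * ternary_code b = of_int z + ternary_code (\<lambda>i. b (i + k))" by blast
  let ?t = "ternary_code (\<lambda>i. b (Suc i + k))"
  have "3 ^ Suc k * ternary_code b = 3 * (3 ^ k * ternary_code b)" by simp
  also have "\<dots> = of_int (3 * z + of_bool (b k)) + ?t"
    unfolding z using ternary_code_shift[of "\<lambda>i. b (i + k)"] by simp
  finally have "\<lfloor>3 ^ Suc k * ternary_code b\<rfloor> = 3 * z + of_bool (b k)"
    using ternary_code_bounds[of "\<lambda>i. b (Suc i + k)"] by (intro floor_unique) auto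
  then show ?thesis by (simp add: ternary_digit_def of_bool_def)
qed

lemma measurable_ternary_code:
  assumes [measurable]: "\<And>k. Measurable.pred M (b k)"
  shows "(\<lambda>x. ternary_code (\<lambda>k. b k x)) \<in> borel_measurable M"
  unfolding ternary_code_def of_bool_def by measurable

lemma measurable_ternary_digit [measurable]: "Measurable.pred borel (ternary_digit k)"
  unfolding ternary_digit_def by measurable

text \<open>Members with compact closure inside a given neighbourhood are what later allows a point
  to be pinned down by compactness.\<close>

lemma exists_compact_base:
  assumes lc: "locally_compact_space (euclidean :: 'a::{second_countable_topology, t2_space} topology)"
  obtains U :: "nat \<Rightarrow> 'a::{second_countable_topology, t2_space} set" where "topological_basis (range U)"
    "\<And>S x. open S \<Longrightarrow> x \<in> S \<Longrightarrow> \<exists>k. x \<in> U k \<and> compact (closure (U k)) \<and> closure (U k) \<subseteq> S"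
proof -
  obtain B :: "'a set set" where B: "countable B" "topological_basis B"
    using ex_countable_basis by blast
  have ne: "B \<noteq> {}"
    using topological_basisE[OF B(2) open_UNIV UNIV_I] by blast
  define U where "U = from_nat_into B"
  have U: "range U = B" using ne B(1) by (simp add: U_def range_from_nat_into)
  have "\<exists>k. x \<in> U k \<and> compact (closure (U k)) \<and> closure (U k) \<subseteq> S" if S: "open S" "x \<in> S" for S x
  proof -
    obtain V where V: "open V" "x \<in> V" "compact (closure V)" "closure V \<subseteq> S"
      using locally_compact_regular[OF lc S] by blast
    obtain W where W: "W \<in> B" "x \<in> W" "W \<subseteq> V" using topological_basisE[OF B(2) V(1,2)] by blast
    have cl: "closure W \<subseteq> closure V" using W(3) by (rule closure_mono)
    have "compact (closure W)"
      using compact_Int_closed[OF V(3) closed_closure[of W]] cl by (simp add: Int_absorb1)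
    moreover obtain k where "W = U k" using W(1) U by auto
    ultimately show ?thesis using W cl V(4) by blast
  qed
  then show thesis using B(2) U by (intro that[of U]) auto
qed

text \<open>A point is coded by its membership in a base of relatively compact open sets. By compactness
  a code belongs to a point iff finitely many of its digits never contradict each other, which is a
  Borel condition.\<close>

theorem borel_retract_of_real:
  assumes lc: "locally_compact_space (euclidean :: 'a::{second_countable_topology, t2_space} topology)"
  obtains j :: "'a::{second_countable_topology, t2_space} \<Rightarrow> real" and s where
    "j \<in> borel_measurable borel" "s \<in> borel_measurable borel"
    "\<And>x. s (j x) = x" "\<And>x. 0 \<le> j x" "\<And>x. j x < 1"
proof -
  obtain U :: "nat \<Rightarrow> 'a set" where U: "topological_basis (range U)"
    "\<And>S x. open S \<Longrightarrow> x \<in> S \<Longrightarrow> \<exists>k. x \<in> U k \<and> compact (closure (U k)) \<and> closure (U k) \<subseteq> S"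
    using exists_compact_base[OF lc] by blast
  have Uo: "open (U k)" for k using U(1) by (simp add: topological_basis_open)
  define j where "j x = ternary_code (\<lambda>k. x \<in> U k)" for x
  have [measurable]: "U k \<in> sets borel" for k using Uo by simp
  have j: "j \<in> borel_measurable borel"
    unfolding j_def by (rule measurable_ternary_code) measurable
  define codes where "codes r x \<longleftrightarrow> (\<forall>k. x \<in> U k \<longleftrightarrow> ternary_digit k r)" for r x
  have codes_j: "codes (j x) x" for x by (simp add: codes_def j_def)
  have uniq: "x = y" if "codes r x" "codes r y" for r x y
  proof (rule ccontr)
    assume "x \<noteq> y"
    then obtain S T where ST: "open S" "open T" "x \<in> S" "y \<in> T" "S \<inter> T = {}" using hausdorff[OF \<open>x \<noteq> y\<close>] by auto
    then obtain k where k: "x \<in> U k" "closure (U k) \<subseteq> S" using U(2)[OF ST(1,3)] by auto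
    then have "y \<in> U k" using that by (simp add: codes_def)
    then have "y \<in> S" using k(2) closure_subset by auto
    then show False using ST(4,5) by auto
  qed
  \<comment> \<open>The points not contradicted by the first \<open>n + 1\<close> digits. Taking
    closures of the chosen sets makes each cell closed.\<close>
  define cell where "cell n r = (\<Inter>k\<in>{k. k \<le> n \<and> ternary_digit k r}. closure (U k)) \<inter> (\<Inter>k\<in>{k. k \<le> n \<and> \<not> ternary_digit k r}. - U k)" for n r
  \<comment> \<open>The first condition provides a compact set for the finite intersection property.
    The second replaces membership in a closure by membership in the open set itself. The third is
    consistency of every initial segment of digits.\<close>
  define valid where "valid r \<longleftrightarrow> (\<exists>k. compact (closure (U k)) \<and> ternary_digit k r) \<and>
    (\<forall>k. ternary_digit k r \<longrightarrow> (\<exists>l. closure (U l) \<subseteq> U k \<and> ternary_digit l r)) \<and> (\<forall>n. cell n r \<noteq> {})" for r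
  have valid_iff: "valid r \<longleftrightarrow> (\<exists>x. codes r x)" for r
  proof
    assume "\<exists>x. codes r x"
    then obtain x where x: "\<And>k. x \<in> U k \<longleftrightarrow> ternary_digit k r" by (auto simp: codes_def)
    have "x \<in> cell n r" for n using x closure_subset by (auto simp: cell_def)
    moreover have "\<exists>k. compact (closure (U k)) \<and> ternary_digit k r" using U(2)[of UNIV x] x by auto
    moreover have "\<exists>l. closure (U l) \<subseteq> U k \<and> ternary_digit l r" if "ternary_digit k r" for k
      using U(2)[OF Uo, of x k] x that by auto
    ultimately show "valid r" unfolding valid_def by blast
  next
    assume v: "valid r"
    then obtain k0 where k0: "compact (closure (U k0))" "ternary_digit k0 r" by (auto simp: valid_def)
    have "closure (U k0) \<inter> \<Inter>(range (\<lambda>n. cell n r)) \<noteq> {}"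
    proof (rule compact_imp_fip[OF k0(1)])
      fix T assume "T \<in> range (\<lambda>n. cell n r)"
      then show "closed T" using Uo by (auto simp: cell_def intro!: closed_Int closed_INT)
    next
      fix F' assume "finite F'" "F' \<subseteq> range (\<lambda>n. cell n r)"
      then obtain N where N: "finite N" "F' = (\<lambda>n. cell n r) ` N"
        by (meson finite_subset_image)
      let ?m = "Max (insert k0 N)"
      have "cell ?m r \<noteq> {}" using v by (simp add: valid_def)
      then obtain x where "x \<in> cell ?m r" by blast
      moreover have "cell ?m r \<subseteq> cell n r" if "n \<in> N" for n
      proof -
        have "n \<le> ?m" using N that by simp
        then show ?thesis by (auto simp: cell_def)
      qed
      moreover have "cell ?m r \<subseteq> closure (U k0)"
        using k0 N by (auto simp: cell_def)
      ultimately show "closure (U k0) \<inter> \<Inter>F' \<noteq> {}" using N by blast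
    qed
    then obtain x where x: "\<And>n. x \<in> cell n r" by blast
    have "x \<in> U k \<longleftrightarrow> ternary_digit k r" for k
    proof
      assume "ternary_digit k r"
      then obtain l where l: "closure (U l) \<subseteq> U k" "ternary_digit l r" using v by (auto simp: valid_def)
      then have "x \<in> closure (U l)" using x[of l] by (auto simp: cell_def)
      then show "x \<in> U k" using l by blast
    qed (use x[of k] in \<open>auto simp: cell_def\<close>)
    then show "\<exists>x. codes r x" by (auto simp: codes_def)
  qed
  define s where "s r = (if valid r then THE x. codes r x else undefined)" for r
  have s_codes: "codes r (s r)" if "valid r" for r
    using that uniq unfolding s_def valid_iff by (metis (mono_tags, lifting) theI)
  have cellm: "Measurable.pred borel (\<lambda>r. cell n r \<noteq> {})" for n
  proof -
    \<comment> \<open>A cell depends on \<open>r\<close> only through finitely many digits, so its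
      nonemptiness is a finite union of digit patterns, whatever the sets \<open>U k\<close>
      are.\<close>
    define c where "c I = (\<Inter>k\<in>{k. k \<le> n \<and> k \<in> I}. closure (U k)) \<inter> (\<Inter>k\<in>{k. k \<le> n \<and> k \<notin> I}. - U k)" for I
    have "cell n r \<noteq> {} \<longleftrightarrow> (\<exists>I\<in>Pow {..n}. c I \<noteq> {} \<and> (\<forall>k\<in>{..n}. ternary_digit k r \<longleftrightarrow> k \<in> I))" for r
    proof
      assume "cell n r \<noteq> {}"
      moreover have "cell n r = c {k. k \<le> n \<and> ternary_digit k r}"
        unfolding cell_def c_def by (intro arg_cong2[where f="(\<inter>)"] INF_cong) auto
      ultimately show "\<exists>I\<in>Pow {..n}. c I \<noteq> {} \<and> (\<forall>k\<in>{..n}. ternary_digit k r \<longleftrightarrow> k \<in> I)"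
        by (intro bexI[of _ "{k. k \<le> n \<and> ternary_digit k r}"]) auto
    next
      assume "\<exists>I\<in>Pow {..n}. c I \<noteq> {} \<and> (\<forall>k\<in>{..n}. ternary_digit k r \<longleftrightarrow> k \<in> I)"
      then obtain I where I: "c I \<noteq> {}" "\<And>k. k \<le> n \<Longrightarrow> ternary_digit k r \<longleftrightarrow> k \<in> I" by auto
      have "cell n r = c I"
        unfolding cell_def c_def using I(2) by (intro arg_cong2[where f="(\<inter>)"] INF_cong) auto
      then show "cell n r \<noteq> {}" using I by simp
    qed
    moreover have "Measurable.pred borel (\<lambda>r. \<exists>I\<in>Pow {..n}. c I \<noteq> {} \<and> (\<forall>k\<in>{..n}. ternary_digit k r \<longleftrightarrow> k \<in> I))"
      by (rule pred_intros_finite) auto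
    ultimately show ?thesis by simp
  qed
  have validm: "Measurable.pred borel valid"
    unfolding valid_def using cellm by measurable
  have sm: "s \<in> borel_measurable borel"
  proof -
    have "s \<in> measurable borel (sigma UNIV (range U))"
    proof (rule measurable_measure_of)
      fix S assume "S \<in> range U"
      then obtain k where k: "S = U k" by auto
      have "s -` S = {r. if valid r then ternary_digit k r else undefined \<in> U k}"
        using s_codes by (auto simp: k codes_def) (auto simp: s_def)
      then show "s -` S \<inter> space borel \<in> sets borel"
        using validm by simp
    qed auto
    moreover have "borel = (sigma UNIV (range U) :: 'a measure)"
      by (rule borel_eq_countable_basis[OF _ U(1)]) simp
    ultimately show ?thesis by simp
  qed
  have "s (j x) = x" for x
  proof -
    have "valid (j x)" using codes_j valid_iff by blast
    then show ?thesis using s_codes codes_j uniq by blast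
  qed
  moreover have "0 \<le> j x" "j x < 1" for x
    using ternary_code_bounds[of "\<lambda>k. x \<in> U k"] by (auto simp: j_def)
  ultimately show thesis using j sm by (intro that)
qed

section \<open>Inverse transform sampling and the decoding of measures\<close>

lemma ennreal_suminf_commute: "(\<Sum>i. \<Sum>m. f i m) = (\<Sum>m. \<Sum>i. f i m :: ennreal)"
  using nn_integral_suminf[of "\<lambda>i m. f i m" "count_space (UNIV :: nat set)"]
  by (simp add: nn_integral_count_space_nat)

text \<open>Generalized inverse of a distribution function carried by \<open>{0..<1}\<close>. Only
  rational arguments occur, so the infimum is countable and measurable in the values of
  \<open>F\<close>. The default value 1 keeps the family bounded for every \<open>F\<close>, also
  for one that is no distribution function.\<close>

definition quantile :: "(rat \<Rightarrow> real) \<Rightarrow> real \<Rightarrow> real" where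
  "quantile F u = (INF q. if 0 \<le> q \<and> q \<le> 1 \<and> u \<le> F q then of_rat q else 1)"

lemma measurable_quantile:
  assumes [measurable]: "\<And>q. (\<lambda>x. F x q) \<in> borel_measurable M" "u \<in> borel_measurable M"
  shows "(\<lambda>x. quantile (F x) (u x)) \<in> borel_measurable M"
proof -
  have "(\<lambda>x. if 0 \<le> q \<and> q \<le> 1 \<and> u x \<le> F x q then of_rat q else 1 :: real) \<in> borel_measurable M" for q
    by measurable
  then show ?thesis
    unfolding quantile_def
    by (intro borel_measurable_cINF) (auto intro!: bdd_belowI[of _ 0])
qed

text \<open>The Galois connection between a distribution function and its inverse. From left to
  right it is right continuity along \<open>x + 1 / Suc n\<close>; from right to left it is density
  of the rationals. The condition \<open>u \<le> F 1\<close> keeps \<open>u\<close> within the total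
  mass.\<close>

lemma quantile_le_iff:
  assumes fin: "finite_measure \<nu>" and sets: "sets \<nu> = sets borel" and supp: "emeasure \<nu> (- {0..<1}) = 0"
    and F: "\<And>q. F q = measure \<nu> {..of_rat q}" and u: "0 < u" "u \<le> F 1"
  shows "quantile F u \<le> x \<longleftrightarrow> u \<le> measure \<nu> {..x}"
proof -
  interpret finite_measure \<nu> by fact
  note [measurable_cong] = sets
  have spn: "space \<nu> = UNIV" using sets_eq_imp_space_eq[OF sets] by simp
  let ?f = "\<lambda>q. if 0 \<le> q \<and> q \<le> 1 \<and> u \<le> F q then of_rat q else 1 :: real"
  have bdd: "bdd_below (range ?f)" by (auto intro!: bdd_belowI[of _ 0])
  have ge0: "0 \<le> quantile F u" unfolding quantile_def by (intro cINF_greatest) auto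
  have le1: "quantile F u \<le> 1" unfolding quantile_def by (rule cINF_lower2[OF bdd, of 1]) auto
  have le: "quantile F u \<le> of_rat q" if "0 \<le> q" "q \<le> 1" "u \<le> F q" for q
    unfolding quantile_def using that by (intro cINF_lower2[OF bdd, of q]) auto
  consider "x < 0" | "0 \<le> x" "x < 1" | "1 \<le> x" by linarith
  then show ?thesis
  proof cases
    case 1
    have "emeasure \<nu> {..x} \<le> emeasure \<nu> (- {0..<1})" using 1 by (intro emeasure_mono) (auto simp: sets)
    then have "measure \<nu> {..x} = 0" using supp by (simp add: measure_def)
    then show ?thesis using 1 ge0 u by auto
  next
    case 3
    have "F 1 \<le> measure \<nu> {..x}" unfolding F using 3 by (intro finite_measure_mono) (auto simp: sets)
    then show ?thesis using 3 le1 u by auto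
  next
    case 2
    show ?thesis
    proof
      assume Q: "quantile F u \<le> x"
      have "u \<le> measure \<nu> {..x + 1 / Suc n}" for n
      proof (cases "x + 1 / Suc n < 1")
        case True
        have "quantile F u < x + 1 / Suc n" using Q by (smt (verit) divide_pos_pos of_nat_0_less_iff zero_less_Suc)
        then obtain q where q: "?f q < x + 1 / Suc n"
          unfolding quantile_def using cINF_less_iff[OF _ bdd] by auto
        then have q': "u \<le> F q" "of_rat q < x + 1 / Suc n" using True by (auto split: if_splits)
        have "F q \<le> measure \<nu> {..x + 1 / Suc n}"
          unfolding F using q'(2) by (intro finite_measure_mono) (auto simp: sets)
        then show ?thesis using q' by simp
      next
        case False
        have "F 1 \<le> measure \<nu> {..x + 1 / Suc n}"
          unfolding F using False by (intro finite_measure_mono) (auto simp: sets)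
        then show ?thesis using u by simp
      qed
      moreover have "(\<lambda>n. measure \<nu> {..x + 1 / Suc n}) \<longlonglongrightarrow> measure \<nu> (\<Inter>n. {..x + 1 / Suc n})"
        by (intro finite_Lim_measure_decseq) (auto simp: sets decseq_def field_simps intro: order_trans)
      moreover have "(\<Inter>n. {..x + 1 / Suc n}) = {..x}"
      proof safe
        fix y assume y: "y \<in> (\<Inter>n. {..x + 1 / Suc n})"
        have "(\<lambda>n. x + 1 / Suc n) \<longlonglongrightarrow> x + 0"
          by (intro tendsto_intros LIMSEQ_Suc lim_1_over_n)
        then show "y \<le> x" using y by (intro LIMSEQ_le_const) auto
      qed (auto intro: order_trans)
      ultimately show "u \<le> measure \<nu> {..x}" by (intro LIMSEQ_le_const) auto
    next
      assume u': "u \<le> measure \<nu> {..x}"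
      show "quantile F u \<le> x"
      proof (rule field_le_epsilon)
        fix e :: real assume "e > 0"
        then have "x < min 1 (x + e)" using 2 by auto
        then obtain q where q: "x < of_rat q" "of_rat q < min 1 (x + e)" using of_rat_dense by blast
        have "measure \<nu> {..x} \<le> F q" unfolding F using q(1) by (intro finite_measure_mono) (auto simp: sets)
        moreover have "0 \<le> q" "q \<le> 1" using q 2 by (smt (verit) zero_le_of_rat_iff of_rat_le_1_iff)+
        ultimately have "quantile F u \<le> of_rat q" using u' by (intro le) auto
        then show "quantile F u \<le> x + e" using q by simp
      qed
    qed
  qed
qed

text \<open>Lebesgue measure on \<open>{0<..F 1}\<close>, which has the total mass of
  \<open>\<nu>\<close>, is mapped by the quantile function to a measure with the same distribution
  function as \<open>\<nu>\<close>.\<close>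

lemma emeasure_quantile:
  assumes fin: "finite_measure \<nu>" and sets: "sets \<nu> = sets borel" and supp: "emeasure \<nu> (- {0..<1}) = 0"
    and F: "\<And>q. F q = measure \<nu> {..of_rat q}" and B: "B \<in> sets borel"
  shows "emeasure lborel {u. 0 < u \<and> u \<le> F 1 \<and> quantile F u \<in> B} = emeasure \<nu> B"
proof -
  interpret finite_measure \<nu> by fact
  have spn: "space \<nu> = UNIV" using sets_eq_imp_space_eq[OF sets] by simp
  let ?L = "restrict_space lborel {0<..F 1}"
  have F1: "0 \<le> F 1" by (simp add: F)
  have eL: "emeasure ?L A = emeasure lborel A" if "A \<subseteq> {0<..F 1}" for A
    using that by (intro emeasure_restrict_space) auto
  have [measurable]: "quantile F \<in> borel_measurable ?L"
    by (intro measurable_restrict_space1 measurable_quantile) auto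
  let ?Q = "distr ?L borel (quantile F)"
  have ed: "emeasure ?Q A = emeasure lborel {u. 0 < u \<and> u \<le> F 1 \<and> quantile F u \<in> A}" if "A \<in> sets borel" for A
    using that by (subst emeasure_distr) (auto simp: eL space_restrict_space intro!: arg_cong[where f="emeasure lborel"] split: if_splits)
  have "emeasure lborel {u. 0 < u \<and> u \<le> F 1 \<and> quantile F u \<in> UNIV} \<le> emeasure lborel {0..F 1}"
    by (intro emeasure_mono) auto
  also have "\<dots> < \<infinity>" using F1 by simp
  finally have "emeasure ?Q (space ?Q) < \<infinity>"
    using ed[of UNIV] by simp
  then have finQ: "finite_measure ?Q" by (intro finite_measureI) auto
  have "cdf ?Q x = cdf \<nu> x" for x
  proof -
    have le: "measure \<nu> {..x} \<le> F 1"
    proof -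
      have "emeasure \<nu> {..x} \<le> emeasure \<nu> ({..1} \<union> - {0..<1})"
        by (intro emeasure_mono) (auto simp: sets)
      also have "\<dots> \<le> emeasure \<nu> {..1} + emeasure \<nu> (- {0..<1})"
        by (intro emeasure_subadditive) (auto simp: sets)
      finally show ?thesis using supp by (simp add: F emeasure_eq_measure)
    qed
    have "{u. 0 < u \<and> u \<le> F 1 \<and> quantile F u \<in> {..x}} = {0<..measure \<nu> {..x}}"
      using quantile_le_iff[OF fin sets supp F] le by (auto intro: order_trans)
    then have "emeasure ?Q {..x} = ennreal (measure \<nu> {..x})"
      using ed[of "{..x}"] by simp
    then show ?thesis by (simp add: cdf_def measure_def)
  qed
  then have "?Q = \<nu>"
    using fin sets finQ spn by (intro cdf_unique') (auto simp: finite_borel_measure_def finite_borel_measure_axioms_def)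
  then show ?thesis using ed[OF B] by simp
qed

text \<open>A measure is coded by the distribution functions of the images in \<open>[0, 1)\<close> of its restrictions
  to countably many bounded pieces, and recovered from the code by inverse transform sampling from
  Lebesgue measure; with this decoding measurability in the code is an instance of Fubini.\<close>

theorem radon_algebra_retract:
  fixes j :: "'a::{second_countable_topology, t2_space} \<Rightarrow> real"
  assumes j [measurable]: "j \<in> borel_measurable borel" and s [measurable]: "s \<in> borel_measurable borel"
    and sj: "\<And>x. s (j x) = x" and j01: "\<And>x. 0 \<le> j x" "\<And>x. j x < 1"
    and D [measurable]: "\<And>m. D m \<in> sets borel" and dD: "disjoint_family D" and UD: "(\<Union>m. D m) = UNIV"
    and cD: "\<And>m. compact (closure (D m))" and bD: "\<And>B. compact (closure B) \<Longrightarrow> \<exists>n. B \<subseteq> (\<Union>m<n. D m)"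
  defines "code \<equiv> \<lambda>(\<mu> :: 'a measure) (m, q). measure \<mu> {x\<in>D m. j x \<le> of_rat q}"
  obtains dec :: "(nat \<times> rat \<Rightarrow> real) \<Rightarrow> 'a measure" where
    "dec \<in> measurable borel radon_algebra" "\<And>\<mu>. \<mu> \<in> radon_measures \<Longrightarrow> dec (code \<mu>) = \<mu>"
proof -
  \<comment> \<open>The parameters \<open>u\<close> whose sample lies in the piece
    \<open>D m\<close> and in \<open>B\<close>. The bound \<open>u \<le> y (m, 1)\<close> limits the
    mass of the piece for every \<open>y\<close>, so \<open>dec y\<close> is a Radon measure even
    when \<open>y\<close> is no code.\<close>
  define A where "A m y B = {u. 0 < u \<and> u \<le> y (m, 1) \<and> s (quantile (\<lambda>q. y (m, q)) u) \<in> D m \<inter> B}"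
    for m and y :: "nat \<times> rat \<Rightarrow> real" and B
  define dec where "dec y = measure_of UNIV (sets borel) (\<lambda>B. \<Sum>m. emeasure lborel (A m y B))" for y
  have ymeas [measurable]: "(\<lambda>y :: nat \<times> rat \<Rightarrow> real. y i) \<in> borel_measurable borel" for i
    by (intro borel_measurable_continuous_onI continuous_on_product_coordinates)
  have Asets [measurable]: "A m y B \<in> sets borel" if [measurable]: "B \<in> sets borel" for m y B
  proof -
    have [measurable]: "quantile (\<lambda>q. y (m, q)) \<in> borel_measurable borel" by (rule measurable_quantile) auto
    have "Measurable.pred borel (\<lambda>u. 0 < u \<and> u \<le> y (m, 1) \<and> s (quantile (\<lambda>q. y (m, q)) u) \<in> D m \<inter> B)"
      by measurable
    then show ?thesis unfolding A_def by (simp add: pred_def)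
  qed
  have setsdec [simp]: "sets (dec y) = sets borel" for y
    unfolding dec_def using sets.sigma_sets_eq[of "borel :: 'a measure"] by simp
  have em: "emeasure (dec y) B = (\<Sum>m. emeasure lborel (A m y B))" if "B \<in> sets borel" for y B
  proof (rule emeasure_measure_of[OF dec_def[of y]])
    show "positive (sets (dec y)) (\<lambda>B. \<Sum>m. emeasure lborel (A m y B))" by (simp add: positive_def A_def)
    show "countably_additive (sets (dec y)) (\<lambda>B. \<Sum>m. emeasure lborel (A m y B))"
    proof (rule countably_additiveI)
      fix C :: "nat \<Rightarrow> 'a set" assume C: "range C \<subseteq> sets (dec y)" "disjoint_family C"
      have Cb [measurable]: "C i \<in> sets borel" for i using C(1) by auto
      have "(\<Sum>i. emeasure lborel (A m y (C i))) = emeasure lborel (A m y (\<Union>i. C i))" for m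
      proof -
        have "(\<Sum>i. emeasure lborel (A m y (C i))) = emeasure lborel (\<Union>i. A m y (C i))"
        proof (rule suminf_emeasure)
          show "range (\<lambda>i. A m y (C i)) \<subseteq> sets lborel" using Asets[OF Cb] by auto
          show "disjoint_family (\<lambda>i. A m y (C i))" using C(2) by (fastforce simp: disjoint_family_on_def A_def)
        qed
        also have "(\<Union>i. A m y (C i)) = A m y (\<Union>i. C i)" by (auto simp: A_def)
        finally show ?thesis .
      qed
      then show "(\<Sum>i. \<Sum>m. emeasure lborel (A m y (C i))) = (\<Sum>m. emeasure lborel (A m y (\<Union>i. C i)))"
        by (subst ennreal_suminf_commute) simp
    qed
  qed (use that in \<open>auto simp: dec_def\<close>)
  have rad: "dec y \<in> radon_measures" for y
    unfolding radon_measures_iff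
  proof (intro conjI ballI impI)
    fix B :: "'a set" assume B: "B \<in> sets borel" "compact (closure B)"
    obtain n where n: "B \<subseteq> (\<Union>m<n. D m)" using bD[OF B(2)] by blast
    have Ae: "A m y B = {}" if "m \<notin> {..<n}" for m
    proof -
      have "D m \<inter> D k = {}" if "k < n" for k
        using \<open>m \<notin> {..<n}\<close> that by (intro disjoint_family_onD[OF dD]) auto
      then have "D m \<inter> (\<Union>k<n. D k) = {}" by auto
      then have "D m \<inter> B = {}" using n by auto
      then show ?thesis by (simp add: A_def)
    qed
    have "emeasure (dec y) B = (\<Sum>m<n. emeasure lborel (A m y B))"
      unfolding em[OF B(1)] using Ae by (intro suminf_finite) auto
    also have "\<dots> \<le> (\<Sum>m<n. emeasure lborel {0..\<bar>y (m, 1)\<bar>})"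
      by (intro sum_mono emeasure_mono) (auto simp: A_def)
    also have "\<dots> < \<infinity>" by simp
    finally show "emeasure (dec y) B < \<infinity>" .
  qed simp
  have "dec \<in> measurable borel radon_algebra"
  proof (rule measurable_radon_algebra)
    fix B :: "'a set" assume [measurable]: "B \<in> sets borel"
    have "(\<lambda>y. emeasure lborel (A m y B)) \<in> borel_measurable borel" for m
    proof -
      let ?R = "{p :: (nat \<times> rat \<Rightarrow> real) \<times> real. 0 < snd p \<and> snd p \<le> fst p (m, 1) \<and> s (quantile (\<lambda>q. fst p (m, q)) (snd p)) \<in> D m \<inter> B}"
      have c: "(\<lambda>p :: (nat \<times> rat \<Rightarrow> real) \<times> real. fst p i) \<in> borel_measurable (borel \<Otimes>\<^sub>M lborel)" for i
        by (rule measurable_compose[OF measurable_fst ymeas])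
      have [measurable]: "(\<lambda>p :: (nat \<times> rat \<Rightarrow> real) \<times> real. quantile (\<lambda>q. fst p (m, q)) (snd p)) \<in> borel_measurable (borel \<Otimes>\<^sub>M lborel)"
        by (intro measurable_quantile c) measurable
      have "Measurable.pred (borel \<Otimes>\<^sub>M lborel) (\<lambda>p. p \<in> ?R)"
        using c[of "(m, 1)"] by measurable
      then have R: "?R \<in> sets (borel \<Otimes>\<^sub>M lborel)" by (simp add: pred_def space_pair_measure)
      have "A m y B = Pair y -` ?R" for y by (auto simp: A_def)
      then show ?thesis using lborel.measurable_emeasure_Pair[OF R] by simp
    qed
    then show "(\<lambda>y. emeasure (dec y) B) \<in> borel_measurable borel"
      by (simp add: em)
  qed (rule rad)
  moreover have "dec (code \<mu>) = \<mu>" if \<mu>: "\<mu> \<in> radon_measures" for \<mu>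
  proof (rule measure_eqI)
    have s\<mu> [measurable_cong]: "sets \<mu> = sets borel" using \<mu> by (rule sets_radon)
    have sp\<mu>: "space \<mu> = UNIV" using sets_eq_imp_space_eq[OF s\<mu>] by simp
    show "sets (dec (code \<mu>)) = sets \<mu>" by (simp add: s\<mu>)
    fix B assume "B \<in> sets (dec (code \<mu>))"
    then have B [measurable]: "B \<in> sets borel" by simp
    have "emeasure lborel (A m (code \<mu>) B) = emeasure \<mu> (D m \<inter> B)" for m
    proof -
      define \<nu> where "\<nu> = distr (restrict_space \<mu> (D m)) borel j"
      have [measurable]: "j \<in> borel_measurable (restrict_space \<mu> (D m))"
        by (intro measurable_restrict_space1) measurable
      have e\<nu>: "emeasure \<nu> C = emeasure \<mu> {x\<in>D m. j x \<in> C}" if "C \<in> sets borel" for C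
        using that unfolding \<nu>_def
        by (subst emeasure_distr) (auto simp: emeasure_restrict_space space_restrict_space s\<mu> sp\<mu> intro!: arg_cong[where f="emeasure \<mu>"])
      have fin: "finite_measure \<nu>"
      proof (rule finite_measureI)
        have "emeasure \<nu> (space \<nu>) = emeasure \<mu> (D m)" by (simp add: e\<nu> \<nu>_def[THEN arg_cong[where f=space]])
        also have "\<dots> < \<infinity>" using \<mu> cD D by (auto simp: radon_measures_iff)
        finally show "emeasure \<nu> (space \<nu>) \<noteq> \<infinity>" by simp
      qed
      have F: "code \<mu> (m, q) = measure \<nu> {..of_rat q}" for q
        by (simp add: code_def measure_def e\<nu>)
      have "emeasure lborel (A m (code \<mu>) B) = emeasure lborel {u. 0 < u \<and> u \<le> code \<mu> (m, 1) \<and> quantile (\<lambda>q. code \<mu> (m, q)) u \<in> s -` (D m \<inter> B)}"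
        by (simp add: A_def)
      also have "\<dots> = emeasure \<nu> (s -` (D m \<inter> B))"
      proof (rule emeasure_quantile[OF fin _ _ F])
        show "emeasure \<nu> (- {0..<1}) = 0" using j01 by (simp add: e\<nu> not_le not_less)
        have "s -` (D m \<inter> B) \<inter> space borel \<in> sets borel" by measurable
        then show "s -` (D m \<inter> B) \<in> sets borel" by simp
      qed (simp add: \<nu>_def)
      also have "\<dots> = emeasure \<mu> {x\<in>D m. j x \<in> s -` (D m \<inter> B)}"
      proof (rule e\<nu>)
        have "s -` (D m \<inter> B) \<inter> space borel \<in> sets borel" by measurable
        then show "s -` (D m \<inter> B) \<in> sets borel" by simp
      qed
      also have "{x\<in>D m. j x \<in> s -` (D m \<inter> B)} = D m \<inter> B" using sj by auto
      finally show ?thesis .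
    qed
    then have "emeasure (dec (code \<mu>)) B = (\<Sum>m. emeasure \<mu> (D m \<inter> B))" by (simp add: em)
    also have "\<dots> = emeasure \<mu> (\<Union>m. D m \<inter> B)"
      using dD by (intro suminf_emeasure) (auto simp: disjoint_family_on_def s\<mu>)
    also have "(\<Union>m. D m \<inter> B) = B" using UD by auto
    finally show "emeasure (dec (code \<mu>)) B = emeasure \<mu> B" .
  qed
  ultimately show thesis using that by blast
qed

section \<open>Inverse limits\<close>

text \<open>A Markov chain run backwards in its index: state \<open>n\<close> arises from state
  \<open>n + 1\<close> and independent noise of law \<open>K n\<close>, and
  \<open>consistent\<close> says that the prescribed marginals \<open>Q n\<close> are compatible
  with this. The pair \<open>code\<close>, \<open>dec\<close> transports the state space into a
  Polish space.\<close>

locale backward_recursion =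
  fixes N :: "'b measure" and Q K :: "nat \<Rightarrow> 'b measure" and f :: "nat \<Rightarrow> 'b \<Rightarrow> 'b \<Rightarrow> 'b"
    and code :: "'b \<Rightarrow> 'y::polish_space" and dec :: "'y \<Rightarrow> 'b"
  assumes prob_Q: "\<And>n. prob_space (Q n)" and prob_K: "\<And>n. prob_space (K n)"
    and sets_Q [measurable_cong]: "\<And>n. sets (Q n) = sets N"
    and sets_K [measurable_cong]: "\<And>n. sets (K n) = sets N"
    and measurable_f: "\<And>n. (\<lambda>(x, k). f n x k) \<in> measurable (N \<Otimes>\<^sub>M N) N"
    and consistent: "\<And>n. distr (Q (Suc n) \<Otimes>\<^sub>M K n) N (\<lambda>(x, k). f n x k) = Q n"
    and measurable_code [measurable]: "code \<in> measurable N borel"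
    and measurable_dec [measurable]: "dec \<in> measurable borel N"
    and dec_code: "\<And>x. x \<in> space N \<Longrightarrow> dec (code x) = x"
begin

lemma measurable_f' [measurable (raw)]:
  "g \<in> measurable M N \<Longrightarrow> h \<in> measurable M N \<Longrightarrow> (\<lambda>x. f n (g x) (h x)) \<in> measurable M N"
  using measurable_compose[OF measurable_Pair measurable_f, of g M h n] by simp

text \<open>The chain started at index \<open>n\<close> in \<open>x\<close>; coordinate
  \<open>i\<close> of \<open>w\<close> drives the step from \<open>i + 1\<close> to
  \<open>i\<close>. Indices above \<open>n\<close> receive the starting state as a dummy
  value.\<close>

primrec traj :: "nat \<Rightarrow> 'b \<Rightarrow> (nat \<Rightarrow> 'b) \<Rightarrow> nat \<Rightarrow> 'b" where
  "traj 0 x w = (\<lambda>j. x)"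
| "traj (Suc n) x w = (\<lambda>j. if j \<le> n then traj n (f n x (w n)) w j else x)"

lemma traj_same: "traj n x w n = x"
  by (cases n) auto

lemma traj_cong: "(\<And>i. i < n \<Longrightarrow> w i = w' i) \<Longrightarrow> traj n x w = traj n x w'"
  by (induction n arbitrary: x) auto

lemma measurable_traj:
  assumes "g \<in> measurable M N" "\<And>i. i < n \<Longrightarrow> (\<lambda>p. w p i) \<in> measurable M N"
  shows "(\<lambda>p. traj n (g p) (w p) j) \<in> measurable M N"
  using assms
proof (induction n arbitrary: g)
  case (Suc n)
  have [measurable]: "(\<lambda>p. traj n (f n (g p) (w p n)) (w p) j) \<in> measurable M N"
    using Suc by (intro Suc.IH measurable_f') auto
  show ?case using Suc by (cases "j \<le> n") auto
qed simp

abbreviation noise :: "nat \<Rightarrow> (nat \<Rightarrow> 'b) measure" where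
  "noise n \<equiv> PiM {..<n} K"

lemma measurable_noise: "i < n \<Longrightarrow> (\<lambda>w. w i) \<in> measurable (noise n) N"
  by (subst measurable_cong_sets[OF refl sets_K[symmetric, of i]]) (auto intro: measurable_component_singleton)

lemma prob_noise: "prob_space (noise n)"
  by (intro prob_space_PiM prob_K)

text \<open>The first backward step uses only coordinate \<open>n\<close> of the noise. Integrating
  that coordinate out and applying \<open>consistent\<close> leaves a state of law
  \<open>Q n\<close> and independent noise with coordinates below \<open>n\<close>.\<close>

lemma nn_integral_noise_step:
  assumes G: "case_prod G \<in> borel_measurable (N \<Otimes>\<^sub>M noise n)"
  shows "(\<integral>\<^sup>+x. \<integral>\<^sup>+w. G (f n x (w n)) (restrict w {..<n}) \<partial>noise (Suc n) \<partial>Q (Suc n))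
       = (\<integral>\<^sup>+z. \<integral>\<^sup>+w. G z w \<partial>noise n \<partial>Q n)"
proof -
  interpret K: prob_space "K i" for i by (rule prob_K)
  interpret noise: prob_space "noise m" for m by (rule prob_noise)
  interpret product_sigma_finite K by unfold_locales
  have Gz: "(\<lambda>z. \<integral>\<^sup>+w. G z w \<partial>noise n) \<in> borel_measurable N"
    using noise.borel_measurable_nn_integral_fst[OF G] by simp
  have comp: "(\<lambda>w. w n) \<in> measurable (noise (Suc n)) N" by (rule measurable_noise) simp
  have restr: "(\<lambda>w. restrict w {..<n}) \<in> measurable (noise (Suc n)) (noise n)"
    by (intro measurable_restrict_subset) auto
  have "(\<integral>\<^sup>+w. G (f n x (w n)) (restrict w {..<n}) \<partial>noise (Suc n)) = (\<integral>\<^sup>+k. \<integral>\<^sup>+w. G (f n x k) w \<partial>noise n \<partial>K n)"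
    if x: "x \<in> space (Q (Suc n))" for x
  proof -
    have xN: "x \<in> space N" using x sets_eq_imp_space_eq[OF sets_Q] by simp
    have "(\<lambda>w. (f n x (w n), restrict w {..<n})) \<in> measurable (noise (Suc n)) (N \<Otimes>\<^sub>M noise n)"
      using comp restr xN by measurable
    from measurable_compose[OF this G]
    have "(\<lambda>w. G (f n x (w n)) (restrict w {..<n})) \<in> borel_measurable (noise (Suc n))" by simp
    then have "(\<integral>\<^sup>+w. G (f n x (w n)) (restrict w {..<n}) \<partial>noise (Suc n)) =
      (\<integral>\<^sup>+k. \<integral>\<^sup>+w. G (f n x ((w(n := k)) n)) (restrict (w(n := k)) {..<n}) \<partial>noise n \<partial>K n)"
      unfolding lessThan_Suc by (intro product_nn_integral_insert_rev) auto
    also have "\<dots> = (\<integral>\<^sup>+k. \<integral>\<^sup>+w. G (f n x k) w \<partial>noise n \<partial>K n)"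
    proof (intro nn_integral_cong)
      fix k w assume "w \<in> space (noise n)"
      then have "restrict (w(n := k)) {..<n} = w"
        by (auto simp: space_PiM PiE_def extensional_def restrict_def fun_eq_iff)
      then show "G (f n x ((w(n := k)) n)) (restrict (w(n := k)) {..<n}) = G (f n x k) w" by simp
    qed
    finally show ?thesis .
  qed
  then have "(\<integral>\<^sup>+x. \<integral>\<^sup>+w. G (f n x (w n)) (restrict w {..<n}) \<partial>noise (Suc n) \<partial>Q (Suc n))
     = (\<integral>\<^sup>+x. \<integral>\<^sup>+k. (\<integral>\<^sup>+w. G (f n x k) w \<partial>noise n) \<partial>K n \<partial>Q (Suc n))"
    by (intro nn_integral_cong)
  also have "\<dots> = (\<integral>\<^sup>+p. (\<integral>\<^sup>+w. G (case p of (x, k) \<Rightarrow> f n x k) w \<partial>noise n) \<partial>(Q (Suc n) \<Otimes>\<^sub>M K n))"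
  proof (subst K.nn_integral_fst[symmetric])
    have "(\<lambda>(x, k). f n x k) \<in> measurable (Q (Suc n) \<Otimes>\<^sub>M K n) N"
      using measurable_f by (simp cong: measurable_cong_sets)
    from measurable_compose[OF this Gz]
    show "(\<lambda>p. \<integral>\<^sup>+w. G (case p of (x, k) \<Rightarrow> f n x k) w \<partial>noise n) \<in> borel_measurable (Q (Suc n) \<Otimes>\<^sub>M K n)" .
  qed simp
  also have "\<dots> = (\<integral>\<^sup>+z. (\<integral>\<^sup>+w. G z w \<partial>noise n) \<partial>distr (Q (Suc n) \<Otimes>\<^sub>M K n) N (\<lambda>(x, k). f n x k))"
  proof (rule nn_integral_distr[symmetric])
    show "(\<lambda>(x, k). f n x k) \<in> measurable (Q (Suc n) \<Otimes>\<^sub>M K n) N"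
      using measurable_f by (simp cong: measurable_cong_sets)
  qed (use Gz in simp)
  finally show ?thesis unfolding consistent .
qed

definition fidi :: "nat \<Rightarrow> nat set \<Rightarrow> (nat \<Rightarrow> 'y) measure" where
  "fidi n J = distr (Q n \<Otimes>\<^sub>M noise n) (PiM J (\<lambda>_. borel)) (\<lambda>(x, w). \<lambda>j\<in>J. code (traj n x w j))"

lemma measurable_fidi_map:
  "(\<lambda>(x, w). \<lambda>j\<in>J. code (traj n x w j)) \<in> measurable (Q n \<Otimes>\<^sub>M noise n) (PiM J (\<lambda>_. borel))"
proof -
  have "(\<lambda>p. \<lambda>j\<in>J. code (traj n (fst p) (snd p) j)) \<in> measurable (Q n \<Otimes>\<^sub>M noise n) (PiM J (\<lambda>_. borel))"
  proof (intro measurable_restrict measurable_compose[OF _ measurable_code] measurable_traj)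
    show "fst \<in> measurable (Q n \<Otimes>\<^sub>M noise n) N" by measurable
    show "(\<lambda>p. snd p i) \<in> measurable (Q n \<Otimes>\<^sub>M noise n) N" if "i < n" for i
      by (rule measurable_compose[OF measurable_snd measurable_noise[OF that]])
  qed
  then show ?thesis by (simp add: case_prod_beta')
qed

lemma prob_fidi: "prob_space (fidi n J)"
proof -
  interpret Q: prob_space "Q n" by (rule prob_Q)
  interpret noise: prob_space "noise n" by (rule prob_noise)
  interpret P: pair_prob_space "Q n" "noise n" ..
  show ?thesis unfolding fidi_def by (intro P.prob_space_distr measurable_fidi_map)
qed

lemma nn_integral_fidi:
  assumes [measurable]: "F \<in> borel_measurable (PiM J (\<lambda>_. borel))"
  shows "(\<integral>\<^sup>+y. F y \<partial>fidi n J) = (\<integral>\<^sup>+x. \<integral>\<^sup>+w. F (\<lambda>j\<in>J. code (traj n x w j)) \<partial>noise n \<partial>Q n)"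
proof -
  interpret noise: prob_space "noise n" by (rule prob_noise)
  have "(\<integral>\<^sup>+y. F y \<partial>fidi n J) = (\<integral>\<^sup>+p. F (case p of (x, w) \<Rightarrow> \<lambda>j\<in>J. code (traj n x w j)) \<partial>(Q n \<Otimes>\<^sub>M noise n))"
    unfolding fidi_def by (intro nn_integral_distr measurable_fidi_map) simp
  also have "\<dots> = (\<integral>\<^sup>+x. \<integral>\<^sup>+w. F (\<lambda>j\<in>J. code (traj n x w j)) \<partial>noise n \<partial>Q n)"
    by (subst noise.nn_integral_fst[symmetric]) (use measurable_compose[OF measurable_fidi_map assms] in auto)
  finally show ?thesis .
qed

text \<open>By \<open>consistent\<close>, the law of the first \<open>n + 1\<close> states does not depend on how much later the recursion starts.\<close>

lemma fidi_step: "J \<subseteq> {..n} \<Longrightarrow> fidi (Suc n) J = fidi n J"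
proof (rule measure_eqI)
  assume J: "J \<subseteq> {..n}"
  show "sets (fidi (Suc n) J) = sets (fidi n J)" by (simp add: fidi_def)
  fix X assume "X \<in> sets (fidi (Suc n) J)"
  then have X: "X \<in> sets (PiM J (\<lambda>_. borel))" by (simp add: fidi_def)
  then have [measurable]: "indicator X \<in> borel_measurable (PiM J (\<lambda>_. borel))" by simp
  define G where "G x w = (indicator X (\<lambda>j\<in>J. code (traj n x w j)) :: ennreal)" for x w
  have sQ: "sets (Q n \<Otimes>\<^sub>M noise n) = sets (N \<Otimes>\<^sub>M noise n)" by (intro sets_pair_measure_cong sets_Q refl)
  have Gm: "case_prod G \<in> borel_measurable (N \<Otimes>\<^sub>M noise n)"
    using measurable_compose[OF measurable_fidi_map[of n J], of "indicator X" borel] X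
    by (subst measurable_cong_sets[OF sQ[symmetric] refl]) (simp add: G_def[abs_def] case_prod_beta')
  have e: "emeasure (fidi n J) X = (\<integral>\<^sup>+y. indicator X y \<partial>fidi n J)" for n
    using X by (simp add: fidi_def)
  have "emeasure (fidi (Suc n) J) X = (\<integral>\<^sup>+x. \<integral>\<^sup>+w. indicator X (\<lambda>j\<in>J. code (traj (Suc n) x w j)) \<partial>noise (Suc n) \<partial>Q (Suc n))"
    unfolding e by (intro nn_integral_fidi) measurable
  also have "\<dots> = (\<integral>\<^sup>+x. \<integral>\<^sup>+w. G (f n x (w n)) (restrict w {..<n}) \<partial>noise (Suc n) \<partial>Q (Suc n))"
  proof (intro nn_integral_cong)
    fix x w
    have "traj n (f n x (w n)) (restrict w {..<n}) = traj n (f n x (w n)) w"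
      by (rule traj_cong) simp
    moreover have "restrict (\<lambda>j. code (traj (Suc n) x w j)) J = restrict (\<lambda>j. code (traj n (f n x (w n)) w j)) J"
      using J by (auto simp: restrict_def fun_eq_iff)
    ultimately show "indicator X (\<lambda>j\<in>J. code (traj (Suc n) x w j)) = G (f n x (w n)) (restrict w {..<n})"
      unfolding G_def by simp
  qed
  also have "\<dots> = (\<integral>\<^sup>+z. \<integral>\<^sup>+w. G z w \<partial>noise n \<partial>Q n)"
    using Gm by (rule nn_integral_noise_step)
  also have "\<dots> = emeasure (fidi n J) X"
    unfolding e G_def by (intro nn_integral_fidi[symmetric]) measurable
  finally show "emeasure (fidi (Suc n) J) X = emeasure (fidi n J) X" .
qed

lemma fidi_mono: "J \<subseteq> {..n} \<Longrightarrow> n \<le> m \<Longrightarrow> fidi m J = fidi n J"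
proof (induction m)
  case (Suc m)
  show ?case
  proof (cases "n = Suc m")
    case False
    then have "n \<le> m" "J \<subseteq> {..m}" using Suc.prems by auto
    then show ?thesis using Suc.IH Suc.prems(1) fidi_step[of J m] by simp
  qed simp
qed auto

lemma distr_fidi:
  assumes "J \<subseteq> H"
  shows "distr (fidi n H) (PiM J (\<lambda>_. borel)) (\<lambda>y. restrict y J) = fidi n J"
  unfolding fidi_def
proof (subst distr_distr[OF measurable_restrict_subset[OF assms] measurable_fidi_map], intro distr_cong refl)
  fix p show "((\<lambda>y. restrict y J) \<circ> (\<lambda>(x, w). \<lambda>j\<in>H. code (traj n x w j))) p = (case p of (x, w) \<Rightarrow> \<lambda>j\<in>J. code (traj n x w j))"
    using assms by (cases p) (auto simp: restrict_def fun_eq_iff)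
qed

text \<open>Each index set is served by the chain started at its maximum; later starts give the same
  law. Inserting 0 covers the empty set.\<close>

lemma consistent_fidi: "projective_family UNIV (\<lambda>J. fidi (Max (insert 0 J)) J) (\<lambda>_. borel)"
proof (rule projective_family.intro)
  fix J H :: "nat set" assume JH: "J \<subseteq> H" "finite H"
  then have "fidi (Max (insert 0 H)) J = fidi (Max (insert 0 J)) J"
    by (intro fidi_mono) (auto intro: Max_mono finite_subset dest: finite_subset)
  then show "fidi (Max (insert 0 J)) J = distr (fidi (Max (insert 0 H)) H) (PiM J (\<lambda>_. borel)) (\<lambda>f. restrict f J)"
    using JH by (simp add: distr_fidi)
qed (rule prob_fidi)

text \<open>Decoding the coordinates of Kolmogorov's limit gives the states. The joint law of
  neighbours is what is recorded: it determines every marginal and lets almost sure relations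
  between consecutive states be transferred from
  \<open>Q (Suc n) \<Otimes>\<^sub>M K n\<close>.\<close>

theorem inverse_limit_exists:
  obtains \<Omega> :: "(nat \<Rightarrow> 'y) measure" and \<eta> where "prob_space \<Omega>" "\<And>n. \<eta> n \<in> measurable \<Omega> N"
    "\<And>n. distr \<Omega> (N \<Otimes>\<^sub>M N) (\<lambda>\<omega>. (\<eta> n \<omega>, \<eta> (Suc n) \<omega>)) = distr (Q (Suc n) \<Otimes>\<^sub>M K n) (N \<Otimes>\<^sub>M N) (\<lambda>(x, k). (f n x k, x))"
proof -
  interpret L: polish_projective UNIV "\<lambda>J. fidi (Max (insert 0 J)) J"
    unfolding polish_projective_def by (rule consistent_fidi)
  have setsL [measurable_cong]: "sets L.lim = sets (PiM UNIV (\<lambda>_. borel))" by simp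
  have comp [measurable]: "(\<lambda>\<omega>. \<omega> n) \<in> measurable L.lim borel" for n
    by (subst measurable_cong_sets[OF setsL refl]) (rule measurable_component_singleton, simp)
  define \<eta> where "\<eta> n \<omega> = dec (\<omega> n)" for n and \<omega> :: "nat \<Rightarrow> 'y"
  have \<eta> [measurable]: "\<eta> n \<in> measurable L.lim N" for n unfolding \<eta>_def by measurable
  have "distr L.lim (N \<Otimes>\<^sub>M N) (\<lambda>\<omega>. (\<eta> n \<omega>, \<eta> (Suc n) \<omega>)) = distr (Q (Suc n) \<Otimes>\<^sub>M K n) (N \<Otimes>\<^sub>M N) (\<lambda>(x, k). (f n x k, x))" for n
  proof -
    interpret K: prob_space "K i" for i by (rule prob_K)
    interpret noise: prob_space "noise m" for m by (rule prob_noise)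
    interpret product_sigma_finite K by unfold_locales
    let ?J = "{n, Suc n}"
    have J: "distr L.lim (PiM ?J (\<lambda>_. borel)) (\<lambda>\<omega>. restrict \<omega> ?J) = fidi (Suc n) ?J"
    proof (rule measure_eqI)
      fix X assume "X \<in> sets (distr L.lim (PiM ?J (\<lambda>_. borel)) (\<lambda>\<omega>. restrict \<omega> ?J))"
      then have X: "X \<in> sets (PiM ?J (\<lambda>_. borel))" by simp
      have "emeasure (distr L.lim (PiM ?J (\<lambda>_. borel)) (\<lambda>\<omega>. restrict \<omega> ?J)) X = emeasure L.lim (prod_emb UNIV (\<lambda>_. borel) ?J X)"
        using X by (subst emeasure_distr) (auto simp: prod_emb_def space_PiM intro: measurable_restrict_subset)
      also have "\<dots> = emeasure (fidi (Suc n) ?J) X" using L.emeasure_lim_emb[OF _ _ X] by simp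
      finally show "emeasure (distr L.lim (PiM ?J (\<lambda>_. borel)) (\<lambda>\<omega>. restrict \<omega> ?J)) X = emeasure (fidi (Suc n) ?J) X" .
    qed (simp add: fidi_def)
    let ?d = "\<lambda>y. (dec (y n), dec (y (Suc n)))"
    have d [measurable]: "?d \<in> measurable (PiM ?J (\<lambda>_. borel)) (N \<Otimes>\<^sub>M N)" by measurable
    have "distr L.lim (N \<Otimes>\<^sub>M N) (\<lambda>\<omega>. (\<eta> n \<omega>, \<eta> (Suc n) \<omega>)) = distr (fidi (Suc n) ?J) (N \<Otimes>\<^sub>M N) ?d"
      unfolding J[symmetric]
      by (subst distr_distr[OF d]) (auto simp: \<eta>_def comp_def intro: measurable_restrict_subset)
    also have "\<dots> = distr (Q (Suc n) \<Otimes>\<^sub>M K n) (N \<Otimes>\<^sub>M N) (\<lambda>(x, k). (f n x k, x))"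
    proof (rule measure_eqI)
      fix X assume "X \<in> sets (distr (fidi (Suc n) ?J) (N \<Otimes>\<^sub>M N) ?d)"
      then have X [measurable]: "X \<in> sets (N \<Otimes>\<^sub>M N)" by simp
      have ge: "(\<lambda>(x, k). (f n x k, x)) \<in> measurable (Q (Suc n) \<Otimes>\<^sub>M K n) (N \<Otimes>\<^sub>M N)" by measurable
      have gx: "(\<lambda>k. indicator X (f n x k, x) :: ennreal) \<in> borel_measurable (K n)" if "x \<in> space N" for x
        using that by measurable
      have ds: "?d \<in> measurable (fidi (Suc n) ?J) (N \<Otimes>\<^sub>M N)"
        by (subst measurable_cong_sets[OF _ refl, of _ "PiM ?J (\<lambda>_. borel)"]) (simp_all add: fidi_def d)
      have "emeasure (distr (fidi (Suc n) ?J) (N \<Otimes>\<^sub>M N) ?d) X = (\<integral>\<^sup>+y. indicator X y \<partial>distr (fidi (Suc n) ?J) (N \<Otimes>\<^sub>M N) ?d)"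
        by simp
      also have "\<dots> = (\<integral>\<^sup>+y. indicator X (?d y) \<partial>fidi (Suc n) ?J)"
        using ds by (intro nn_integral_distr) auto
      also have "\<dots> = (\<integral>\<^sup>+x. \<integral>\<^sup>+w. indicator X (?d (\<lambda>j\<in>?J. code (traj (Suc n) x w j))) \<partial>noise (Suc n) \<partial>Q (Suc n))"
        using d by (intro nn_integral_fidi) measurable
      also have "\<dots> = (\<integral>\<^sup>+x. \<integral>\<^sup>+w. indicator X (f n x (w n), x) \<partial>noise (Suc n) \<partial>Q (Suc n))"
      proof (intro nn_integral_cong)
        fix x w assume x: "x \<in> space (Q (Suc n))" and w: "w \<in> space (noise (Suc n))"
        have xN: "x \<in> space N" using x sets_eq_imp_space_eq[OF sets_Q] by simp
        have "w n \<in> space N" using measurable_space[OF measurable_noise[of n "Suc n"] w] by simp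
        then have "f n x (w n) \<in> space N" using measurable_space[OF measurable_f, of "(x, w n)" n] xN by (simp add: space_pair_measure)
        then show "indicator X (?d (\<lambda>j\<in>?J. code (traj (Suc n) x w j))) = (indicator X (f n x (w n), x) :: ennreal)"
          using xN by (simp add: traj_same dec_code)
      qed
      also have "\<dots> = (\<integral>\<^sup>+x. \<integral>\<^sup>+k. indicator X (f n x k, x) \<partial>K n \<partial>Q (Suc n))"
      proof (intro nn_integral_cong)
        fix x assume x: "x \<in> space (Q (Suc n))"
        have xN: "x \<in> space N" using x sets_eq_imp_space_eq[OF sets_Q] by simp
        have "(\<lambda>w. indicator X (f n x (w n), x) :: ennreal) \<in> borel_measurable (noise (Suc n))"
          using measurable_noise[of n "Suc n"] xN by measurable
        then have "(\<integral>\<^sup>+w. indicator X (f n x (w n), x) \<partial>noise (Suc n)) = (\<integral>\<^sup>+k. \<integral>\<^sup>+w. indicator X (f n x ((w(n := k)) n), x) \<partial>noise n \<partial>K n)"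
          unfolding lessThan_Suc by (intro product_nn_integral_insert_rev) auto
        then show "(\<integral>\<^sup>+w. indicator X (f n x (w n), x) \<partial>noise (Suc n)) = (\<integral>\<^sup>+k. indicator X (f n x k, x) \<partial>K n)"
          by (simp add: noise.emeasure_space_1)
      qed
      also have "\<dots> = (\<integral>\<^sup>+p. indicator X (case p of (x, k) \<Rightarrow> (f n x k, x)) \<partial>(Q (Suc n) \<Otimes>\<^sub>M K n))"
        using measurable_compose[OF ge, of "indicator X"] by (subst K.nn_integral_fst[symmetric]) auto
      also have "\<dots> = (\<integral>\<^sup>+p. indicator X p \<partial>distr (Q (Suc n) \<Otimes>\<^sub>M K n) (N \<Otimes>\<^sub>M N) (\<lambda>(x, k). (f n x k, x)))"
        using ge by (intro nn_integral_distr[symmetric]) auto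
      also have "\<dots> = emeasure (distr (Q (Suc n) \<Otimes>\<^sub>M K n) (N \<Otimes>\<^sub>M N) (\<lambda>(x, k). (f n x k, x))) X"
        by simp
      finally show "emeasure (distr (fidi (Suc n) ?J) (N \<Otimes>\<^sub>M N) ?d) X = emeasure (distr (Q (Suc n) \<Otimes>\<^sub>M K n) (N \<Otimes>\<^sub>M N) (\<lambda>(x, k). (f n x k, x))) X" .
    qed simp
    finally show ?thesis .
  qed
  then show thesis using \<eta> L.P.prob_space_axioms that by blast
qed

end

section \<open>Limits and uniqueness on the space of Radon measures\<close>

definition bounded_partition :: "(nat \<Rightarrow> 'a::topological_space set) \<Rightarrow> bool" where
  "bounded_partition D \<longleftrightarrow> (\<forall>m. D m \<in> sets borel \<and> compact (closure (D m))) \<and> disjoint_family D \<and> (\<Union>m. D m) = UNIV \<and>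
     (\<forall>B. compact (closure B) \<longrightarrow> (\<exists>n. B \<subseteq> (\<Union>m<n. D m)))"

lemma exists_bounded_partition:
  assumes lc: "locally_compact_space (euclidean :: 'a::{second_countable_topology, t2_space} topology)"
  obtains D :: "nat \<Rightarrow> 'a::{second_countable_topology, t2_space} set" where "bounded_partition D"
proof -
  obtain K :: "nat \<Rightarrow> 'a set" where K: "\<And>n. compact (K n)" "\<And>n. K n \<subseteq> interior (K (Suc n))" "(\<Union>n. K n) = UNIV"
    using compact_exhaustion[OF lc] by blast
  have "bounded_partition (disjointed K)"
    unfolding bounded_partition_def
  proof (intro conjI allI impI)
    have Kb: "range K \<subseteq> sets borel" using K(1) by (auto intro: borel_closed compact_imp_closed)
    fix m
    show "disjointed K m \<in> sets borel" using sets.range_disjointed_sets[OF Kb] by auto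
    have "closure (disjointed K m) \<subseteq> K m"
      using K(1) by (intro closure_minimal compact_imp_closed disjointed_subset)
    then show "compact (closure (disjointed K m))"
      using compact_Int_closed[OF K(1) closed_closure, of m "disjointed K m"] by (simp add: Int_absorb1)
  next
    show "disjoint_family (disjointed K)" by (rule disjoint_family_disjointed)
    show "(\<Union>m. disjointed K m) = UNIV" using UN_disjointed_eq[of K] K(3) by simp
    fix B :: "'a set" assume "compact (closure B)"
    then obtain n where n: "closure B \<subseteq> K n" using compact_subset_exhaustion[OF K(2,3)] by blast
    have "K n \<subseteq> (\<Union>m<Suc n. disjointed K m)"
      using finite_UN_disjointed_eq[of K "Suc n"] by (auto simp: atLeast0LessThan)
    then show "\<exists>n. B \<subseteq> (\<Union>m<n. disjointed K m)" using n closure_subset by blast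
  qed
  then show thesis by (rule that)
qed

lemma sigma_finite_radon:
  fixes D :: "nat \<Rightarrow> 'a::topological_space set" and \<mu> :: "'a measure"
  assumes D: "bounded_partition D" and \<mu>: "\<mu> \<in> radon_measures"
  shows "sigma_finite_measure \<mu>"
proof
  show "\<exists>A. countable A \<and> A \<subseteq> sets \<mu> \<and> \<Union>A = space \<mu> \<and> (\<forall>a\<in>A. emeasure \<mu> a \<noteq> \<infinity>)"
  proof (intro exI[of _ "range D"] conjI ballI)
    show "\<Union>(range D) = space \<mu>" using D sets_eq_imp_space_eq[OF sets_radon[OF \<mu>]] by (simp add: bounded_partition_def)
    show "range D \<subseteq> sets \<mu>" using D by (auto simp: bounded_partition_def sets_radon[OF \<mu>])
    show "emeasure \<mu> a \<noteq> \<infinity>" if "a \<in> range D" for a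
      using that D \<mu> by (auto simp: bounded_partition_def radon_measures_iff less_top)
  qed simp
qed

lemma emeasure_partition:
  fixes D :: "nat \<Rightarrow> 'a::topological_space set" and \<mu> :: "'a measure"
  assumes D: "bounded_partition D" and \<mu>: "sets \<mu> = sets borel" and B: "B \<in> sets borel"
  shows "emeasure \<mu> B = (\<Sum>m. emeasure \<mu> (B \<inter> D m))"
proof -
  have "(\<Sum>m. emeasure \<mu> (B \<inter> D m)) = emeasure \<mu> (\<Union>m. B \<inter> D m)"
    using D B by (intro suminf_emeasure) (auto simp: bounded_partition_def \<mu> disjoint_family_on_def)
  also have "(\<Union>m. B \<inter> D m) = B" using D by (auto simp: bounded_partition_def)
  finally show ?thesis by simp
qed

text \<open>All members of the sequence have densities with respect to the first one, so the limit can be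
  taken at the level of densities; this makes countable additivity of the limit automatic.\<close>

lemma decreasing_radon_limit:
  fixes \<eta> :: "nat \<Rightarrow> 'a::{second_countable_topology, t2_space} measure" and D :: "nat \<Rightarrow> 'a set"
  assumes D: "bounded_partition D"
    and \<eta>: "\<And>n. \<eta> n \<in> radon_measures" and \<kappa>: "\<And>n. \<kappa> n \<in> radon_measures"
    and step: "\<And>n. \<eta> n = add_measure (\<eta> (Suc n)) (\<kappa> n)"
  obtains \<nu> where "\<nu> \<in> radon_measures"
    "\<And>h. h \<in> borel_measurable borel \<Longrightarrow> (\<integral>\<^sup>+x. h x \<partial>\<eta> 0) < \<infinity> \<Longrightarrow> (\<lambda>n. \<integral>\<^sup>+x. h x \<partial>\<eta> n) \<longlonglongrightarrow> (\<integral>\<^sup>+x. h x \<partial>\<nu>)"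
proof -
  interpret sigma_finite_measure "\<eta> 0" by (rule sigma_finite_radon[OF D \<eta>])
  note s [measurable_cong] = sets_radon[OF \<eta>] sets_radon[OF \<kappa>]
  have em: "emeasure (\<eta> n) B = emeasure (\<eta> (Suc n)) B + emeasure (\<kappa> n) B" if "B \<in> sets borel" for n B
    using that by (subst step) (simp add: emeasure_add_measure s)
  have le: "emeasure (\<eta> n) B \<le> emeasure (\<eta> 0) B" if "B \<in> sets borel" for n B
  proof (induction n)
    case (Suc n)
    then show ?case using em[OF that, of n] by (metis add_increasing2 dual_order.trans le_iff_add)
  qed simp
  have lek: "emeasure (\<kappa> n) B \<le> emeasure (\<eta> 0) B" if "B \<in> sets borel" for n B
    using le[OF that, of n] em[OF that, of n] by (metis add.commute dual_order.trans le_iff_add)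
  define f where "f n = RN_deriv (\<eta> 0) (\<eta> n)" for n
  \<comment> \<open>The increments also get densities: uniqueness of densities then gives
    \<open>f (Suc n) + k n = f n\<close> almost everywhere, which is what makes the
    \<open>f n\<close> decrease.\<close>
  define k where "k n = RN_deriv (\<eta> 0) (\<kappa> n)" for n
  have f [measurable]: "f n \<in> borel_measurable borel" "k n \<in> borel_measurable borel" for n
    using borel_measurable_RN_deriv[of "\<eta> 0" "\<eta> n"] borel_measurable_RN_deriv[of "\<eta> 0" "\<kappa> n"]
    by (auto simp: f_def k_def cong: measurable_cong_sets)
  have ac: "absolutely_continuous (\<eta> 0) M"
    if "sets M = sets borel" "\<And>B. B \<in> sets borel \<Longrightarrow> emeasure M B \<le> emeasure (\<eta> 0) B" for M
    unfolding absolutely_continuous_def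
  proof
    fix B assume "B \<in> null_sets (\<eta> 0)"
    then have "B \<in> sets borel" "emeasure (\<eta> 0) B = 0" by (auto simp: null_sets_def s)
    then show "B \<in> null_sets M" using that(2)[of B] by (simp add: null_sets_def that(1))
  qed
  have df: "density (\<eta> 0) (f n) = \<eta> n" for n
    unfolding f_def using le by (intro density_RN_deriv ac) (simp_all add: s)
  have dk: "density (\<eta> 0) (k n) = \<kappa> n" for n
    unfolding k_def using lek by (intro density_RN_deriv ac) (simp_all add: s)
  have dec1: "AE x in \<eta> 0. f (Suc n) x \<le> f n x" for n
  proof -
    have "density (\<eta> 0) (\<lambda>x. f (Suc n) x + k n x) = \<eta> n"
    proof (rule measure_eqI)
      fix B assume "B \<in> sets (density (\<eta> 0) (\<lambda>x. f (Suc n) x + k n x))"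
      then have B [measurable]: "B \<in> sets borel" by (simp add: s)
      have "emeasure (density (\<eta> 0) (\<lambda>x. f (Suc n) x + k n x)) B =
         emeasure (density (\<eta> 0) (f (Suc n))) B + emeasure (density (\<eta> 0) (k n)) B"
        by (simp add: emeasure_density s distrib_right nn_integral_add)
      then show "emeasure (density (\<eta> 0) (\<lambda>x. f (Suc n) x + k n x)) B = emeasure (\<eta> n) B"
        unfolding df dk using em[OF B, of n] by simp
    qed (simp add: s)
    then have "AE x in \<eta> 0. f (Suc n) x + k n x = f n x"
      using df[of n] by (subst density_unique_iff[symmetric]) (simp_all add: s)
    then show ?thesis by eventually_elim (metis le_iff_add)
  qed
  have f0: "AE x in \<eta> 0. f 0 x = 1"
    using df[of 0] by (subst density_unique_iff[symmetric]) (simp_all add: density_1)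
  define F where "F x = (INF n. f n x)" for x
  have F [measurable]: "F \<in> borel_measurable borel" unfolding F_def by measurable
  define \<nu> where "\<nu> = density (\<eta> 0) F"
  have s\<nu>: "sets \<nu> = sets borel" by (simp add: \<nu>_def s)
  have conv: "(\<lambda>n. \<integral>\<^sup>+x. h x \<partial>\<eta> n) \<longlonglongrightarrow> (\<integral>\<^sup>+x. h x \<partial>\<nu>)"
    if h: "h \<in> borel_measurable borel" "(\<integral>\<^sup>+x. h x \<partial>\<eta> 0) < \<infinity>" for h
  proof -
    note [measurable] = h(1)
    \<comment> \<open>Multiplication by infinity is not continuous at 0, so the limit of
      \<open>f n x * h x\<close> is taken only where \<open>h x\<close> is finite.\<close>
    have hfin: "AE x in \<eta> 0. h x \<noteq> \<infinity>" using h by (intro nn_integral_PInf_AE) (auto simp: s)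
    have decAE: "AE x in \<eta> 0. decseq (\<lambda>n. f n x)"
      using dec1 by (simp add: decseq_Suc_iff AE_all_countable)
    have I: "(\<integral>\<^sup>+x. h x \<partial>\<eta> n) = (\<integral>\<^sup>+x. f n x * h x \<partial>\<eta> 0)" for n
      by (subst df[symmetric]) (simp add: nn_integral_density)
    have dec2: "AE x in \<eta> 0. f (Suc n) x * h x \<le> f n x * h x" for n
      using dec1[of n] by eventually_elim (rule mult_right_mono, auto)
    have "(\<integral>\<^sup>+x. (INF n. f n x * h x) \<partial>\<eta> 0) = (INF n. \<integral>\<^sup>+x. f n x * h x \<partial>\<eta> 0)"
      using dec2 h(2) unfolding I[of 0] by (intro nn_integral_monotone_convergence_INF_AE) auto
    moreover have "decseq (\<lambda>n. \<integral>\<^sup>+x. f n x * h x \<partial>\<eta> 0)"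
      using dec2 by (intro decseq_SucI nn_integral_mono_AE)
    ultimately have "(\<lambda>n. \<integral>\<^sup>+x. f n x * h x \<partial>\<eta> 0) \<longlonglongrightarrow> (\<integral>\<^sup>+x. (INF n. f n x * h x) \<partial>\<eta> 0)"
      by (simp add: LIMSEQ_INF)
    also have "(\<integral>\<^sup>+x. (INF n. f n x * h x) \<partial>\<eta> 0) = (\<integral>\<^sup>+x. F x * h x \<partial>\<eta> 0)"
    proof (intro nn_integral_cong_AE)
      show "AE x in \<eta> 0. (INF n. f n x * h x) = F x * h x"
        using hfin decAE
      proof eventually_elim
        fix x assume hx: "h x \<noteq> \<infinity>" and dx: "decseq (\<lambda>n. f n x)"
        have "(\<lambda>n. h x * f n x) \<longlonglongrightarrow> h x * F x"
          unfolding F_def using hx dx by (intro ennreal_tendsto_cmult LIMSEQ_INF) (auto simp: less_top)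
        then have "(\<lambda>n. f n x * h x) \<longlonglongrightarrow> F x * h x" by (simp add: mult.commute)
        moreover have "decseq (\<lambda>n. f n x * h x)"
          using dx by (auto simp: decseq_def intro: mult_right_mono)
        ultimately show "(INF n. f n x * h x) = F x * h x"
          using LIMSEQ_INF LIMSEQ_unique by blast
      qed
    qed
    also have "\<dots> = (\<integral>\<^sup>+x. h x \<partial>\<nu>)" unfolding \<nu>_def by (simp add: nn_integral_density)
    finally show ?thesis unfolding I .
  qed
  have "emeasure \<nu> B \<le> emeasure (\<eta> 0) B" if [measurable]: "B \<in> sets borel" for B
  proof -
    have "emeasure \<nu> B = (\<integral>\<^sup>+x. F x * indicator B x \<partial>\<eta> 0)" unfolding \<nu>_def by (simp add: emeasure_density s)
    also have "\<dots> \<le> (\<integral>\<^sup>+x. f 0 x * indicator B x \<partial>\<eta> 0)"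
      unfolding F_def by (intro nn_integral_mono mult_right_mono INF_lower) auto
    also have "\<dots> = emeasure (density (\<eta> 0) (f 0)) B" by (simp add: emeasure_density s)
    finally show ?thesis unfolding df .
  qed
  then have "\<nu> \<in> radon_measures"
    using \<eta>[of 0] s\<nu> by (fastforce simp: radon_measures_iff intro: le_less_trans)
  then show thesis using conv by (rule that)
qed

section \<open>Test functions and the uniqueness of Laplace transforms\<close>

lemma ennreal_BM_measurable: "h \<in> BM \<Longrightarrow> (\<lambda>x. ennreal (h x)) \<in> borel_measurable borel"
  by (auto simp: BM_def)

lemma BM_nn_integral_finite:
  assumes h: "h \<in> BM" and \<mu>: "\<mu> \<in> radon_measures"
  shows "(\<integral>\<^sup>+x. ennreal (h x) \<partial>\<mu>) < \<infinity>" "(\<integral>\<^sup>+x. ennreal (h x) \<partial>\<mu>) = ennreal (pairing h \<mu>)" "0 \<le> pairing h \<mu>"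
proof -
  have hm: "h \<in> borel_measurable borel" "\<And>x. 0 \<le> h x" and c: "compact (closure {x. h x \<noteq> 0})"
    using h by (auto simp: BM_def)
  obtain K where "\<forall>y\<in>range h. norm y \<le> K"
    using h unfolding BM_def bounded_iff by blast
  then have K: "\<And>x. h x \<le> K" by (auto simp: abs_le_iff)
  note [measurable] = hm(1)
  have [measurable_cong]: "sets \<mu> = sets borel" using \<mu> by (rule sets_radon)
  let ?S = "{x. h x \<noteq> 0}"
  have S: "?S \<in> sets borel" by measurable
  have "(\<integral>\<^sup>+x. ennreal (h x) \<partial>\<mu>) \<le> (\<integral>\<^sup>+x. ennreal K * indicator ?S x \<partial>\<mu>)"
    using K hm by (intro nn_integral_mono) (auto simp: indicator_def intro!: ennreal_leI)
  also have "\<dots> = ennreal K * emeasure \<mu> ?S" using S by (simp add: nn_integral_cmult_indicator sets_radon[OF \<mu>])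
  also have "\<dots> < \<infinity>" using \<mu> c S by (auto simp: radon_measures_iff ennreal_mult_less_top)
  finally show fin: "(\<integral>\<^sup>+x. ennreal (h x) \<partial>\<mu>) < \<infinity>" .
  have "integrable \<mu> h" using fin hm by (intro integrableI_nonneg) auto
  then show "(\<integral>\<^sup>+x. ennreal (h x) \<partial>\<mu>) = ennreal (pairing h \<mu>)"
    unfolding pairing_def using hm by (intro nn_integral_eq_integral) auto
  show "0 \<le> pairing h \<mu>" unfolding pairing_def using hm by simp
qed

lemma eneg_BM: "h \<in> BM \<Longrightarrow> \<mu> \<in> radon_measures \<Longrightarrow> eneg (\<integral>\<^sup>+x. ennreal (h x) \<partial>\<mu>) = exp (- pairing h \<mu>)"
  using BM_nn_integral_finite[of h \<mu>] by (simp add: eneg_ennreal)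

lemma BM_add:
  assumes "h \<in> BM" "k \<in> BM" shows "(\<lambda>x. h x + k x) \<in> BM"
proof -
  have cl: "closure {x. h x + k x \<noteq> 0} \<subseteq> closure {x. h x \<noteq> 0} \<union> closure {x. k x \<noteq> 0}"
    by (subst closure_Un[symmetric], intro closure_mono) auto
  have "compact (closure {x. h x \<noteq> 0} \<union> closure {x. k x \<noteq> 0})" using assms by (auto simp: BM_def)
  from compact_Int_closed[OF this closed_closure[of "{x. h x + k x \<noteq> 0}"]] have "compact (closure {x. h x + k x \<noteq> 0})"
    by (simp only: Int_absorb1[OF cl])
  moreover have "bounded (range (\<lambda>x. h x + k x))"
    using assms by (auto simp: BM_def intro: bounded_plus_comp)
  ultimately show ?thesis using assms by (auto simp: BM_def)
qed

lemma BM_cmult: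
  assumes "h \<in> BM" "0 \<le> c" shows "(\<lambda>x. c * h x) \<in> BM"
proof -
  have cl: "closure {x. c * h x \<noteq> 0} \<subseteq> closure {x. h x \<noteq> 0}"
    by (intro closure_mono) auto
  have "compact (closure {x. h x \<noteq> 0})" using assms by (auto simp: BM_def)
  from compact_Int_closed[OF this closed_closure[of "{x. c * h x \<noteq> 0}"]] have "compact (closure {x. c * h x \<noteq> 0})"
    by (simp only: Int_absorb1[OF cl])
  moreover have "bounded (range (\<lambda>x. c * h x))"
    using assms bounded_scaleR_comp[of h UNIV c] by (auto simp: BM_def)
  ultimately show ?thesis using assms by (auto simp: BM_def)
qed

lemma BM_indicator:
  assumes "B \<in> sets borel" "compact (closure B)" shows "indicator B \<in> BM"
proof -
  have "{x. indicator B x \<noteq> (0::real)} = B" by (auto simp: indicator_def)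
  moreover have "bounded (range (indicator B :: _ \<Rightarrow> real))"
    by (rule boundedI[of _ 1]) auto
  ultimately show ?thesis using assms by (auto simp: BM_def)
qed

text \<open>Depends only on the law and accepts functions with values in \<open>ennreal\<close>, so
  that the strictly positive weight can be inserted; on \<open>BM\<close> it agrees with the Laplace
  functional.\<close>

definition lap :: "'a measure measure \<Rightarrow> ('a \<Rightarrow> ennreal) \<Rightarrow> real" where
  "lap R h = (\<integral>\<mu>. eneg (\<integral>\<^sup>+x. h x \<partial>\<mu>) \<partial>R)"

lemma measurable_eneg_nn_integral:
  "h \<in> borel_measurable borel \<Longrightarrow> (\<lambda>\<mu>. eneg (\<integral>\<^sup>+x. h x \<partial>\<mu>)) \<in> borel_measurable radon_algebra"
  by (rule measurable_compose[OF measurable_nn_integral_radon_algebra eneg_measurable])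

lemma integrable_eneg_nn_integral:
  assumes "finite_measure R" "sets R = sets radon_algebra" "h \<in> borel_measurable borel"
  shows "integrable R (\<lambda>\<mu>. eneg (\<integral>\<^sup>+x. h x \<partial>\<mu>))"
proof -
  interpret finite_measure R by fact
  show ?thesis
    by (rule integrable_const_bound[where B=1])
       (use measurable_eneg_nn_integral[OF assms(3)] in \<open>simp_all add: measurable_cong_sets[OF assms(2) refl]\<close>)
qed

text \<open>The functions exp (- \<langle>h, \<mu>\<rangle>) are closed under products because
  pairings add, and they generate the \<sigma>-algebra: the mass of \<open>B \<inter> D m\<close> is
  minus the logarithm of such a function, and these masses add up to that of
  \<open>B\<close>.\<close>

theorem laplace_unique:
  fixes A B :: "'a::{second_countable_topology, t2_space} measure measure"
  assumes lc: "locally_compact_space (euclidean :: 'a topology)"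
    and fin: "finite_measure A" "finite_measure B" and sets: "sets A = sets radon_algebra" "sets B = sets radon_algebra"
    and eq: "\<And>h. h \<in> BM \<Longrightarrow> lap A (\<lambda>x. ennreal (h x)) = lap B (\<lambda>x. ennreal (h x))"
  shows "A = B"
proof -
  obtain D :: "nat \<Rightarrow> 'a set" where D: "bounded_partition D" using exists_bounded_partition[OF lc] by blast
  let ?e = "\<lambda>h \<mu> :: 'a measure. eneg (\<integral>\<^sup>+x. ennreal (h x) \<partial>\<mu>)"
  \<comment> \<open>Outside the Radon measures the value is fixed at 1: closure under products is an
    identity of functions on the whole type, whereas additivity of the integral is available only
    for measures on the Borel sets.\<close>
  define \<H> where "\<H> = {X. \<exists>h\<in>BM. \<forall>\<mu>. X \<mu> = (if \<mu> \<in> radon_measures then ?e h \<mu> else 1)}"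
  have spA: "space A = radon_measures" using sets_eq_imp_space_eq[OF sets(1)] by (simp add: space_radon_algebra)
  have spB: "space B = radon_measures" using sets_eq_imp_space_eq[OF sets(2)] by (simp add: space_radon_algebra)
  have H: "(\<lambda>\<mu>. if \<mu> \<in> radon_measures then ?e h \<mu> else 1) \<in> \<H>" if "h \<in> BM" for h
    using that unfolding \<H>_def by auto
  show ?thesis
  proof (rule finite_measure_eq_of_multiplicative_class[where \<H>=\<H>])
    fix X assume "X \<in> \<H>"
    then obtain h where h: "h \<in> BM" "\<And>\<mu>. X \<mu> = (if \<mu> \<in> radon_measures then ?e h \<mu> else 1)" unfolding \<H>_def by auto
    have "?e h \<in> borel_measurable A"
      using measurable_eneg_nn_integral[OF ennreal_BM_measurable[OF h(1)]] by (simp add: measurable_cong_sets[OF sets(1) refl])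
    then show "X \<in> borel_measurable A"
      using h(2) by (subst measurable_cong[of A X "?e h"]) (auto simp: spA)
    show "0 \<le> X \<mu>" "X \<mu> \<le> 1" for \<mu> by (auto simp: h(2))
    have "(\<integral>\<mu>. X \<mu> \<partial>A) = lap A (\<lambda>x. ennreal (h x))"
      unfolding lap_def using h(2) by (intro Bochner_Integration.integral_cong) (auto simp: spA)
    moreover have "(\<integral>\<mu>. X \<mu> \<partial>B) = lap B (\<lambda>x. ennreal (h x))"
      unfolding lap_def using h(2) by (intro Bochner_Integration.integral_cong) (auto simp: spB)
    ultimately show "(\<integral>\<mu>. X \<mu> \<partial>A) = (\<integral>\<mu>. X \<mu> \<partial>B)" using eq[OF h(1)] by simp
  next
    have "(\<lambda>_::'a. 0) \<in> BM" by (auto simp: BM_def)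
    from H[OF this] show "(\<lambda>_. 1) \<in> \<H>" by (simp cong: if_cong)
  next
    fix X Y assume "X \<in> \<H>" "Y \<in> \<H>"
    then obtain h k where h: "h \<in> BM" "\<And>\<mu>. X \<mu> = (if \<mu> \<in> radon_measures then ?e h \<mu> else 1)"
      and k: "k \<in> BM" "\<And>\<mu>. Y \<mu> = (if \<mu> \<in> radon_measures then ?e k \<mu> else 1)" unfolding \<H>_def by auto
    have "?e h \<mu> * ?e k \<mu> = ?e (\<lambda>x. h x + k x) \<mu>" if "\<mu> \<in> radon_measures" for \<mu>
    proof -
      have "(\<integral>\<^sup>+x. ennreal (h x + k x) \<partial>\<mu>) = (\<integral>\<^sup>+x. ennreal (h x) + ennreal (k x) \<partial>\<mu>)"
        using h(1) k(1) by (intro nn_integral_cong) (auto simp: BM_def)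
      also have "\<dots> = (\<integral>\<^sup>+x. ennreal (h x) \<partial>\<mu>) + (\<integral>\<^sup>+x. ennreal (k x) \<partial>\<mu>)"
        using ennreal_BM_measurable[OF h(1)] ennreal_BM_measurable[OF k(1)] sets_radon[OF that]
        by (intro nn_integral_add) (auto cong: measurable_cong_sets)
      finally show ?thesis by (simp add: eneg_add)
    qed
    then have "(\<lambda>\<mu>. X \<mu> * Y \<mu>) = (\<lambda>\<mu>. if \<mu> \<in> radon_measures then ?e (\<lambda>x. h x + k x) \<mu> else 1)"
      using h(2) k(2) by auto
    then show "(\<lambda>\<mu>. X \<mu> * Y \<mu>) \<in> \<H>" using H[OF BM_add[OF h(1) k(1)]] by simp
  next
    define G where "G = {{\<mu> \<in> space A. c \<le> X \<mu>} |X c. X \<in> \<H>}"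
    let ?\<Sigma> = "sigma radon_measures G"
    have G: "G \<subseteq> Pow radon_measures" by (auto simp: spA G_def)
    have sp: "space ?\<Sigma> = radon_measures" using G by (simp add: space_measure_of)
    have "(\<lambda>\<mu>. \<mu>) \<in> measurable ?\<Sigma> radon_algebra"
    proof (rule measurable_radon_algebra)
      fix B :: "'a set" assume B: "B \<in> sets borel"
      have "(\<lambda>\<mu>. emeasure \<mu> (B \<inter> D m)) \<in> borel_measurable ?\<Sigma>" for m
      proof -
        let ?C = "B \<inter> D m"
        have "closure ?C \<subseteq> closure (D m)" by (rule closure_mono) auto
        then have cC: "compact (closure ?C)"
          using D compact_Int_closed[OF _ closed_closure, of "closure (D m)" ?C] by (auto simp: bounded_partition_def Int_absorb1)
        have C: "?C \<in> sets borel" using B D by (auto simp: bounded_partition_def)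
        have bm: "indicator ?C \<in> BM" using C cC by (rule BM_indicator)
        have fin: "emeasure \<mu> ?C < \<top>" if "\<mu> \<in> radon_measures" for \<mu> using that C cC by (auto simp: radon_measures_iff)
        have eC: "?e (indicator ?C) \<mu> = eneg (emeasure \<mu> ?C)" if "\<mu> \<in> radon_measures" for \<mu>
          using C sets_radon[OF that] by (simp add: ennreal_indicator)
        have "(\<lambda>\<mu>. eneg (emeasure \<mu> ?C)) \<in> borel_measurable ?\<Sigma>"
          unfolding borel_measurable_iff_ge
        proof
          fix c
          define X where "X = (\<lambda>\<mu>. if \<mu> \<in> radon_measures then ?e (indicator ?C) \<mu> else 1)"
          have "X \<in> \<H>" unfolding X_def by (rule H[OF bm])
          then have "{\<mu> \<in> space A. c \<le> X \<mu>} \<in> G" unfolding G_def by blast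
          also have "{\<mu> \<in> space A. c \<le> X \<mu>} = {\<mu> \<in> space ?\<Sigma>. c \<le> eneg (emeasure \<mu> ?C)}"
            using eC by (auto simp: sp spA X_def)
          finally show "{\<mu> \<in> space ?\<Sigma>. c \<le> eneg (emeasure \<mu> ?C)} \<in> sets ?\<Sigma>"
            using G by (simp add: sets_measure_of sigma_sets.Basic)
        qed
        then have "(\<lambda>\<mu>. ennreal (- ln (eneg (emeasure \<mu> ?C)))) \<in> borel_measurable ?\<Sigma>" by measurable
        also have "?this \<longleftrightarrow> ?thesis"
        proof (intro measurable_cong)
          fix \<mu> assume "\<mu> \<in> space ?\<Sigma>"
          then have "emeasure \<mu> ?C < \<top>" using fin sp by simp
          then show "ennreal (- ln (eneg (emeasure \<mu> ?C))) = emeasure \<mu> ?C"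
            by (cases "emeasure \<mu> ?C") (auto simp: eneg_ennreal)
        qed
        finally show ?thesis .
      qed
      then have "(\<lambda>\<mu>. \<Sum>m. emeasure \<mu> (B \<inter> D m)) \<in> borel_measurable ?\<Sigma>" by measurable
      also have "?this \<longleftrightarrow> (\<lambda>\<mu>. emeasure \<mu> B) \<in> borel_measurable ?\<Sigma>"
        using emeasure_partition[OF D sets_radon B] sp by (intro measurable_cong) simp
      finally show "(\<lambda>\<mu>. emeasure \<mu> B) \<in> borel_measurable ?\<Sigma>" .
    qed (simp add: sp)
    then have "S \<in> sets ?\<Sigma>" if "S \<in> sets A" for S
      using that measurable_sets[of "\<lambda>\<mu>. \<mu>" ?\<Sigma> radon_algebra S] sets.sets_into_space[OF that] spA
      by (simp add: sets(1) sp Int_absorb2)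
    then show "sets A \<subseteq> sigma_sets (space A) {{\<mu> \<in> space A. c \<le> X \<mu>} |X c. X \<in> \<H>}"
      using G unfolding G_def[symmetric] by (auto simp: spA sets_measure_of)
  qed (use fin sets in auto)
qed

text \<open>On \<open>D m\<close> the weight is \<open>(1/2) ^ m / (N m + 1)\<close>, where the mass
  of \<open>D m\<close> exceeds \<open>N m\<close> with probability below \<open>(1/2) ^ m\<close>.
  By Borel-Cantelli almost every measure eventually obeys these bounds, so the series for
  \<langle>g, \<mu>\<rangle> converges. A function in \<open>BM\<close> lives on finitely many
  pieces, where \<open>g\<close> is bounded below by a positive constant.\<close>

lemma exists_integrable_weight:
  fixes D :: "nat \<Rightarrow> 'a::{second_countable_topology, t2_space} set" and R :: "'a measure measure"
  assumes D: "bounded_partition D" and R: "prob_space R" and sR: "sets R = sets radon_algebra"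
  obtains g :: "'a \<Rightarrow> real" where "g \<in> borel_measurable borel" "\<And>x. 0 < g x"
    "AE \<mu> in R. (\<integral>\<^sup>+x. ennreal (g x) \<partial>\<mu>) < \<infinity>" "\<And>h. h \<in> BM \<Longrightarrow> \<exists>C>0. \<forall>x. h x \<le> C * g x"
proof -
  interpret prob_space R by fact
  note [measurable_cong] = sR
  have Db [measurable]: "D m \<in> sets borel" for m using D by (auto simp: bounded_partition_def)
  have [measurable]: "(\<lambda>\<mu>. emeasure \<mu> (D m)) \<in> borel_measurable R" for m
    using measurable_emeasure_radon_algebra[OF Db] by (simp cong: measurable_cong_sets)
  have spR: "space R = radon_measures" using sets_eq_imp_space_eq[OF sR] by (simp add: space_radon_algebra)
  have fin: "emeasure \<mu> (D m) < \<infinity>" if "\<mu> \<in> space R" for \<mu> m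
    using that D by (auto simp: spR radon_measures_iff bounded_partition_def)
  have dj: "D k \<inter> D m = {}" if "k \<noteq> m" for k m
    using D that by (intro disjoint_family_onD[of D UNIV]) (auto simp: bounded_partition_def)
  define A where "A m n = {\<mu>\<in>space R. ennreal (real n) < emeasure \<mu> (D m)}" for m n
  have [measurable]: "A m n \<in> sets R" for m n unfolding A_def by measurable
  have "\<exists>n. measure R (A m n) < (1/2) ^ m" for m
  proof -
    have "(\<lambda>n. measure R (A m n)) \<longlonglongrightarrow> measure R (\<Inter>n. A m n)"
    proof (rule finite_Lim_measure_decseq)
      have "A m k \<subseteq> A m n" if "n \<le> k" for n k
      proof -
        have "ennreal (real n) \<le> ennreal (real k)" using that by (intro ennreal_leI) simp
        from le_less_trans[OF this] show ?thesis unfolding A_def by blast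
      qed
      then show "decseq (A m)" by (simp add: decseq_def)
    qed auto
    moreover have "(\<Inter>n. A m n) = {}"
    proof -
      have "\<exists>n. \<not> ennreal (real n) < emeasure \<mu> (D m)" if "\<mu> \<in> space R" for \<mu>
      proof -
        obtain n where "measure \<mu> (D m) \<le> real n" using real_arch_simple by blast
        then show ?thesis using fin[OF that, of m]
          by (intro exI[of _ n]) (auto simp: not_less emeasure_eq_ennreal_measure less_top intro!: ennreal_leI)
      qed
      then show ?thesis by (auto simp: A_def)
    qed
    ultimately have "(\<lambda>n. measure R (A m n)) \<longlonglongrightarrow> 0" by simp
    then have "eventually (\<lambda>n. measure R (A m n) < (1/2) ^ m) sequentially"
      by (rule order_tendstoD) simp
    then show ?thesis by (auto simp: eventually_sequentially)
  qed
  then obtain N where N: "\<And>m. measure R (A m (N m)) < (1/2) ^ m" by metis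
  \<comment> \<open>The summand 1 avoids division by 0 when \<open>N m = 0\<close>.\<close>
  define c where "c m = (1/2) ^ m / (real (N m) + 1)" for m
  have c0: "c m > 0" for m by (simp add: c_def add_nonneg_pos)
  define g where "g x = (\<Sum>m. c m * indicator (D m) x)" for x
  have gm: "g \<in> borel_measurable borel" unfolding g_def by measurable
  have gD: "g x = c m" if "x \<in> D m" for x m
  proof -
    have "indicator (D k) x = (0::real)" if "k \<noteq> m" for k
      using dj[OF that] \<open>x \<in> D m\<close> by (auto simp: indicator_def)
    then have "g x = (\<Sum>k\<in>{m}. c k * indicator (D k) x)"
      unfolding g_def by (intro suminf_finite) auto
    then show ?thesis using that by simp
  qed
  have cover: "\<exists>m. x \<in> D m" for x using D by (auto simp: bounded_partition_def)
  have g0: "0 < g x" for x using cover[of x] gD c0 by metis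
  have AE_fin: "AE \<mu> in R. (\<integral>\<^sup>+x. ennreal (g x) \<partial>\<mu>) < \<infinity>"
  proof -
    have "AE \<mu> in R. eventually (\<lambda>m. \<mu> \<in> space R - A m (N m)) sequentially"
    proof (rule borel_cantelli_AE1)
      show "summable (\<lambda>m. measure R (A m (N m)))"
        by (rule summable_comparison_test[of _ "\<lambda>m. (1/2) ^ m"]) (auto intro!: exI[of _ 0] less_imp_le N summable_geometric)
    qed (auto simp: less_top[symmetric])
    moreover have "AE \<mu> in R. \<mu> \<in> space R" by simp
    ultimately show ?thesis
    proof eventually_elim
      fix \<mu> assume ev: "eventually (\<lambda>m. \<mu> \<in> space R - A m (N m)) sequentially" and \<mu>: "\<mu> \<in> space R"
      have s\<mu> [measurable_cong]: "sets \<mu> = sets borel" using \<mu> spR sets_radon by auto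
      define r where "r m = c m * measure \<mu> (D m)" for m
      have r: "ennreal (c m) * emeasure \<mu> (D m) = ennreal (r m)" "0 \<le> r m" for m
        using fin[OF \<mu>, of m] c0[of m] by (auto simp: r_def emeasure_eq_ennreal_measure ennreal_mult less_top)
      have "eventually (\<lambda>m. norm (r m) \<le> (1/2) ^ m) sequentially"
        using ev
      proof eventually_elim
        fix m assume "\<mu> \<in> space R - A m (N m)"
        then have "emeasure \<mu> (D m) \<le> ennreal (real (N m))" by (auto simp: A_def not_less)
        then have "measure \<mu> (D m) \<le> real (N m)"
          using fin[OF \<mu>, of m] by (simp add: emeasure_eq_ennreal_measure less_top)
        then have "r m \<le> (1/2) ^ m / (real (N m) + 1) * (real (N m) + 1)"
          unfolding r_def c_def by (intro mult_left_mono) auto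
        then show "norm (r m) \<le> (1/2) ^ m" using r(2)[of m] by (simp add: add_nonneg_pos less_imp_neq[symmetric])
      qed
      then have "summable r"
        by (rule summable_comparison_test_ev) (simp add: summable_geometric)
      have "(\<integral>\<^sup>+x. ennreal (g x) \<partial>\<mu>) = (\<integral>\<^sup>+x. (\<Sum>m. ennreal (c m) * indicator (D m) x) \<partial>\<mu>)"
      proof (intro nn_integral_cong)
        fix x
        obtain m where m: "x \<in> D m" using cover by blast
        have "indicator (D k) x = (0::ennreal)" if "k \<noteq> m" for k
          using dj[OF that] m by (auto simp: indicator_def)
        then have "(\<Sum>k. ennreal (c k) * indicator (D k) x) = (\<Sum>k\<in>{m}. ennreal (c k) * indicator (D k) x)"
          by (intro suminf_finite) auto
        then show "ennreal (g x) = (\<Sum>m. ennreal (c m) * indicator (D m) x)" using m gD by simp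
      qed
      also have "\<dots> = (\<Sum>m. ennreal (c m) * emeasure \<mu> (D m))"
        by (subst nn_integral_suminf) (auto simp: nn_integral_cmult_indicator s\<mu>)
      also have "\<dots> = ennreal (\<Sum>m. r m)"
        unfolding r(1) using r(2) \<open>summable r\<close> by (intro suminf_ennreal2) auto
      finally show "(\<integral>\<^sup>+x. ennreal (g x) \<partial>\<mu>) < \<infinity>" by simp
    qed
  qed
  have dom: "\<exists>C>0. \<forall>x. h x \<le> C * g x" if h: "h \<in> BM" for h
  proof -
    obtain K where "\<forall>y\<in>range h. norm y \<le> K" using h unfolding BM_def bounded_iff by blast
    then have K: "\<And>x. h x \<le> K" "0 \<le> K" by (auto simp: abs_le_iff intro: order_trans[OF abs_ge_zero])
    have "compact (closure {x. h x \<noteq> 0})" using h by (simp add: BM_def)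
    then obtain n where n: "{x. h x \<noteq> 0} \<subseteq> (\<Union>m<n. D m)" using D unfolding bounded_partition_def by blast
    define C where "C = (\<Sum>m<n. K / c m) + 1"
    have S0: "0 \<le> (\<Sum>m<n. K / c m)" using K c0 by (intro sum_nonneg divide_nonneg_pos) auto
    have "h x \<le> C * g x" for x
    proof (cases "h x = 0")
      case True
      then show ?thesis using S0 g0[of x] by (simp add: C_def)
    next
      case False
      then obtain m where m: "m < n" "x \<in> D m" using n by blast
      have "K / c m \<le> (\<Sum>m<n. K / c m)"
        using m K c0 by (intro member_le_sum divide_nonneg_pos) auto
      then have "K / c m \<le> C" by (simp add: C_def)
      then have "K \<le> C * c m" using c0[of m] by (simp add: field_simps)
      then show ?thesis using K(1)[of x] gD[OF m(2)] by simp
    qed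
    then show ?thesis using S0 by (intro exI[of _ C]) (auto simp: C_def)
  qed
  show thesis using that[OF gm g0 AE_fin dom] .
qed

section \<open>Monotone solutions of Cauchy's functional equation\<close>

lemma monotone_additive_linear:
  fixes f :: "real \<Rightarrow> real"
  assumes add: "\<And>x y. 0 < x \<Longrightarrow> 0 < y \<Longrightarrow> f (x + y) = f x + f y"
    and mono: "\<And>x y. 0 < x \<Longrightarrow> x \<le> y \<Longrightarrow> f x \<le> f y" and x: "0 < x"
  shows "f x = x * f 1"
proof -
  have mult: "f (real (Suc n) * y) = real (Suc n) * f y" if "0 < y" for n y
  proof (induction n)
    case (Suc n)
    have "real (Suc (Suc n)) * y = real (Suc n) * y + y" by (simp add: algebra_simps)
    then have "f (real (Suc (Suc n)) * y) = f (real (Suc n) * y + y)" by simp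
    also have "\<dots> = f (real (Suc n) * y) + f y" using that by (intro add) auto
    finally show ?case using Suc by (simp add: algebra_simps)
  qed simp
  have f1: "0 \<le> f 1" using mono[of 1 2] add[of 1 1] by simp
  \<comment> \<open>With \<open>N\<close> the integer part of \<open>(n + 1) * x\<close>, both
    \<open>f ((n + 1) * x)\<close> and \<open>(n + 1) * x * f 1\<close> lie between
    \<open>N * f 1\<close> and \<open>(N + 1) * f 1\<close>.\<close>
  have bound: "\<bar>f x - x * f 1\<bar> \<le> 2 * f 1 / real (Suc n)" if n: "1 \<le> real (Suc n) * x" for n
  proof -
    define N where "N = nat \<lfloor>real (Suc n) * x\<rfloor>"
    have N: "real N \<le> real (Suc n) * x" "real (Suc n) * x \<le> real N + 1" "1 \<le> N"
      using n by (auto simp: N_def) linarith+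
    then obtain k where k: "N = Suc k" by (cases N) auto
    have "real N * f 1 \<le> f (real (Suc n) * x)"
      using mult[of 1 k] mono[of "real N" "real (Suc n) * x"] N k by simp
    moreover have "f (real (Suc n) * x) \<le> (real N + 1) * f 1"
      using mult[of 1 "Suc k"] mono[of "real (Suc n) * x" "real N + 1"] N k x by (simp add: algebra_simps)
    moreover have "f (real (Suc n) * x) = real (Suc n) * f x" by (rule mult[OF x])
    moreover have "real N * f 1 \<le> real (Suc n) * x * f 1" "real (Suc n) * x * f 1 \<le> (real N + 1) * f 1"
      using N f1 by (auto intro: mult_right_mono)
    ultimately have "\<bar>real (Suc n) * f x - real (Suc n) * x * f 1\<bar> \<le> 2 * f 1"
      using f1 by (simp add: abs_le_iff algebra_simps)
    also have "real (Suc n) * f x - real (Suc n) * x * f 1 = real (Suc n) * (f x - x * f 1)" by (simp add: algebra_simps)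
    finally have "real (Suc n) * \<bar>f x - x * f 1\<bar> \<le> 2 * f 1" by (simp add: abs_mult)
    then show ?thesis by (simp add: field_simps)
  qed
  have "(\<lambda>n. 2 * f 1 * (1 / real (Suc n))) \<longlonglongrightarrow> 2 * f 1 * 0"
    by (intro tendsto_intros LIMSEQ_Suc lim_1_over_n)
  moreover have "eventually (\<lambda>n. \<bar>f x - x * f 1\<bar> \<le> 2 * f 1 * (1 / real (Suc n))) sequentially"
  proof -
    obtain n0 where n0: "1 / x < real n0" using reals_Archimedean2 by blast
    show ?thesis
    proof (rule eventually_sequentiallyI[of n0])
      fix n assume "n0 \<le> n"
      then have "1 / x \<le> real (Suc n)" using n0 by linarith
      then have "1 \<le> real (Suc n) * x" using x by (simp add: field_simps)
      then show "\<bar>f x - x * f 1\<bar> \<le> 2 * f 1 * (1 / real (Suc n))" using bound by simp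
    qed
  qed
  ultimately have "\<bar>f x - x * f 1\<bar> \<le> 2 * f 1 * 0" by (intro tendsto_lowerbound) auto
  then show ?thesis by simp
qed

text \<open>Positivity at 1 spreads to all arguments, because \<open>l\<close> is decreasing and its
  values at positive integers are powers of \<open>l 1\<close>. Then minus the logarithm is additive
  and increasing.\<close>

lemma monotone_multiplicative_powr:
  fixes l :: "real \<Rightarrow> real"
  assumes mult: "\<And>x y. 0 < x \<Longrightarrow> 0 < y \<Longrightarrow> l (x + y) = l x * l y"
    and mono: "\<And>x y. 0 < x \<Longrightarrow> x \<le> y \<Longrightarrow> l y \<le> l x" and pos: "0 < l 1" and x: "0 < x"
  shows "l x = l 1 powr x"
proof -
  have ln: "l (real (Suc n)) = l 1 ^ Suc n" for n
  proof (induction n)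
    case (Suc n)
    have "l (real (Suc (Suc n))) = l (real (Suc n) + 1)" by (simp add: algebra_simps)
    also have "\<dots> = l (real (Suc n)) * l 1" by (intro mult) auto
    finally show ?case using Suc by (simp add: algebra_simps)
  qed simp
  have lpos: "0 < l y" if "0 < y" for y
  proof -
    obtain n where "y \<le> real n" using real_arch_simple by blast
    then have "l (real (Suc n)) \<le> l y" using that by (intro mono) auto
    then show ?thesis using ln[of n] pos by (metis order_less_le_trans zero_less_power)
  qed
  have "- ln (l x) = x * - ln (l 1)"
  proof (rule monotone_additive_linear[OF _ _ x])
    show "- ln (l (x + y)) = - ln (l x) + - ln (l y)" if "0 < x" "0 < y" for x y
      using lpos[OF that(1)] lpos[OF that(2)] by (simp add: mult[OF that] ln_mult)
    show "- ln (l x) \<le> - ln (l y)" if "0 < x" "x \<le> y" for x y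
      using lpos[of x] lpos[of y] that mono[OF that] by simp
  qed
  then show ?thesis using lpos[OF x] pos by (simp add: powr_def exp_ln[symmetric] del: exp_ln)
    (metis exp_ln)
qed

section \<open>Laplace transforms under scaling and convolution\<close>

lemma lap_nonneg: "0 \<le> lap R h"
  unfolding lap_def by (rule Bochner_Integration.integral_nonneg) simp

context
  fixes R :: "'a::topological_space measure measure"
  assumes R: "prob_space R" and sR: "sets R = sets radon_algebra"
begin

lemma integrable_lap: "h \<in> borel_measurable borel \<Longrightarrow> integrable R (\<lambda>\<mu>. eneg (\<integral>\<^sup>+x. h x \<partial>\<mu>))"
  using R sR by (intro integrable_eneg_nn_integral) (auto simp: prob_space_def)

lemma lap_mono:
  assumes "h \<in> borel_measurable borel" "k \<in> borel_measurable borel" "\<And>x. h x \<le> k x"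
  shows "lap R k \<le> lap R h"
  unfolding lap_def using assms
  by (intro integral_mono integrable_lap eneg_antimono nn_integral_mono) auto

lemma lap_le_1:
  assumes "h \<in> borel_measurable borel" shows "lap R h \<le> 1"
proof -
  interpret prob_space R by (rule R)
  have "lap R h \<le> (\<integral>\<mu>. 1 \<partial>R)"
    unfolding lap_def using assms by (intro integral_mono integrable_lap) auto
  then show ?thesis by (simp add: prob_space)
qed

lemma lap_pos:
  assumes "h \<in> borel_measurable borel" "AE \<mu> in R. (\<integral>\<^sup>+x. h x \<partial>\<mu>) < \<infinity>"
  shows "0 < lap R h"
proof -
  interpret prob_space R by (rule R)
  have "lap R h \<noteq> 0"
  proof
    assume "lap R h = 0"
    then have "AE \<mu> in R. eneg (\<integral>\<^sup>+x. h x \<partial>\<mu>) = 0"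
      unfolding lap_def using integrable_lap[OF assms(1)] by (subst (asm) integral_nonneg_eq_0_iff_AE) auto
    with assms(2) have "AE \<mu> in R. False" by eventually_elim auto
    then show False by simp
  qed
  then show ?thesis using lap_nonneg[of R h] by simp
qed

lemma lap_distr_scale:
  assumes "h \<in> borel_measurable borel" "0 \<le> c"
  shows "lap (distr R radon_algebra (scale_measure (ennreal c))) h = lap R (\<lambda>x. ennreal c * h x)"
proof -
  have spR: "space R = radon_measures" using sets_eq_imp_space_eq[OF sR] by (simp add: space_radon_algebra)
  have "lap (distr R radon_algebra (scale_measure (ennreal c))) h = (\<integral>\<mu>. eneg (\<integral>\<^sup>+x. h x \<partial>scale_measure (ennreal c) \<mu>) \<partial>R)"
    unfolding lap_def
    using measurable_scale_measure measurable_eneg_nn_integral[OF assms(1)]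
    by (intro integral_distr) (simp_all add: measurable_cong_sets[OF sR refl])
  also have "\<dots> = lap R (\<lambda>x. ennreal c * h x)"
    unfolding lap_def
  proof (intro Bochner_Integration.integral_cong refl)
    fix \<mu> assume "\<mu> \<in> space R"
    then have \<mu>: "\<mu> \<in> radon_measures" by (simp add: spR)
    then have "h \<in> borel_measurable \<mu>" using assms by (simp add: measurable_cong_sets[OF sets_radon refl])
    then show "eneg (\<integral>\<^sup>+x. h x \<partial>scale_measure (ennreal c) \<mu>) = eneg (\<integral>\<^sup>+x. ennreal c * h x \<partial>\<mu>)"
      by (simp add: nn_integral_radon_scale[OF \<mu> assms(1)] nn_integral_cmult)
  qed
  finally show ?thesis .
qed

end

lemma lap_convolution:
  fixes A B :: "'a::topological_space measure measure"
  assumes A: "prob_space A" "sets A = sets radon_algebra" and B: "prob_space B" "sets B = sets radon_algebra"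
    and h: "h \<in> borel_measurable borel"
  shows "lap (distr (A \<Otimes>\<^sub>M B) radon_algebra (\<lambda>(\<mu>, \<nu>). add_measure \<mu> \<nu>)) h = lap A h * lap B h"
proof -
  interpret A: prob_space A by fact
  interpret B: prob_space B by fact
  interpret P: pair_prob_space A B ..
  have s: "sets (A \<Otimes>\<^sub>M B) = sets (radon_algebra \<Otimes>\<^sub>M radon_algebra)" by (intro sets_pair_measure_cong A B)
  have spA: "space A = radon_measures" "space B = radon_measures"
    using sets_eq_imp_space_eq[OF A(2)] sets_eq_imp_space_eq[OF B(2)] by (simp_all add: space_radon_algebra)
  have "lap (distr (A \<Otimes>\<^sub>M B) radon_algebra (\<lambda>(\<mu>, \<nu>). add_measure \<mu> \<nu>)) h =
    (\<integral>p. eneg (\<integral>\<^sup>+x. h x \<partial>(case p of (\<mu>, \<nu>) \<Rightarrow> add_measure \<mu> \<nu>)) \<partial>(A \<Otimes>\<^sub>M B))"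
    unfolding lap_def using measurable_eneg_nn_integral[OF h] measurable_add_measure
    by (intro integral_distr) (simp_all add: measurable_cong_sets[OF s refl])
  also have "\<dots> = (\<integral>p. eneg (\<integral>\<^sup>+x. h x \<partial>fst p) * eneg (\<integral>\<^sup>+x. h x \<partial>snd p) \<partial>(A \<Otimes>\<^sub>M B))"
    using nn_integral_radon_add[OF _ _ h]
    by (intro Bochner_Integration.integral_cong) (auto simp: space_pair_measure spA eneg_add)
  also have "\<dots> = (\<integral>\<mu>. \<integral>\<nu>. eneg (\<integral>\<^sup>+x. h x \<partial>\<mu>) * eneg (\<integral>\<^sup>+x. h x \<partial>\<nu>) \<partial>B \<partial>A)"
  proof (subst P.integral_fst'[symmetric])
    have e: "(\<lambda>\<mu>. eneg (\<integral>\<^sup>+x. h x \<partial>\<mu>)) \<in> borel_measurable A" "(\<lambda>\<mu>. eneg (\<integral>\<^sup>+x. h x \<partial>\<mu>)) \<in> borel_measurable B"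
      using measurable_eneg_nn_integral[OF h] A(2) B(2) by (simp_all cong: measurable_cong_sets)
    show "integrable (A \<Otimes>\<^sub>M B) (\<lambda>p. eneg (\<integral>\<^sup>+x. h x \<partial>fst p) * eneg (\<integral>\<^sup>+x. h x \<partial>snd p))"
      using measurable_compose[OF measurable_fst e(1), of B] measurable_compose[OF measurable_snd e(2), of A]
      by (intro P.integrable_const_bound[where B=1] borel_measurable_times) (auto simp: abs_mult mult_le_one)
  qed simp
  also have "\<dots> = lap A h * lap B h" by (simp add: lap_def)
  finally show ?thesis .
qed

section \<open>The tangent law of a stable law\<close>

text \<open>Additivity allows a summand to be recovered measurably from a sum and the other summand,
  by subtracting codes and decoding. That each coordinate is the mass of a relatively compact set
  makes it finite on Radon measures and accessible to Laplace transforms.\<close>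

lemma exists_additive_code:
  assumes lc: "locally_compact_space (euclidean :: 'a::{second_countable_topology, t2_space} topology)"
  obtains code :: "'a::{second_countable_topology, t2_space} measure \<Rightarrow> (nat \<times> rat \<Rightarrow> real)" and dec where
    "code \<in> measurable radon_algebra borel" "dec \<in> measurable borel radon_algebra"
    "\<And>\<mu>. \<mu> \<in> radon_measures \<Longrightarrow> dec (code \<mu>) = \<mu>"
    "\<And>\<mu> \<nu>. \<mu> \<in> radon_measures \<Longrightarrow> \<nu> \<in> radon_measures \<Longrightarrow> code (add_measure \<mu> \<nu>) = (\<lambda>i. code \<mu> i + code \<nu> i)"
    "\<And>i. \<exists>B\<in>sets borel. compact (closure B) \<and> (\<forall>\<mu>. code \<mu> i = measure \<mu> B)"
proof -
  obtain D :: "nat \<Rightarrow> 'a set" where D: "bounded_partition D" using exists_bounded_partition[OF lc] by blast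
  obtain j :: "'a \<Rightarrow> real" and s where js: "j \<in> borel_measurable borel" "s \<in> borel_measurable borel"
    "\<And>x. s (j x) = x" "\<And>x. 0 \<le> j x" "\<And>x. j x < 1" using borel_retract_of_real[OF lc] by blast
  define code where "code = (\<lambda>(\<mu> :: 'a measure) (m, q). measure \<mu> {x\<in>D m. j x \<le> of_rat q})"
  have D': "\<And>m. D m \<in> sets borel" "disjoint_family D" "(\<Union>m. D m) = UNIV" "\<And>m. compact (closure (D m))"
    "\<And>B. compact (closure B) \<Longrightarrow> \<exists>n. B \<subseteq> (\<Union>m<n. D m)"
    using D by (auto simp: bounded_partition_def)
  obtain dec :: "(nat \<times> rat \<Rightarrow> real) \<Rightarrow> 'a measure" where dec: "dec \<in> measurable borel radon_algebra"
    "\<And>\<mu>. \<mu> \<in> radon_measures \<Longrightarrow> dec (code \<mu>) = \<mu>"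
    using radon_algebra_retract[OF js D'] unfolding code_def by blast
  note [measurable] = js(1) D'(1)
  have S: "{x\<in>D m. j x \<le> of_rat q} \<in> sets borel" for m q by measurable
  have fin: "emeasure \<mu> {x\<in>D m. j x \<le> of_rat q} < \<top>" if "\<mu> \<in> radon_measures" for \<mu> m q
  proof -
    have "emeasure \<mu> {x\<in>D m. j x \<le> of_rat q} \<le> emeasure \<mu> (D m)"
      using that D'(1) by (intro emeasure_mono) (auto simp: sets_radon)
    also have "\<dots> < \<top>" using that D' by (auto simp: radon_measures_iff)
    finally show ?thesis .
  qed
  have "code \<in> measurable radon_algebra borel"
  proof (rule measurable_coordinatewise_then_product)
    fix i :: "nat \<times> rat"
    show "(\<lambda>\<mu>. code \<mu> i) \<in> borel_measurable radon_algebra"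
      using measurable_emeasure_radon_algebra[OF S, of "fst i" "snd i"]
      by (cases i) (simp add: code_def measure_def)
  qed
  moreover have "code (add_measure \<mu> \<nu>) = (\<lambda>i. code \<mu> i + code \<nu> i)" if "\<mu> \<in> radon_measures" "\<nu> \<in> radon_measures" for \<mu> \<nu>
  proof
    fix i
    show "code (add_measure \<mu> \<nu>) i = code \<mu> i + code \<nu> i"
      using that S fin[OF that(1)] fin[OF that(2)]
      by (cases i) (simp add: code_def measure_def emeasure_add_measure sets_radon enn2real_plus)
  qed
  moreover have "\<exists>B\<in>sets borel. compact (closure B) \<and> (\<forall>\<mu>. code \<mu> i = measure \<mu> B)" for i
  proof (intro bexI[OF _ S] conjI allI)
    have "closure {x\<in>D (fst i). j x \<le> of_rat (snd i)} \<subseteq> closure (D (fst i))" by (rule closure_mono) auto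
    then show "compact (closure {x\<in>D (fst i). j x \<le> of_rat (snd i)})"
      using compact_Int_closed[OF D'(4)[of "fst i"] closed_closure[of "{x\<in>D (fst i). j x \<le> of_rat (snd i)}"]]
      by (simp only: Int_absorb1)
    show "code \<mu> i = measure \<mu> {x\<in>D (fst i). j x \<le> of_rat (snd i)}" for \<mu>
      by (simp add: code_def case_prod_beta')
  qed
  ultimately show thesis using dec by (intro that)
qed

text \<open>The sign \<open>s = -1\<close> suppresses measures with small \<langle>G, \<mu>\<rangle>
  and yields the approximations of the tangent law; \<open>s = 1\<close> yields the law of the
  increment between two of them. Since \<open>eneg\<close> turns sums into products, the new
  transform involves only \<open>lap A\<close> at \<open>h\<close>, \<open>G\<close> and
  \<open>h + G\<close>.\<close>

lemma tilted_law:
  fixes A :: "'a::topological_space measure measure"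
  assumes A: "prob_space A" "sets A = sets radon_algebra" and G: "G \<in> borel_measurable borel"
    and s: "s \<in> {-1, 1 :: real}" and pos: "0 < 1 + s * lap A G"
  defines "T \<equiv> density A (\<lambda>\<mu>. ennreal ((1 + s * eneg (\<integral>\<^sup>+x. G x \<partial>\<mu>)) / (1 + s * lap A G)))"
  shows "prob_space T" "sets T = sets radon_algebra"
    "\<And>h. h \<in> borel_measurable borel \<Longrightarrow> lap T h = (lap A h + s * lap A (\<lambda>x. h x + G x)) / (1 + s * lap A G)"
proof -
  interpret A: prob_space A by (rule A)
  let ?w = "\<lambda>\<mu>. (1 + s * eneg (\<integral>\<^sup>+x. G x \<partial>\<mu>)) / (1 + s * lap A G)"
  have m [measurable]: "(\<lambda>\<mu>. eneg (\<integral>\<^sup>+x. h x \<partial>\<mu>)) \<in> borel_measurable A" if "h \<in> borel_measurable borel" for h :: "'a \<Rightarrow> ennreal"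
    using measurable_eneg_nn_integral[OF that] by (simp add: measurable_cong_sets[OF A(2) refl])
  note [measurable] = m[OF G]
  have nn: "0 \<le> 1 + s * eneg x" for x using s by auto
  have w0: "0 \<le> ?w \<mu>" for \<mu> using nn pos by (intro divide_nonneg_pos)
  have i: "integrable A (\<lambda>\<mu>. eneg (\<integral>\<^sup>+x. h x \<partial>\<mu>))" if "h \<in> borel_measurable borel" for h :: "'a \<Rightarrow> ennreal"
    using that integrable_lap[OF A] by simp
  show "sets T = sets radon_algebra" by (simp add: T_def A(2))
  have spA: "space A = radon_measures" using sets_eq_imp_space_eq[OF A(2)] by (simp add: space_radon_algebra)
  show "prob_space T"
  proof
    have "emeasure T (space T) = (\<integral>\<^sup>+\<mu>. ennreal (?w \<mu>) \<partial>A)"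
      unfolding T_def by (simp add: emeasure_density cong: nn_integral_cong)
    also have "\<dots> = ennreal (\<integral>\<mu>. ?w \<mu> \<partial>A)"
      using w0 i[OF G] by (intro nn_integral_eq_integral) auto
    also have "(\<integral>\<mu>. ?w \<mu> \<partial>A) = 1"
      using i[OF G] pos by (simp add: lap_def A.prob_space)
    finally show "emeasure T (space T) = 1" by simp
  qed
  fix h :: "'a \<Rightarrow> ennreal" assume h: "h \<in> borel_measurable borel"
  have hG: "(\<lambda>x. h x + G x) \<in> borel_measurable borel" using h G by measurable
  have "lap T h = (\<integral>\<mu>. eneg (\<integral>\<^sup>+x. h x \<partial>\<mu>) \<partial>T)" by (rule lap_def)
  also have "\<dots> = (\<integral>\<mu>. ?w \<mu> * eneg (\<integral>\<^sup>+x. h x \<partial>\<mu>) \<partial>A)"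
    unfolding T_def using w0 m[OF h] by (subst integral_real_density) auto
  also have "\<dots> = (\<integral>\<mu>. (eneg (\<integral>\<^sup>+x. h x \<partial>\<mu>) + s * eneg (\<integral>\<^sup>+x. h x + G x \<partial>\<mu>)) / (1 + s * lap A G) \<partial>A)"
  proof (intro Bochner_Integration.integral_cong refl)
    fix \<mu> assume "\<mu> \<in> space A"
    then have "(\<integral>\<^sup>+x. h x + G x \<partial>\<mu>) = (\<integral>\<^sup>+x. h x \<partial>\<mu>) + (\<integral>\<^sup>+x. G x \<partial>\<mu>)"
      using h G by (intro nn_integral_add) (simp_all add: spA measurable_cong_sets[OF sets_radon refl])
    then show "?w \<mu> * eneg (\<integral>\<^sup>+x. h x \<partial>\<mu>) = (eneg (\<integral>\<^sup>+x. h x \<partial>\<mu>) + s * eneg (\<integral>\<^sup>+x. h x + G x \<partial>\<mu>)) / (1 + s * lap A G)"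
      by (simp add: eneg_add algebra_simps)
  qed
  also have "\<dots> = (lap A h + s * lap A (\<lambda>x. h x + G x)) / (1 + s * lap A G)"
    using i[OF h] i[OF hG] by (simp add: lap_def)
  finally show "lap T h = (lap A h + s * lap A (\<lambda>x. h x + G x)) / (1 + s * lap A G)" .
qed

text \<open>Numerator and denominator are divided by \<open>(1/2) ^ n\<close>; the difference
  quotients of x^t at t = 0 tend to \<open>ln x\<close>.\<close>

lemma powr_difference_quotient_tendsto:
  fixes a b c :: real
  assumes "0 < a" "0 < b" "0 < c" "c < 1"
  shows "(\<lambda>n. (a powr ((1/2) ^ n) - b powr ((1/2) ^ n)) / (1 - c powr ((1/2) ^ n))) \<longlonglongrightarrow> (ln a - ln b) / (- ln c)"
proof -
  have q: "(\<lambda>n. (x powr ((1/2) ^ n) - 1) / (1/2) ^ n) \<longlonglongrightarrow> ln x" if "0 < x" for x :: real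
  proof -
    have "((\<lambda>t. x powr t) has_real_derivative (x powr 0 * ln x)) (at 0)"
      using that by (auto intro!: derivative_eq_intros)
    then have "((\<lambda>t. (x powr (0 + t) - x powr 0) / t) \<longlongrightarrow> ln x) (at 0)"
      using that by (simp add: DERIV_def)
    moreover have "filterlim (\<lambda>n. (1/2) ^ n :: real) (at 0) sequentially"
      unfolding filterlim_at by (auto intro: LIMSEQ_power_zero)
    ultimately show ?thesis
      using filterlim_compose[of "\<lambda>t. (x powr (0 + t) - x powr 0) / t"] that by fastforce
  qed
  have "(\<lambda>n. ((a powr ((1/2) ^ n) - 1) / (1/2) ^ n - (b powr ((1/2) ^ n) - 1) / (1/2) ^ n) / (- ((c powr ((1/2) ^ n) - 1) / (1/2) ^ n)))
    \<longlonglongrightarrow> (ln a - ln b) / (- ln c)"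
    using assms by (intro tendsto_intros q) auto
  also have "(\<lambda>n. ((a powr ((1/2) ^ n) - 1) / (1/2) ^ n - (b powr ((1/2) ^ n) - 1) / (1/2) ^ n) / (- ((c powr ((1/2) ^ n) - 1) / (1/2) ^ n)))
    = (\<lambda>n. (a powr ((1/2) ^ n) - b powr ((1/2) ^ n)) / (1 - c powr ((1/2) ^ n)))"
  proof
    fix n
    have e: "((a - 1) / t - (b - 1) / t) / (- ((c - 1) / t)) = (a - b) / (1 - c)" if "t \<noteq> 0" for a b c t :: real
    proof -
      have "(a - 1) / t - (b - 1) / t = (a - b) / t" "- ((c - 1) / t) = (1 - c) / t"
        by (simp_all add: diff_divide_distrib)
      then show ?thesis using that by simp
    qed
    show "((a powr ((1/2) ^ n) - 1) / (1/2) ^ n - (b powr ((1/2) ^ n) - 1) / (1/2) ^ n) / (- ((c powr ((1/2) ^ n) - 1) / (1/2) ^ n)) = (a powr ((1/2) ^ n) - b powr ((1/2) ^ n)) / (1 - c powr ((1/2) ^ n))"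
      by (rule e) simp
  qed
  finally show ?thesis .
qed

text \<open>Strict stability enters as an identity of Laplace transforms. It is demanded for all
  measurable functions, since it will be applied to the weight as well as to
  \<open>BM\<close>.\<close>

locale stable_laplace =
  fixes R :: "'a::{second_countable_topology, t2_space} measure measure" and \<alpha> :: real
  assumes lc: "locally_compact_space (euclidean :: 'a topology)"
    and R: "prob_space R" and sR: "sets R = sets radon_algebra" and \<alpha>: "0 < \<alpha>"
    and stable: "\<And>t h. 0 \<le> t \<Longrightarrow> t \<le> 1 \<Longrightarrow> h \<in> borel_measurable borel \<Longrightarrow>
      lap R (\<lambda>x. ennreal (t powr (1 / \<alpha>)) * h x) * lap R (\<lambda>x. ennreal ((1 - t) powr (1 / \<alpha>)) * h x) = lap R h"
begin

text \<open>The transform at \<open>s powr (1 / \<alpha>) * h\<close> is multiplicative in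
  \<open>s\<close>: stability with \<open>t = x / (x + y)\<close> is applied to the function
  \<open>(x + y) powr (1 / \<alpha>) * h\<close>. A monotone multiplicative function is a power, and
  \<open>s = c powr \<alpha>\<close> gives the claim.\<close>

lemma lap_scale:
  assumes h [measurable]: "h \<in> borel_measurable borel" and pos: "0 < lap R h" and c: "0 < c"
  shows "lap R (\<lambda>x. ennreal c * h x) = lap R h powr (c powr \<alpha>)"
proof -
  define l where "l s = lap R (\<lambda>x. ennreal (s powr (1 / \<alpha>)) * h x)" for s
  have l1: "l 1 = lap R h" by (simp add: l_def)
  have "l s = l 1 powr s" if "0 < s" for s
  proof (rule monotone_multiplicative_powr[OF _ _ _ that])
    show "l (x + y) = l x * l y" if xy: "0 < x" "0 < y" for x y
    proof -
      have e: "ennreal ((z / (x + y)) powr (1 / \<alpha>)) * (ennreal ((x + y) powr (1 / \<alpha>)) * u) = ennreal (z powr (1 / \<alpha>)) * u"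
        if "0 < z" for z u
      proof -
        have "(z / (x + y)) powr (1 / \<alpha>) * (x + y) powr (1 / \<alpha>) = z powr (1 / \<alpha>)"
          using that xy by (subst powr_mult[symmetric]) auto
        then show ?thesis by (simp add: mult.assoc[symmetric] ennreal_mult[symmetric])
      qed
      have t: "1 - x / (x + y) = y / (x + y)" using xy by (simp add: field_simps)
      have "lap R (\<lambda>z. ennreal ((x / (x + y)) powr (1 / \<alpha>)) * (ennreal ((x + y) powr (1 / \<alpha>)) * h z)) *
          lap R (\<lambda>z. ennreal ((1 - x / (x + y)) powr (1 / \<alpha>)) * (ennreal ((x + y) powr (1 / \<alpha>)) * h z)) = l (x + y)"
        unfolding l_def using xy by (intro stable) (auto simp: field_simps)
      then show ?thesis unfolding t e[OF xy(1)] e[OF xy(2)] l_def by simp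
    qed
    show "l y \<le> l x" if "0 < x" "x \<le> y" for x y
      unfolding l_def using that \<alpha> by (intro lap_mono[OF R sR] mult_right_mono ennreal_leI powr_mono2) auto
    show "0 < l 1" using pos l1 by simp
  qed
  from this[of "c powr \<alpha>"] show ?thesis using c \<alpha> by (simp add: l_def l1[unfolded l_def] powr_powr)
qed

end

locale weighted_stable_laplace = stable_laplace +
  fixes g :: "'a::{second_countable_topology, t2_space} \<Rightarrow> real"
  assumes g [measurable]: "g \<in> borel_measurable borel" and g_pos: "\<And>x. 0 < g x"
    and g_fin: "AE \<mu> in R. (\<integral>\<^sup>+x. ennreal (g x) \<partial>\<mu>) < \<infinity>"
    and g_dom: "\<And>h. h \<in> BM \<Longrightarrow> \<exists>C>0. \<forall>x. h x \<le> C * g x"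
begin

text \<open>A cone that contains \<open>BM\<close> and the weight and on which the pairing is almost
  surely finite under \<open>R\<close>; hence Laplace transforms are positive there and their
  logarithms can be taken.\<close>

definition dominated :: "('a \<Rightarrow> ennreal) \<Rightarrow> bool" where
  "dominated h \<longleftrightarrow> h \<in> borel_measurable borel \<and> (\<exists>C>0. \<forall>x. h x \<le> ennreal (C * g x))"

lemma dominated_meas: "dominated h \<Longrightarrow> h \<in> borel_measurable borel"
  by (simp add: dominated_def)

lemma dominated_BM: "h \<in> BM \<Longrightarrow> dominated (\<lambda>x. ennreal (h x))"
  using g_dom[of h] by (auto simp: dominated_def ennreal_BM_measurable intro!: ennreal_leI)

lemma dominated_g: "dominated (\<lambda>x. ennreal (g x))"
  unfolding dominated_def by (auto intro!: exI[of _ 1])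

lemma dominated_add: "dominated h \<Longrightarrow> dominated k \<Longrightarrow> dominated (\<lambda>x. h x + k x)"
proof -
  assume hk: "dominated h" "dominated k"
  then obtain C E where C: "C > 0" "\<And>x. h x \<le> ennreal (C * g x)" and E: "E > 0" "\<And>x. k x \<le> ennreal (E * g x)"
    by (auto simp: dominated_def)
  have "h x + k x \<le> ennreal ((C + E) * g x)" for x
    using add_mono[OF C(2)[of x] E(2)[of x]] C(1) E(1) g_pos[of x] by (simp add: distrib_right)
  then show ?thesis using hk C(1) E(1) by (auto simp: dominated_def intro!: exI[of _ "C + E"])
qed

lemma dominated_cmult: "dominated h \<Longrightarrow> 0 \<le> c \<Longrightarrow> dominated (\<lambda>x. ennreal c * h x)"
proof -
  assume h: "dominated h" and c: "0 \<le> c"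
  then obtain C where C: "C > 0" "\<And>x. h x \<le> ennreal (C * g x)" by (auto simp: dominated_def)
  have "ennreal c * h x \<le> ennreal ((c * C + 1) * g x)" for x
  proof -
    have "ennreal c * h x \<le> ennreal c * ennreal (C * g x)" using C by (intro mult_left_mono) auto
    also have "\<dots> = ennreal (c * C * g x)" using c C g_pos[of x] by (simp add: ennreal_mult[symmetric] mult.assoc)
    also have "\<dots> \<le> ennreal ((c * C + 1) * g x)" using g_pos[of x] by (intro ennreal_leI) (simp add: distrib_right)
    finally show ?thesis .
  qed
  then show ?thesis using h c C(1) by (auto simp: dominated_def intro!: exI[of _ "c * C + 1"] add_nonneg_pos)
qed

lemma dominated_integral_finite:
  assumes h: "dominated h" and \<mu>: "\<mu> \<in> radon_measures" and fin: "(\<integral>\<^sup>+x. ennreal (g x) \<partial>\<mu>) < \<infinity>"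
  shows "(\<integral>\<^sup>+x. h x \<partial>\<mu>) < \<infinity>"
proof -
  obtain C where C: "C > 0" "\<And>x. h x \<le> ennreal (C * g x)" using h by (auto simp: dominated_def)
  have "(\<integral>\<^sup>+x. h x \<partial>\<mu>) \<le> (\<integral>\<^sup>+x. ennreal C * ennreal (g x) \<partial>\<mu>)"
    using C g_pos by (intro nn_integral_mono) (simp add: ennreal_mult[symmetric] less_imp_le)
  also have "\<dots> = ennreal C * (\<integral>\<^sup>+x. ennreal (g x) \<partial>\<mu>)"
    using sets_radon[OF \<mu>] by (intro nn_integral_cmult) (simp cong: measurable_cong_sets)
  also have "\<dots> < \<infinity>" using fin by (simp add: ennreal_mult_less_top)
  finally show ?thesis .
qed

lemma spR: "space R = radon_measures"
  using sets_eq_imp_space_eq[OF sR] by (simp add: space_radon_algebra)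

lemma lap_dominated_pos: "dominated h \<Longrightarrow> 0 < lap R h"
proof (rule lap_pos[OF R sR])
  assume h: "dominated h"
  show "AE \<mu> in R. (\<integral>\<^sup>+x. h x \<partial>\<mu>) < \<infinity>"
    using g_fin AE_space by eventually_elim (auto simp: spR intro: dominated_integral_finite[OF h, simplified])
qed (rule dominated_meas)

end

context weighted_stable_laplace
begin

abbreviation G :: "'a \<Rightarrow> ennreal" where "G \<equiv> \<lambda>x. ennreal (g x)"

text \<open>By stability this is the law of one summand when a random measure of law
  \<open>R\<close> is split into \<open>2 ^ n\<close> independent identically distributed
  parts.\<close>

definition scaled :: "nat \<Rightarrow> 'a measure measure" where
  "scaled n = distr R radon_algebra (scale_measure (ennreal (((1/2) ^ n) powr (1 / \<alpha>))))"

definition tilt :: "real \<Rightarrow> nat \<Rightarrow> 'a measure measure" where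
  "tilt s n = density (scaled n) (\<lambda>\<mu>. ennreal ((1 + s * eneg (\<integral>\<^sup>+x. G x \<partial>\<mu>)) / (1 + s * lap (scaled n) G)))"

lemma prob_space_scaled: "prob_space (scaled n)" "sets (scaled n) = sets radon_algebra"
  unfolding scaled_def using R measurable_scale_measure
  by (auto intro!: prob_space.prob_space_distr simp: measurable_cong_sets[OF sR refl])

lemma lap_scaled:
  assumes h: "dominated h" shows "lap (scaled n) h = lap R h powr ((1/2) ^ n)"
proof -
  have "lap (scaled n) h = lap R h powr ((((1/2) ^ n) powr (1 / \<alpha>)) powr \<alpha>)"
    unfolding scaled_def using dominated_meas[OF h] lap_dominated_pos[OF h]
    by (subst lap_distr_scale[OF R sR]) (auto intro!: lap_scale)
  also have "(((1/2) ^ n :: real) powr (1 / \<alpha>)) powr \<alpha> = (1/2) ^ n"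
    using \<alpha> by (simp add: powr_powr)
  finally show ?thesis .
qed

lemma lap_G: "0 < lap R G" "lap R G \<le> 1"
  using lap_dominated_pos[OF dominated_g] lap_le_1[OF R sR] by auto

text \<open>With \<open>\<tau> = 2^-n\<close>, tilting \<open>scaled n\<close> by \<open>1 - exp (- \<langle>g, \<cdot>\<rangle>)\<close> convolves well with tilting \<open>scaled (n + 1)\<close> by
  \<open>1 + exp (- \<langle>g, \<cdot>\<rangle>)\<close>: on Laplace transforms this is the factorization of a difference of squares.\<close>

lemma exists_tangent_law:
  assumes L1: "lap R G \<noteq> 1"
  obtains Q where "prob_space Q" "sets Q = sets radon_algebra"
    "\<And>h. dominated h \<Longrightarrow> lap Q h = (ln (lap R h) - ln (lap R (\<lambda>x. h x + G x))) / (- ln (lap R G))"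
proof -
  have L: "0 < lap R G" "lap R G < 1" using lap_G L1 by auto
  have Lp: "0 < lap R G powr ((1/2) ^ n)" "lap R G powr ((1/2) ^ n) < 1" for n
    using L powr_less_mono2[of "(1/2) ^ n" "lap R G" 1] by auto
  define Q where "Q n = tilt (-1) n" for n
  define K where "K n = tilt 1 (Suc n)" for n
  have tilt: "prob_space (tilt s n)" "sets (tilt s n) = sets radon_algebra"
    "\<And>h. dominated h \<Longrightarrow> lap (tilt s n) h = (lap R h powr ((1/2) ^ n) + s * lap R (\<lambda>x. h x + G x) powr ((1/2) ^ n)) / (1 + s * lap R G powr ((1/2) ^ n))"
    if s: "s \<in> {-1, 1}" for s n
  proof -
    have pos: "0 < 1 + s * lap (scaled n) G"
      unfolding lap_scaled[OF dominated_g] using s Lp[of n] by (auto intro: add_pos_pos simp del: powr_gt_zero)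
    have Gm: "G \<in> borel_measurable borel" by simp
    note t = tilted_law[OF prob_space_scaled Gm s pos]
    show "prob_space (tilt s n)" "sets (tilt s n) = sets radon_algebra"
      unfolding tilt_def using t by auto
    show "lap (tilt s n) h = (lap R h powr ((1/2) ^ n) + s * lap R (\<lambda>x. h x + G x) powr ((1/2) ^ n)) / (1 + s * lap R G powr ((1/2) ^ n))"
      if h: "dominated h" for h
      using t(3)[OF dominated_meas[OF h]] lap_scaled[OF h] lap_scaled[OF dominated_g] lap_scaled[OF dominated_add[OF h dominated_g]]
      unfolding tilt_def by simp
  qed
  have Qn: "prob_space (Q n)" "sets (Q n) = sets radon_algebra" for n using tilt(1,2)[of "-1"] by (auto simp: Q_def)
  have Kn: "prob_space (K n)" "sets (K n) = sets radon_algebra" for n using tilt(1,2)[of 1] by (auto simp: K_def)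
  have lapQ: "lap (Q n) h = (lap R h powr ((1/2) ^ n) - lap R (\<lambda>x. h x + G x) powr ((1/2) ^ n)) / (1 - lap R G powr ((1/2) ^ n))"
    if "dominated h" for h n using tilt(3)[of "-1" h n] that by (simp add: Q_def)
  have lapK: "lap (K n) h = (lap R h powr ((1/2) ^ Suc n) + lap R (\<lambda>x. h x + G x) powr ((1/2) ^ Suc n)) / (1 + lap R G powr ((1/2) ^ Suc n))"
    if "dominated h" for h n using tilt(3)[of 1 h "Suc n"] that by (simp add: K_def)
  have conv: "distr (Q (Suc n) \<Otimes>\<^sub>M K n) radon_algebra (\<lambda>(\<mu>, \<nu>). add_measure \<mu> \<nu>) = Q n" for n
  proof (rule laplace_unique[OF lc])
    interpret Qi: prob_space "Q (Suc n)" by (rule Qn)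
    interpret Ki: prob_space "K n" by (rule Kn)
    interpret QK: pair_prob_space "Q (Suc n)" "K n" ..
    have s: "sets (Q (Suc n) \<Otimes>\<^sub>M K n) = sets (radon_algebra \<Otimes>\<^sub>M radon_algebra)" by (intro sets_pair_measure_cong Qn Kn)
    have "prob_space (distr (Q (Suc n) \<Otimes>\<^sub>M K n) radon_algebra (\<lambda>(\<mu>, \<nu>). add_measure \<mu> \<nu>))"
      using measurable_add_measure by (intro QK.prob_space_distr) (simp add: measurable_cong_sets[OF s refl])
    then show "finite_measure (distr (Q (Suc n) \<Otimes>\<^sub>M K n) radon_algebra (\<lambda>(\<mu>, \<nu>). add_measure \<mu> \<nu>))"
      by (simp add: prob_space_def)
    show "finite_measure (Q n)" using Qn by (simp add: prob_space_def)
    fix h :: "'a \<Rightarrow> real" assume h: "h \<in> BM"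
    let ?h = "\<lambda>x. ennreal (h x)"
    have dh: "dominated ?h" using h by (rule dominated_BM)
    have sq: "x powr ((1/2) ^ n) = (x powr ((1/2) ^ Suc n))\<^sup>2" for x :: real
      by (simp add: power2_eq_square powr_add[symmetric])
    have alg: "(a - b) / (1 - c) * ((a + b) / (1 + c)) = (a\<^sup>2 - b\<^sup>2) / (1 - c\<^sup>2)" for a b c :: real
      by (simp add: power2_eq_square algebra_simps)
    have "lap (distr (Q (Suc n) \<Otimes>\<^sub>M K n) radon_algebra (\<lambda>(\<mu>, \<nu>). add_measure \<mu> \<nu>)) ?h = lap (Q (Suc n)) ?h * lap (K n) ?h"
      by (intro lap_convolution Qn Kn dominated_meas[OF dh])
    also have "\<dots> = lap (Q n) ?h"
      unfolding lapQ[OF dh] lapK[OF dh] alg sq[symmetric] by simp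
    finally show "lap (distr (Q (Suc n) \<Otimes>\<^sub>M K n) radon_algebra (\<lambda>(\<mu>, \<nu>). add_measure \<mu> \<nu>)) ?h = lap (Q n) ?h" .
  qed (simp_all add: Qn)
  obtain code :: "'a measure \<Rightarrow> (nat \<times> rat \<Rightarrow> real)" and dec where
    code: "code \<in> measurable radon_algebra borel" "dec \<in> measurable borel radon_algebra"
    "\<And>\<mu>. \<mu> \<in> radon_measures \<Longrightarrow> dec (code \<mu>) = \<mu>"
    "\<And>\<mu> \<nu>. \<mu> \<in> radon_measures \<Longrightarrow> \<nu> \<in> radon_measures \<Longrightarrow> code (add_measure \<mu> \<nu>) = (\<lambda>i. code \<mu> i + code \<nu> i)"
  proof (rule exists_additive_code[OF lc])
    fix code :: "'a measure \<Rightarrow> (nat \<times> rat \<Rightarrow> real)" and dec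
    assume "code \<in> measurable radon_algebra borel" "dec \<in> measurable borel radon_algebra"
      "\<And>\<mu>. \<mu> \<in> radon_measures \<Longrightarrow> dec (code \<mu>) = \<mu>"
      "\<And>\<mu> \<nu>. \<mu> \<in> radon_measures \<Longrightarrow> \<nu> \<in> radon_measures \<Longrightarrow> code (add_measure \<mu> \<nu>) = (\<lambda>i. code \<mu> i + code \<nu> i)"
    then show thesis by (rule that)
  qed
  interpret br: backward_recursion radon_algebra Q K "\<lambda>_. add_measure" code dec
    by (rule backward_recursion.intro) (simp_all add: Qn Kn conv code(1-3) space_radon_algebra measurable_add_measure)
  obtain \<Omega> :: "(nat \<Rightarrow> nat \<times> rat \<Rightarrow> real) measure" and \<eta> where \<Omega>: "prob_space \<Omega>"
    and \<eta>: "\<And>n. \<eta> n \<in> measurable \<Omega> radon_algebra"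
    and joint: "\<And>n. distr \<Omega> (radon_algebra \<Otimes>\<^sub>M radon_algebra) (\<lambda>\<omega>. (\<eta> n \<omega>, \<eta> (Suc n) \<omega>)) =
      distr (Q (Suc n) \<Otimes>\<^sub>M K n) (radon_algebra \<Otimes>\<^sub>M radon_algebra) (\<lambda>(\<mu>, \<kappa>). (add_measure \<mu> \<kappa>, \<mu>))"
  proof (rule br.inverse_limit_exists)
    fix \<Omega> :: "(nat \<Rightarrow> nat \<times> rat \<Rightarrow> real) measure" and \<eta>
    assume "prob_space \<Omega>" "\<And>n. \<eta> n \<in> measurable \<Omega> radon_algebra"
      "\<And>n. distr \<Omega> (radon_algebra \<Otimes>\<^sub>M radon_algebra) (\<lambda>\<omega>. (\<eta> n \<omega>, \<eta> (Suc n) \<omega>)) =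
        distr (Q (Suc n) \<Otimes>\<^sub>M K n) (radon_algebra \<Otimes>\<^sub>M radon_algebra) (\<lambda>(\<mu>, \<kappa>). (add_measure \<mu> \<kappa>, \<mu>))"
    then show thesis by (rule that)
  qed
  interpret \<Omega>: prob_space \<Omega> by (rule \<Omega>)
  note [measurable] = \<eta> code(1,2) measurable_add_measure
  have \<eta>rad: "\<eta> n \<omega> \<in> radon_measures" if "\<omega> \<in> space \<Omega>" for n \<omega>
    using measurable_space[OF \<eta> that] by (simp add: space_radon_algebra)
  have law: "distr \<Omega> radon_algebra (\<eta> n) = Q n" for n
  proof -
    have s: "sets (Q (Suc n) \<Otimes>\<^sub>M K n) = sets (radon_algebra \<Otimes>\<^sub>M radon_algebra)" by (intro sets_pair_measure_cong Qn Kn)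
    have m: "(\<lambda>(\<mu>, \<kappa>). (add_measure \<mu> \<kappa>, \<mu>)) \<in> measurable (Q (Suc n) \<Otimes>\<^sub>M K n) (radon_algebra \<Otimes>\<^sub>M radon_algebra)"
      unfolding measurable_cong_sets[OF s refl]
      using measurable_Pair[OF measurable_add_measure measurable_fst] by (simp add: case_prod_beta')
    have "distr \<Omega> radon_algebra (\<eta> n) = distr (distr \<Omega> (radon_algebra \<Otimes>\<^sub>M radon_algebra) (\<lambda>\<omega>. (\<eta> n \<omega>, \<eta> (Suc n) \<omega>))) radon_algebra fst"
      by (subst distr_distr) (auto simp: comp_def)
    also have "\<dots> = distr (Q (Suc n) \<Otimes>\<^sub>M K n) radon_algebra (\<lambda>(\<mu>, \<nu>). add_measure \<mu> \<nu>)"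
      unfolding joint by (subst distr_distr[OF _ m]) (auto simp: comp_def case_prod_beta')
    finally show ?thesis using conv by simp
  qed
  \<comment> \<open>The joint law provides the increment only as a variable on another space;
    subtracting codes recreates it on \<open>\<Omega>\<close> as a measurable function of two
    consecutive states.\<close>
  define diff where "diff \<mu> \<nu> = dec (\<lambda>i. code \<mu> i - code \<nu> i)" for \<mu> \<nu>
  \<comment> \<open>Equality of two measures is expressed by countably many real equations, which
    makes it a measurable event; decoding both sides turns it back into an equation of
    measures.\<close>
  define rel where "rel \<mu> \<nu> \<longleftrightarrow> (\<forall>i. code \<mu> i = code (add_measure \<nu> (diff \<mu> \<nu>)) i)" for \<mu> \<nu>
  have coord: "(\<lambda>\<mu>. code \<mu> i) \<in> borel_measurable radon_algebra" for i
    by (rule measurable_compose[OF code(1)]) (intro borel_measurable_continuous_onI continuous_on_product_coordinates)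
  have diffm: "(\<lambda>\<omega>. diff (u \<omega>) (v \<omega>)) \<in> measurable M radon_algebra"
    if [measurable]: "u \<in> measurable M radon_algebra" "v \<in> measurable M radon_algebra" for u v and M :: "'m measure"
    unfolding diff_def
  proof (rule measurable_compose[OF _ code(2)], rule measurable_coordinatewise_then_product)
    show "(\<lambda>\<omega>. code (u \<omega>) i - code (v \<omega>) i) \<in> borel_measurable M" for i
      using measurable_compose[OF that(1) coord] measurable_compose[OF that(2) coord] by measurable
  qed
  have relm: "Measurable.pred M (\<lambda>\<omega>. rel (u \<omega>) (v \<omega>))"
    if u: "u \<in> measurable M radon_algebra" and v: "v \<in> measurable M radon_algebra" for u v and M :: "'m measure"
  proof -
    have a: "(\<lambda>\<omega>. add_measure (v \<omega>) (diff (u \<omega>) (v \<omega>))) \<in> measurable M radon_algebra"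
      using measurable_compose[OF measurable_Pair[OF v diffm[OF u v]] measurable_add_measure] by simp
    show ?thesis
      unfolding rel_def using measurable_compose[OF u coord] measurable_compose[OF a coord] by measurable
  qed
  have diff_rad: "diff \<mu> \<nu> \<in> radon_measures" for \<mu> \<nu>
    using measurable_space[OF code(2)] by (simp add: diff_def space_radon_algebra)
  have rel_eq: "\<mu> = add_measure \<nu> (diff \<mu> \<nu>)" if "rel \<mu> \<nu>" "\<mu> \<in> radon_measures" "\<nu> \<in> radon_measures" for \<mu> \<nu>
  proof -
    have "code \<mu> = code (add_measure \<nu> (diff \<mu> \<nu>))" using that(1) by (auto simp: rel_def)
    then have "dec (code \<mu>) = dec (code (add_measure \<nu> (diff \<mu> \<nu>)))" by simp
    then show ?thesis using code(3)[OF that(2)] code(3)[OF add_measure_radon[OF that(3) diff_rad]] by simp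
  qed
  have rel_add: "rel (add_measure \<mu> \<kappa>) \<mu>" if "\<mu> \<in> radon_measures" "\<kappa> \<in> radon_measures" for \<mu> \<kappa>
    using code(3,4) that by (simp add: rel_def diff_def)
  have AE_rel: "AE \<omega> in \<Omega>. rel (\<eta> n \<omega>) (\<eta> (Suc n) \<omega>)" for n
  proof -
    have s: "sets (Q (Suc n) \<Otimes>\<^sub>M K n) = sets (radon_algebra \<Otimes>\<^sub>M radon_algebra)" by (intro sets_pair_measure_cong Qn Kn)
    have m: "(\<lambda>(\<mu>, \<kappa>). (add_measure \<mu> \<kappa>, \<mu>)) \<in> measurable (Q (Suc n) \<Otimes>\<^sub>M K n) (radon_algebra \<Otimes>\<^sub>M radon_algebra)"
      unfolding measurable_cong_sets[OF s refl]
      using measurable_Pair[OF measurable_add_measure measurable_fst] by (simp add: case_prod_beta')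
    have p: "{p \<in> space (radon_algebra \<Otimes>\<^sub>M radon_algebra). rel (fst p) (snd p)} \<in> sets (radon_algebra \<Otimes>\<^sub>M radon_algebra)"
      using relm[OF measurable_fst measurable_snd] by (simp add: pred_def)
    have "AE p in distr (Q (Suc n) \<Otimes>\<^sub>M K n) (radon_algebra \<Otimes>\<^sub>M radon_algebra) (\<lambda>(\<mu>, \<kappa>). (add_measure \<mu> \<kappa>, \<mu>)). rel (fst p) (snd p)"
      unfolding AE_distr_iff[OF m p] using rel_add
      by (intro AE_I2) (auto simp: space_pair_measure sets_eq_imp_space_eq[OF Qn(2)] sets_eq_imp_space_eq[OF Kn(2)] space_radon_algebra)
    then show ?thesis
      unfolding joint[symmetric] by (subst (asm) AE_distr_iff[OF _ p]) auto
  qed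
  obtain D :: "nat \<Rightarrow> 'a set" where D: "bounded_partition D" using exists_bounded_partition[OF lc] by blast
  define good where "good \<omega> \<longleftrightarrow> (\<forall>n. rel (\<eta> n \<omega>) (\<eta> (Suc n) \<omega>))" for \<omega>
  have [measurable]: "Measurable.pred \<Omega> good" unfolding good_def using relm[OF \<eta> \<eta>] by measurable
  have AE_good: "AE \<omega> in \<Omega>. good \<omega>" unfolding good_def using AE_rel by (simp add: AE_all_countable)
  define limit where "limit \<omega> \<nu> \<longleftrightarrow> \<nu> \<in> radon_measures \<and>
    (\<forall>h\<in>borel_measurable borel. (\<integral>\<^sup>+x. h x \<partial>\<eta> 0 \<omega>) < \<infinity> \<longrightarrow> (\<lambda>n. \<integral>\<^sup>+x. h x \<partial>\<eta> n \<omega>) \<longlonglongrightarrow> (\<integral>\<^sup>+x. h x \<partial>\<nu>))" for \<omega> \<nu>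
  have ex_limit: "\<exists>\<nu>. limit \<omega> \<nu>" if "\<omega> \<in> space \<Omega>" "good \<omega>" for \<omega>
  proof -
    have "\<eta> n \<omega> = add_measure (\<eta> (Suc n) \<omega>) (diff (\<eta> n \<omega>) (\<eta> (Suc n) \<omega>))" for n
      using that \<eta>rad by (intro rel_eq) (auto simp: good_def)
    note ex = decreasing_radon_limit[where \<eta>="\<lambda>n. \<eta> n \<omega>" and \<kappa>="\<lambda>n. diff (\<eta> n \<omega>) (\<eta> (Suc n) \<omega>)", OF D \<eta>rad[OF that(1)] diff_rad this]
    show ?thesis
    proof (rule ex)
      fix \<nu> :: "'a measure"
      assume "\<nu> \<in> radon_measures" "\<And>h. h \<in> borel_measurable borel \<Longrightarrow> (\<integral>\<^sup>+x. h x \<partial>\<eta> 0 \<omega>) < \<infinity> \<Longrightarrow>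
        (\<lambda>n. \<integral>\<^sup>+x. h x \<partial>\<eta> n \<omega>) \<longlonglongrightarrow> (\<integral>\<^sup>+x. h x \<partial>\<nu>)"
      then have "limit \<omega> \<nu>" by (simp add: limit_def)
      then show ?thesis by (rule exI)
    qed
  qed
  \<comment> \<open>Choosing the limit with \<open>SOME\<close> says nothing about measurability,
    which is obtained below from limits of the masses of \<open>B \<inter> D m\<close>.\<close>
  define tail where "tail \<omega> = (if good \<omega> then SOME \<nu>. limit \<omega> \<nu> else zero_measure)" for \<omega>
  have lim: "limit \<omega> (tail \<omega>)" if "\<omega> \<in> space \<Omega>" "good \<omega>" for \<omega>
    using someI_ex[OF ex_limit[OF that]] that by (simp add: tail_def)
  have rad: "tail \<omega> \<in> radon_measures" if "\<omega> \<in> space \<Omega>" for \<omega>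
    using lim[OF that] by (cases "good \<omega>") (auto simp: limit_def tail_def)
  have tailm: "tail \<in> measurable \<Omega> radon_algebra"
  proof (rule measurable_radon_algebra)
    fix B :: "'a set" assume B: "B \<in> sets borel"
    have BD: "B \<inter> D m \<in> sets borel" for m using B D by (auto simp: bounded_partition_def)
    have [measurable]: "(\<lambda>\<omega>. emeasure (\<eta> n \<omega>) (B \<inter> D m)) \<in> borel_measurable \<Omega>" for n m
      by (rule measurable_compose[OF \<eta> measurable_emeasure_radon_algebra[OF BD]])
    have "(\<lambda>\<omega>. if good \<omega> then \<Sum>m. liminf (\<lambda>n. emeasure (\<eta> n \<omega>) (B \<inter> D m)) else 0) \<in> borel_measurable \<Omega>"
      by measurable
    also have "?this \<longleftrightarrow> (\<lambda>\<omega>. emeasure (tail \<omega>) B) \<in> borel_measurable \<Omega>"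
    proof (intro measurable_cong)
      fix \<omega> assume \<omega>: "\<omega> \<in> space \<Omega>"
      show "(if good \<omega> then \<Sum>m. liminf (\<lambda>n. emeasure (\<eta> n \<omega>) (B \<inter> D m)) else 0) = emeasure (tail \<omega>) B"
      proof (cases "good \<omega>")
        case True
        have "liminf (\<lambda>n. emeasure (\<eta> n \<omega>) (B \<inter> D m)) = emeasure (tail \<omega>) (B \<inter> D m)" for m
        proof -
          have i: "(\<integral>\<^sup>+x. indicator (B \<inter> D m) x \<partial>\<mu>) = emeasure \<mu> (B \<inter> D m)" if "\<mu> \<in> radon_measures" for \<mu>
            using BD that by (intro nn_integral_indicator) (simp add: sets_radon)
          have "emeasure (\<eta> 0 \<omega>) (B \<inter> D m) \<le> emeasure (\<eta> 0 \<omega>) (D m)"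
            using D \<eta>rad[OF \<omega>, of 0] by (intro emeasure_mono) (auto simp: bounded_partition_def sets_radon)
          also have "\<dots> < \<infinity>" using D \<eta>rad[OF \<omega>, of 0] by (auto simp: bounded_partition_def radon_measures_iff)
          finally have "(\<integral>\<^sup>+x. indicator (B \<inter> D m) x \<partial>\<eta> 0 \<omega>) < \<infinity>" by (simp add: i \<eta>rad[OF \<omega>])
          moreover have "indicator (B \<inter> D m) \<in> borel_measurable borel" using BD by simp
          ultimately have "(\<lambda>n. \<integral>\<^sup>+x. indicator (B \<inter> D m) x \<partial>\<eta> n \<omega>) \<longlonglongrightarrow> (\<integral>\<^sup>+x. indicator (B \<inter> D m) x \<partial>tail \<omega>)"
            using lim[OF \<omega> True] unfolding limit_def by blast
          then have "(\<lambda>n. emeasure (\<eta> n \<omega>) (B \<inter> D m)) \<longlonglongrightarrow> emeasure (tail \<omega>) (B \<inter> D m)"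
            by (simp only: i \<eta>rad[OF \<omega>] rad[OF \<omega>])
          then show ?thesis by (rule lim_imp_Liminf[OF sequentially_bot])
        qed
        then show ?thesis using True emeasure_partition[OF D sets_radon[OF rad[OF \<omega>]] B] by simp
      qed (simp add: tail_def)
    qed
    finally show "(\<lambda>\<omega>. emeasure (tail \<omega>) B) \<in> borel_measurable \<Omega>" .
  qed (rule rad)
  \<comment> \<open>\<open>Q 0\<close> has a density with respect to \<open>scaled 0\<close>, whose
    scaling factor is 1, so almost sure finiteness of \<langle>g, \<mu>\<rangle> is inherited from
    \<open>R\<close>.\<close>
  have AE_fin: "AE \<omega> in \<Omega>. (\<integral>\<^sup>+x. G x \<partial>\<eta> 0 \<omega>) < \<infinity>"
  proof -
    have Gm: "G \<in> borel_measurable borel" by simp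
    note GM = measurable_nn_integral_radon_algebra[OF Gm]
    have p: "{\<mu>\<in>space radon_algebra. (\<integral>\<^sup>+x. G x \<partial>\<mu>) < \<infinity>} \<in> sets radon_algebra" using GM by measurable
    have "AE \<mu> in R. (\<integral>\<^sup>+x. G x \<partial>scale_measure (ennreal (((1/2) ^ 0) powr (1 / \<alpha>))) \<mu>) < \<infinity>"
      using g_fin AE_space
    proof eventually_elim
      fix \<mu> assume "(\<integral>\<^sup>+x. G x \<partial>\<mu>) < \<infinity>" "\<mu> \<in> space R"
      then show "(\<integral>\<^sup>+x. G x \<partial>scale_measure (ennreal (((1/2) ^ 0) powr (1 / \<alpha>))) \<mu>) < \<infinity>"
        by (subst nn_integral_radon_scale[OF _ Gm]) (auto simp: spR ennreal_mult_less_top)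
    qed
    then have "AE \<mu> in scaled 0. (\<integral>\<^sup>+x. G x \<partial>\<mu>) < \<infinity>"
      unfolding scaled_def
    proof (subst AE_distr_iff[OF _ p])
      show "scale_measure (ennreal (((1/2) ^ 0) powr (1 / \<alpha>))) \<in> measurable R radon_algebra"
        unfolding measurable_cong_sets[OF sR refl] by (rule measurable_scale_measure)
    qed
    then have "AE \<mu> in Q 0. (\<integral>\<^sup>+x. G x \<partial>\<mu>) < \<infinity>"
      unfolding Q_def tilt_def using measurable_eneg_nn_integral[OF Gm]
      by (subst AE_density) (auto simp: measurable_cong_sets[OF prob_space_scaled(2) refl])
    then show ?thesis unfolding law[symmetric] by (subst (asm) AE_distr_iff[OF \<eta> p])
  qed
  show thesis
  proof
    show "prob_space (distr \<Omega> radon_algebra tail)" by (rule \<Omega>.prob_space_distr[OF tailm])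
    show "sets (distr \<Omega> radon_algebra tail) = sets radon_algebra" by simp
    fix h assume h: "dominated h"
    note em = measurable_eneg_nn_integral[OF dominated_meas[OF h]]
    have "(\<lambda>n. \<integral>\<omega>. eneg (\<integral>\<^sup>+x. h x \<partial>\<eta> n \<omega>) \<partial>\<Omega>) \<longlonglongrightarrow> (\<integral>\<omega>. eneg (\<integral>\<^sup>+x. h x \<partial>tail \<omega>) \<partial>\<Omega>)"
    proof (rule integral_dominated_convergence[where w="\<lambda>_. 1"])
      show "AE \<omega> in \<Omega>. (\<lambda>n. eneg (\<integral>\<^sup>+x. h x \<partial>\<eta> n \<omega>)) \<longlonglongrightarrow> eneg (\<integral>\<^sup>+x. h x \<partial>tail \<omega>)"
        using AE_good AE_fin AE_space
      proof eventually_elim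
        fix \<omega> assume \<omega>: "good \<omega>" "(\<integral>\<^sup>+x. G x \<partial>\<eta> 0 \<omega>) < \<infinity>" "\<omega> \<in> space \<Omega>"
        have fin: "(\<integral>\<^sup>+x. h x \<partial>\<eta> 0 \<omega>) < \<infinity>" by (rule dominated_integral_finite[OF h \<eta>rad[OF \<omega>(3)] \<omega>(2)])
        have l: "(\<lambda>n. \<integral>\<^sup>+x. h x \<partial>\<eta> n \<omega>) \<longlonglongrightarrow> (\<integral>\<^sup>+x. h x \<partial>tail \<omega>)"
          using lim[OF \<omega>(3,1)] fin dominated_meas[OF h] unfolding limit_def by blast
        \<comment> \<open>The bound by the state at index 0 passes to the limit and keeps its
          integral finite, where \<open>tendsto_eneg\<close> applies.\<close>
        have le: "(\<integral>\<^sup>+x. h x \<partial>\<eta> n \<omega>) \<le> (\<integral>\<^sup>+x. h x \<partial>\<eta> 0 \<omega>)" for n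
        proof (induction n)
          case (Suc n)
          have "\<eta> n \<omega> = add_measure (\<eta> (Suc n) \<omega>) (diff (\<eta> n \<omega>) (\<eta> (Suc n) \<omega>))"
            using \<omega> \<eta>rad by (intro rel_eq) (auto simp: good_def)
          then have "(\<integral>\<^sup>+x. h x \<partial>\<eta> n \<omega>) = (\<integral>\<^sup>+x. h x \<partial>\<eta> (Suc n) \<omega>) + (\<integral>\<^sup>+x. h x \<partial>diff (\<eta> n \<omega>) (\<eta> (Suc n) \<omega>))"
            using nn_integral_radon_add[OF \<eta>rad[OF \<omega>(3)] diff_rad dominated_meas[OF h]] by metis
          then show ?case using Suc by (metis le_iff_add order_trans)
        qed simp
        have "(\<integral>\<^sup>+x. h x \<partial>tail \<omega>) \<le> (\<integral>\<^sup>+x. h x \<partial>\<eta> 0 \<omega>)"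
          using le by (intro LIMSEQ_le_const2[OF l]) auto
        then have "(\<integral>\<^sup>+x. h x \<partial>tail \<omega>) < \<top>" using fin by simp
        then show "(\<lambda>n. eneg (\<integral>\<^sup>+x. h x \<partial>\<eta> n \<omega>)) \<longlonglongrightarrow> eneg (\<integral>\<^sup>+x. h x \<partial>tail \<omega>)"
          by (rule tendsto_eneg[OF l])
      qed
    qed (use measurable_compose[OF \<eta> em] measurable_compose[OF tailm em] in auto)
    also have "(\<integral>\<omega>. eneg (\<integral>\<^sup>+x. h x \<partial>tail \<omega>) \<partial>\<Omega>) = lap (distr \<Omega> radon_algebra tail) h"
      unfolding lap_def by (rule integral_distr[OF tailm em, symmetric])
    also have "(\<lambda>n. \<integral>\<omega>. eneg (\<integral>\<^sup>+x. h x \<partial>\<eta> n \<omega>) \<partial>\<Omega>) = (\<lambda>n. lap (Q n) h)"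
      unfolding law[symmetric] lap_def using integral_distr[OF \<eta> em] by simp
    finally have "(\<lambda>n. lap (Q n) h) \<longlonglongrightarrow> lap (distr \<Omega> radon_algebra tail) h" .
    moreover have "(\<lambda>n. lap (Q n) h) \<longlonglongrightarrow> (ln (lap R h) - ln (lap R (\<lambda>x. h x + G x))) / (- ln (lap R G))"
      unfolding lapQ[OF h] using lap_dominated_pos[OF h] lap_dominated_pos[OF dominated_add[OF h dominated_g]] L
      by (intro powr_difference_quotient_tendsto) auto
    ultimately show "lap (distr \<Omega> radon_algebra tail) h = (ln (lap R h) - ln (lap R (\<lambda>x. h x + G x))) / (- ln (lap R G))"
      by (rule LIMSEQ_unique)
  qed
qed

end

section \<open>Levy measures\<close>

lemma measurable_nonzero_radon:
  assumes "f \<in> measurable radon_algebra M" shows "f \<in> measurable nonzero_radon_algebra M"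
  unfolding nonzero_radon_algebra_def using assms by (rule measurable_restrict_space1)

lemma measurable_eneg_nonzero:
  "h \<in> borel_measurable borel \<Longrightarrow> (\<lambda>\<mu>. eneg (\<integral>\<^sup>+x. h x \<partial>\<mu>)) \<in> borel_measurable nonzero_radon_algebra"
  by (rule measurable_nonzero_radon[OF measurable_eneg_nn_integral])

lemma nn_integral_pos_radon:
  assumes "g \<in> borel_measurable borel" "\<And>x. 0 < g x" "\<mu> \<in> radon_measures" "\<mu> \<noteq> zero_measure"
  shows "(\<integral>\<^sup>+x. ennreal (g x) \<partial>\<mu>) \<noteq> 0"
proof
  assume "(\<integral>\<^sup>+x. ennreal (g x) \<partial>\<mu>) = 0"
  then have "AE x in \<mu>. ennreal (g x) = 0"
    using assms(1) sets_radon[OF assms(3)] by (subst (asm) nn_integral_0_iff_AE) (auto cong: measurable_cong_sets)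
  then have "AE x in \<mu>. (1::ennreal) = 0"
  proof eventually_elim
    fix x assume "ennreal (g x) = 0"
    then show "(1::ennreal) = 0" using assms(2)[of x] by (simp add: ennreal_eq_0_iff)
  qed
  then have "(\<integral>\<^sup>+x. 1 \<partial>\<mu>) = (\<integral>\<^sup>+x. 0 \<partial>\<mu>)" by (rule nn_integral_cong_AE)
  then have "emeasure \<mu> (space \<mu>) = 0" by simp
  then show False
    using assms(4) measure_eq_0_iff_null_measure[OF sets_radon[OF assms(3)]] sets_eq_imp_space_eq[OF sets_radon[OF assms(3)]] by simp
qed

text \<open>A Levy measure need not be finite, but its tilt by \<open>1 - exp (- \<langle>g, \<cdot>\<rangle>)\<close> is, and loses no information
  when \<open>g\<close> is strictly positive.\<close>

lemma levy_measure_unique: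
  fixes \<Lambda>1 \<Lambda>2 :: "'a::{second_countable_topology, t2_space} measure measure"
  assumes lc: "locally_compact_space (euclidean :: 'a topology)"
    and sets: "sets \<Lambda>1 = sets nonzero_radon_algebra" "sets \<Lambda>2 = sets nonzero_radon_algebra"
    and g [measurable]: "g \<in> borel_measurable borel" and g_pos: "\<And>x. 0 < g x"
    and eq: "\<And>h. h \<in> BM \<Longrightarrow> (\<integral>\<^sup>+\<mu>. ennreal (eneg (\<integral>\<^sup>+x. ennreal (h x) \<partial>\<mu>) * (1 - eneg (\<integral>\<^sup>+x. ennreal (g x) \<partial>\<mu>))) \<partial>\<Lambda>1)
       = (\<integral>\<^sup>+\<mu>. ennreal (eneg (\<integral>\<^sup>+x. ennreal (h x) \<partial>\<mu>) * (1 - eneg (\<integral>\<^sup>+x. ennreal (g x) \<partial>\<mu>))) \<partial>\<Lambda>2)"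
    and fin: "(\<integral>\<^sup>+\<mu>. ennreal (1 - eneg (\<integral>\<^sup>+x. ennreal (g x) \<partial>\<mu>)) \<partial>\<Lambda>1) < \<infinity>"
  shows "\<Lambda>1 = \<Lambda>2"
proof -
  define W where "W \<mu> = 1 - eneg (\<integral>\<^sup>+x. ennreal (g x) \<partial>\<mu>)" for \<mu>
  have W0: "0 \<le> W \<mu>" for \<mu> by (simp add: W_def)
  have Wm: "W \<in> borel_measurable radon_algebra"
    unfolding W_def using measurable_eneg_nn_integral[of "\<lambda>x. ennreal (g x)"] by simp
  have Wpos: "0 < W \<mu>" if "\<mu> \<in> radon_measures - {zero_measure}" for \<mu>
    using eneg_less_1[OF nn_integral_pos_radon[OF g g_pos, of \<mu>]] that by (simp add: W_def)
  \<comment> \<open>The identity map moves the tilted measure from the nonzero Radon measures to all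
    of them, where Laplace transforms determine finite measures.\<close>
  define T where "T \<Lambda> = distr (density \<Lambda> (\<lambda>\<mu>. ennreal (W \<mu>))) radon_algebra (\<lambda>\<mu>. \<mu>)" for \<Lambda>
  have idm: "(\<lambda>\<mu>. \<mu>) \<in> measurable nonzero_radon_algebra radon_algebra"
    by (rule measurable_nonzero_radon) simp
  have nnT: "(\<integral>\<^sup>+\<mu>. f \<mu> \<partial>T \<Lambda>) = (\<integral>\<^sup>+\<mu>. ennreal (W \<mu>) * f \<mu> \<partial>\<Lambda>)"
    if s: "sets \<Lambda> = sets nonzero_radon_algebra" and f: "f \<in> borel_measurable radon_algebra" for \<Lambda> f
  proof -
    have "(\<integral>\<^sup>+\<mu>. f \<mu> \<partial>T \<Lambda>) = (\<integral>\<^sup>+\<mu>. f \<mu> \<partial>density \<Lambda> (\<lambda>\<mu>. ennreal (W \<mu>)))"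
      unfolding T_def using idm f by (intro nn_integral_distr) (simp_all add: measurable_cong_sets[OF s refl])
    also have "\<dots> = (\<integral>\<^sup>+\<mu>. ennreal (W \<mu>) * f \<mu> \<partial>\<Lambda>)"
      using measurable_nonzero_radon[OF Wm] measurable_nonzero_radon[OF f]
      by (intro nn_integral_density) (simp_all add: measurable_cong_sets[OF s refl])
    finally show ?thesis .
  qed
  have zero_BM: "(\<lambda>_. 0) \<in> BM" by (auto simp: BM_def)
  have fin': "(\<integral>\<^sup>+\<mu>. ennreal (W \<mu>) \<partial>\<Lambda>2) = (\<integral>\<^sup>+\<mu>. ennreal (W \<mu>) \<partial>\<Lambda>1)"
    using eq[OF zero_BM] by (simp add: W_def)
  have "T \<Lambda>1 = T \<Lambda>2"
  proof (rule laplace_unique[OF lc])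
    have "finite_measure (T \<Lambda>)" if s: "sets \<Lambda> = sets nonzero_radon_algebra" and "(\<integral>\<^sup>+\<mu>. ennreal (W \<mu>) \<partial>\<Lambda>) < \<infinity>" for \<Lambda>
      using nnT[OF s, of "\<lambda>_. 1"] that(2) by (intro finite_measureI) simp
    then show "finite_measure (T \<Lambda>1)" "finite_measure (T \<Lambda>2)" using sets fin fin' by (auto simp: W_def)
    fix h :: "'a \<Rightarrow> real" assume h: "h \<in> BM"
    have em: "(\<lambda>\<mu>. eneg (\<integral>\<^sup>+x. ennreal (h x) \<partial>\<mu>)) \<in> borel_measurable radon_algebra"
      by (rule measurable_eneg_nn_integral[OF ennreal_BM_measurable[OF h]])
    have "lap (T \<Lambda>) (\<lambda>x. ennreal (h x)) = enn2real (\<integral>\<^sup>+\<mu>. ennreal (eneg (\<integral>\<^sup>+x. ennreal (h x) \<partial>\<mu>) * W \<mu>) \<partial>\<Lambda>)"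
      if s: "sets \<Lambda> = sets nonzero_radon_algebra" for \<Lambda>
    proof -
      have "lap (T \<Lambda>) (\<lambda>x. ennreal (h x)) = enn2real (\<integral>\<^sup>+\<mu>. ennreal (eneg (\<integral>\<^sup>+x. ennreal (h x) \<partial>\<mu>)) \<partial>T \<Lambda>)"
        unfolding lap_def using em by (intro integral_eq_nn_integral) (auto simp: T_def)
      also have "(\<integral>\<^sup>+\<mu>. ennreal (eneg (\<integral>\<^sup>+x. ennreal (h x) \<partial>\<mu>)) \<partial>T \<Lambda>) = (\<integral>\<^sup>+\<mu>. ennreal (W \<mu>) * ennreal (eneg (\<integral>\<^sup>+x. ennreal (h x) \<partial>\<mu>)) \<partial>\<Lambda>)"
        using em by (intro nnT[OF s]) simp
      finally show ?thesis using W0 by (simp add: ennreal_mult[symmetric] mult.commute)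
    qed
    then show "lap (T \<Lambda>1) (\<lambda>x. ennreal (h x)) = lap (T \<Lambda>2) (\<lambda>x. ennreal (h x))"
      using eq[OF h] sets by (simp add: W_def)
  qed (simp_all add: T_def)
  moreover have "emeasure \<Lambda> A = (\<integral>\<^sup>+\<mu>. ennreal (1 / W \<mu>) * indicator A \<mu> \<partial>T \<Lambda>)"
    if s: "sets \<Lambda> = sets nonzero_radon_algebra" and A: "A \<in> sets nonzero_radon_algebra" for \<Lambda> A
  proof -
    have A': "A \<in> sets radon_algebra" "A \<subseteq> radon_measures - {zero_measure}"
      using A by (auto simp: sets_nonzero_radon_algebra_iff)
    have "(\<integral>\<^sup>+\<mu>. ennreal (1 / W \<mu>) * indicator A \<mu> \<partial>T \<Lambda>) = (\<integral>\<^sup>+\<mu>. ennreal (W \<mu>) * (ennreal (1 / W \<mu>) * indicator A \<mu>) \<partial>\<Lambda>)"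
      using Wm borel_measurable_indicator[OF A'(1)] by (intro nnT[OF s]) measurable
    also have "\<dots> = (\<integral>\<^sup>+\<mu>. indicator A \<mu> \<partial>\<Lambda>)"
    proof (intro nn_integral_cong)
      fix \<mu>
      show "ennreal (W \<mu>) * (ennreal (1 / W \<mu>) * indicator A \<mu>) = indicator A \<mu>"
      proof (cases "\<mu> \<in> A")
        case True
        then have "0 < W \<mu>" using A' Wpos by auto
        then have "ennreal (W \<mu>) * ennreal (1 / W \<mu>) = 1" by (simp add: ennreal_mult[symmetric])
        then show ?thesis by (simp add: mult.assoc[symmetric])
      qed simp
    qed
    also have "\<dots> = emeasure \<Lambda> A" using A s by simp
    finally show ?thesis by simp
  qed
  ultimately show ?thesis
    using sets by (intro measure_eqI) auto
qed

text \<open>Finiteness on relatively compact sets follows from integrability. With cutoff functions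
  \<open>f n\<close> of an exhaustion, the vaguely open sets where \<langle>f n, \<mu>\<rangle>
  exceeds \<open>1 / Suc k\<close> cover the nonzero measures. On such a set the integrand is at
  least \<open>1 - exp (- (1 / Suc k))\<close>, so its mass is finite, and finitely many of these
  sets cover a compact closure.\<close>

lemma levy_measureI:
  fixes \<Lambda> :: "'a::{second_countable_topology, t2_space} measure measure"
  assumes lc: "locally_compact_space (euclidean :: 'a topology)"
    and sets: "sets \<Lambda> = sets nonzero_radon_algebra"
    and fin: "\<And>h. h \<in> BM \<Longrightarrow> (\<integral>\<^sup>+\<mu>. ennreal (1 - exp (- pairing h \<mu>)) \<partial>\<Lambda>) < \<infinity>"
  shows "levy_measure \<Lambda>"
  unfolding levy_measure_def radon_measure_on_def
proof (intro conjI ballI impI sets fin)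
  fix B :: "'a measure set" assume B: "B \<in> sets nonzero_radon_algebra" and comp: "compactin nonzero_vague_topology (nonzero_vague_topology closure_of B)"
  have sp: "space \<Lambda> = radon_measures - {zero_measure}"
    using sets_eq_imp_space_eq[OF sets] by (simp add: space_nonzero_radon_algebra)
  obtain C :: "nat \<Rightarrow> 'a set" where C: "\<And>n. compact (C n)" "\<And>n. C n \<subseteq> interior (C (Suc n))" "(\<Union>n. C n) = UNIV"
    using compact_exhaustion[OF lc] by blast
  have "\<exists>f :: 'a \<Rightarrow> real. continuous_on UNIV f \<and> compact (closure {x. f x \<noteq> 0}) \<and> (\<forall>x. 0 \<le> f x \<and> f x \<le> 1) \<and> (\<forall>x\<in>C n. f x = 1)" for n
    using compact_cutoff[OF lc C(1)[of n]] by metis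
  then obtain f :: "nat \<Rightarrow> 'a \<Rightarrow> real" where f: "\<And>n. continuous_on UNIV (f n)" "\<And>n. compact (closure {x. f n x \<noteq> 0})"
    "\<And>n x. 0 \<le> f n x" "\<And>n x. f n x \<le> 1" "\<And>n x. x \<in> C n \<Longrightarrow> f n x = 1"
    by metis
  have fBM: "f n \<in> BM" for n
    using f(1-4) borel_measurable_continuous_onI[OF f(1)] by (auto simp: BM_def intro!: boundedI[of _ 1])
  define U where "U p = {\<mu> \<in> radon_measures. (\<integral>x. f (fst p) x \<partial>\<mu>) \<in> {1 / Suc (snd p)<..}} \<inter> (radon_measures - {zero_measure})" for p :: "nat \<times> nat"
  have topsp: "topspace (vague_topology :: 'a measure topology) = radon_measures"
  proof -
    have "radon_measures \<in> {{\<mu> \<in> radon_measures. (\<integral>x. f x \<partial>\<mu>) \<in> U} | (f :: 'a \<Rightarrow> real) U.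
        continuous_on UNIV f \<and> compact (closure {x. f x \<noteq> 0}) \<and> open U}"
      by (intro CollectI exI[of _ "\<lambda>_. 0"] exI[of _ UNIV]) auto
    then show ?thesis unfolding vague_topology_def topology_generated_by_topspace by blast
  qed
  have Uo: "openin nonzero_vague_topology (U p)" for p
  proof -
    have "{\<mu> \<in> radon_measures. (\<integral>x. f (fst p) x \<partial>\<mu>) \<in> {1 / Suc (snd p)<..}} \<in>
       {{\<mu> \<in> radon_measures. (\<integral>x. f x \<partial>\<mu>) \<in> U} | (f :: 'a \<Rightarrow> real) U.
          continuous_on UNIV f \<and> compact (closure {x. f x \<noteq> 0}) \<and> open U}"
      using f(1,2) by (intro CollectI exI[of _ "f (fst p)"] exI[of _ "{1 / Suc (snd p)<..}"]) simp
    from topology_generated_by_Basis[OF this] show ?thesis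
      unfolding U_def nonzero_vague_topology_def vague_topology_def openin_subtopology by blast
  qed
  have "nonzero_vague_topology closure_of B \<subseteq> radon_measures - {zero_measure}"
    using closure_of_subset_topspace[of nonzero_vague_topology B] by (auto simp: nonzero_vague_topology_def topsp)
  also have "\<dots> \<subseteq> (\<Union>p. U p)"
  proof
    fix \<mu> :: "'a measure" assume \<mu>: "\<mu> \<in> radon_measures - {zero_measure}"
    have "\<exists>n. emeasure \<mu> (C n) \<noteq> 0"
    proof (rule ccontr)
      assume "\<nexists>n. emeasure \<mu> (C n) \<noteq> 0"
      then have "C n \<in> null_sets \<mu>" for n
        using \<mu> C(1) by (auto simp: null_sets_def sets_radon intro: borel_closed compact_imp_closed)
      then have "(\<Union>n. C n) \<in> null_sets \<mu>" by (intro null_sets_UN) auto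
      then show False using \<mu> C(3) measure_eq_0_iff_null_measure[OF sets_radon, of \<mu>] by (auto simp: null_sets_def)
    qed
    then obtain n where n: "emeasure \<mu> (C n) \<noteq> 0" by blast
    have Cb: "C n \<in> sets \<mu>" using \<mu> C(1) by (auto simp: sets_radon intro: borel_closed compact_imp_closed)
    have "0 < emeasure \<mu> (C n)" using n by (simp add: zero_less_iff_neq_zero)
    also have "emeasure \<mu> (C n) = (\<integral>\<^sup>+x. indicator (C n) x \<partial>\<mu>)" using Cb by simp
    also have "\<dots> \<le> (\<integral>\<^sup>+x. ennreal (f n x) \<partial>\<mu>)"
      using f(5) by (intro nn_integral_mono) (auto simp: indicator_def)
    also have "\<dots> = ennreal (pairing (f n) \<mu>)" using BM_nn_integral_finite[OF fBM] \<mu> by auto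
    finally have "0 < (\<integral>x. f n x \<partial>\<mu>)" by (simp add: pairing_def)
    then obtain k where "1 / Suc k < (\<integral>x. f n x \<partial>\<mu>)" using nat_approx_posE by (metis of_nat_Suc)
    then have "\<mu> \<in> U (n, k)" using \<mu> by (simp add: U_def)
    then show "\<mu> \<in> (\<Union>p. U p)" by blast
  qed
  finally have cov: "nonzero_vague_topology closure_of B \<subseteq> \<Union>(range U)" by simp
  have "openin nonzero_vague_topology V" if "V \<in> range U" for V using that Uo by blast
  from compactinD[OF comp this cov] obtain F where F: "finite F" "F \<subseteq> range U" "nonzero_vague_topology closure_of B \<subseteq> \<Union>F"
    by blast
  obtain P where P: "finite P" "F = U ` P" using F(1,2) by (meson finite_subset_image)
  have Um: "U p \<in> sets \<Lambda>" and Ufin: "emeasure \<Lambda> (U p) < \<infinity>" for p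
  proof -
    let ?w = "\<lambda>\<mu>. 1 - exp (- pairing (f (fst p)) \<mu>)" and ?c = "1 - exp (- (1 / Suc (snd p)))"
    have c: "0 < ?c" by simp
    have pm: "(\<lambda>\<mu>. enn2real (\<integral>\<^sup>+x. ennreal (f (fst p) x) \<partial>\<mu>)) \<in> borel_measurable nonzero_radon_algebra"
      using measurable_nonzero_radon[OF measurable_nn_integral_radon_algebra[OF ennreal_BM_measurable[OF fBM]]] by simp
    have pe: "pairing (f (fst p)) \<mu> = enn2real (\<integral>\<^sup>+x. ennreal (f (fst p) x) \<partial>\<mu>)" if "\<mu> \<in> radon_measures" for \<mu>
      using BM_nn_integral_finite[OF fBM that] by simp
    have Ueq: "U p = {\<mu>\<in>space nonzero_radon_algebra. 1 / Suc (snd p) < enn2real (\<integral>\<^sup>+x. ennreal (f (fst p) x) \<partial>\<mu>)}"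
      using pe by (auto simp: U_def space_nonzero_radon_algebra pairing_def[symmetric])
    also have "\<dots> \<in> sets nonzero_radon_algebra" using pm by measurable
    finally show Um: "U p \<in> sets \<Lambda>" by (simp add: sets)
    have "ennreal ?c * emeasure \<Lambda> (U p) = (\<integral>\<^sup>+\<mu>. ennreal ?c * indicator (U p) \<mu> \<partial>\<Lambda>)"
      using Um by (simp add: nn_integral_cmult_indicator)
    also have "\<dots> \<le> (\<integral>\<^sup>+\<mu>. ennreal (?w \<mu>) \<partial>\<Lambda>)"
      by (intro nn_integral_mono) (auto simp: U_def indicator_def pairing_def intro!: ennreal_leI)
    also have "\<dots> < \<infinity>" by (rule fin[OF fBM])
    finally show "emeasure \<Lambda> (U p) < \<infinity>" using c by (auto simp: ennreal_mult_less_top)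
  qed
  have "B \<subseteq> nonzero_vague_topology closure_of B"
    using B by (intro closure_of_subset) (auto simp: nonzero_vague_topology_def topsp sets_nonzero_radon_algebra_iff)
  then have "emeasure \<Lambda> B \<le> emeasure \<Lambda> (\<Union>p\<in>P. U p)"
    using F(3) P Um by (intro emeasure_mono) auto
  also have "\<dots> \<le> (\<Sum>p\<in>P. emeasure \<Lambda> (U p))"
    using P(1) Um by (intro emeasure_subadditive_finite) auto
  also have "\<dots> < \<infinity>" using Ufin P(1) by simp
  finally show "emeasure \<Lambda> B < \<infinity>" .
qed

text \<open>Since \<alpha> < 1, the factor (1 + C/n)^\<alpha> is at most 1 + C/n, so the increment
  is at most C n^(\<alpha> - 1).\<close>

lemma powr_increment_tendsto_0:
  fixes \<alpha> C :: real
  assumes "0 < \<alpha>" "\<alpha> < 1" "0 \<le> C"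
  shows "(\<lambda>n. (real n + C) powr \<alpha> - real n powr \<alpha>) \<longlonglongrightarrow> 0"
proof (rule tendsto_sandwich)
  show "eventually (\<lambda>n. 0 \<le> (real n + C) powr \<alpha> - real n powr \<alpha>) sequentially"
    using assms by (intro always_eventually allI) (auto intro!: powr_mono2)
  show "eventually (\<lambda>n. (real n + C) powr \<alpha> - real n powr \<alpha> \<le> C * real n powr (\<alpha> - 1)) sequentially"
  proof (rule eventually_sequentiallyI[of 1])
    fix n :: nat assume n: "1 \<le> n"
    have "real n * (1 + C / real n) = real n + C" using n by (simp add: distrib_left)
    then have "(real n + C) powr \<alpha> = (real n * (1 + C / real n)) powr \<alpha>" by simp
    also have "\<dots> = real n powr \<alpha> * (1 + C / real n) powr \<alpha>" by (rule powr_mult)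
    also have "\<dots> \<le> real n powr \<alpha> * (1 + C / real n) powr 1"
      using assms n by (intro mult_left_mono powr_mono) auto
    also have "\<dots> = real n powr \<alpha> + C * real n powr (\<alpha> - 1)"
      using n assms by (simp add: powr_diff field_simps)
    finally show "(real n + C) powr \<alpha> - real n powr \<alpha> \<le> C * real n powr (\<alpha> - 1)" by simp
  qed
  have "(\<lambda>n. real n powr (\<alpha> - 1)) \<longlonglongrightarrow> 0"
    using assms by (intro tendsto_neg_powr filterlim_real_sequentially) auto
  then show "(\<lambda>n. C * real n powr (\<alpha> - 1)) \<longlonglongrightarrow> 0" using tendsto_mult_right_zero by blast
qed simp

text \<open>Expanding 1 / (1 - exp (- y)) turns division by the weight into differences of
  exponentials at \<open>k * y\<close> and \<open>x + k * y\<close>, which Laplace transforms can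
  integrate. An infinite \<open>y\<close> is included: then only the term with \<open>k = 0\<close>
  survives.\<close>

lemma geometric_expansion_eneg:
  assumes "y \<noteq> 0"
  shows "(\<lambda>k. eneg (ennreal (real k) * y) - eneg (x + ennreal (real k) * y)) sums ((1 - eneg x) / (1 - eneg y))"
proof -
  have e: "eneg (ennreal (real k) * y) = eneg y ^ k" for k
    using eneg_mult_of_nat[of k y] by (simp add: ennreal_of_nat_eq_real_of_nat)
  have "(\<lambda>k. (1 - eneg x) * eneg y ^ k) sums ((1 - eneg x) * (1 / (1 - eneg y)))"
    using eneg_less_1[OF assms] by (intro sums_mult geometric_sums) simp
  then show ?thesis by (simp add: e eneg_add left_diff_distrib)
qed

context weighted_stable_laplace
begin

definition phi :: "('a \<Rightarrow> ennreal) \<Rightarrow> real" where "phi h = - ln (lap R h)"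

lemma lap_0: "lap R (\<lambda>x. 0) = 1"
  using prob_space.prob_space[OF R] by (simp add: lap_def)

lemma phi_nonneg: "dominated h \<Longrightarrow> 0 \<le> phi h"
  using lap_dominated_pos[of h] lap_le_1[OF R sR dominated_meas, of h] by (simp add: phi_def)

lemma exp_phi: "dominated h \<Longrightarrow> exp (- phi h) = lap R h"
  using lap_dominated_pos[of h] by (simp add: phi_def)

lemma phi_cmult: "dominated h \<Longrightarrow> 0 \<le> c \<Longrightarrow> phi (\<lambda>x. ennreal c * h x) = c powr \<alpha> * phi h"
  using lap_scale[OF dominated_meas lap_dominated_pos, of h c] lap_dominated_pos[of h]
  by (cases "c = 0") (auto simp: phi_def lap_0 ln_powr)

lemma phi_mono: "dominated h \<Longrightarrow> dominated k \<Longrightarrow> (\<And>x. h x \<le> k x) \<Longrightarrow> phi h \<le> phi k"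
  using lap_mono[OF R sR dominated_meas dominated_meas, of h k] lap_dominated_pos[of h] lap_dominated_pos[of k]
  by (simp add: phi_def)

text \<open>With \<open>h \<le> C * g\<close>, monotonicity and the scaling of \<open>phi\<close>
  squeeze the increment between 0 and
  \<open>((n + C) powr \<alpha> - n powr \<alpha>) * phi G\<close>.\<close>

lemma phi_increment_tendsto_0:
  assumes a1: "\<alpha> < 1" and h: "dominated h"
  shows "(\<lambda>n. phi (\<lambda>x. h x + ennreal (real n) * G x) - phi (\<lambda>x. ennreal (real n) * G x)) \<longlonglongrightarrow> 0"
proof -
  obtain C where C: "C > 0" "\<And>x. h x \<le> ennreal (C * g x)" using h by (auto simp: dominated_def)
  have nG: "dominated (\<lambda>x. ennreal (real n) * G x)" for n by (intro dominated_cmult dominated_g) simp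
  have hG: "dominated (\<lambda>x. h x + ennreal (real n) * G x)" for n by (intro dominated_add nG h)
  have CG: "dominated (\<lambda>x. ennreal (real n + C) * G x)" for n using C by (intro dominated_cmult dominated_g) simp
  have le: "phi (\<lambda>x. h x + ennreal (real n) * G x) \<le> phi (\<lambda>x. ennreal (real n + C) * G x)" for n
  proof (rule phi_mono[OF hG CG])
    fix x
    have "h x + ennreal (real n) * G x \<le> ennreal (C * g x) + ennreal (real n) * G x" using C by (intro add_mono) auto
    also have "\<dots> = ennreal (real n + C) * G x"
      using C g_pos[of x] by (simp add: ennreal_mult[symmetric] ennreal_plus[symmetric] distrib_right add.commute del: ennreal_plus)
    finally show "h x + ennreal (real n) * G x \<le> ennreal (real n + C) * G x" .
  qed
  show ?thesis
  proof (rule tendsto_sandwich)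
    show "eventually (\<lambda>n. 0 \<le> phi (\<lambda>x. h x + ennreal (real n) * G x) - phi (\<lambda>x. ennreal (real n) * G x)) sequentially"
      using phi_mono[OF nG hG] by (intro always_eventually allI) simp
    show "eventually (\<lambda>n. phi (\<lambda>x. h x + ennreal (real n) * G x) - phi (\<lambda>x. ennreal (real n) * G x)
       \<le> ((real n + C) powr \<alpha> - real n powr \<alpha>) * phi G) sequentially"
    proof (intro always_eventually allI)
      fix n
      show "phi (\<lambda>x. h x + ennreal (real n) * G x) - phi (\<lambda>x. ennreal (real n) * G x)
       \<le> ((real n + C) powr \<alpha> - real n powr \<alpha>) * phi G"
        using le[of n] C phi_cmult[OF dominated_g, of "real n + C"] phi_cmult[OF dominated_g, of "real n"]
        by (simp add: left_diff_distrib)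
    qed
    show "(\<lambda>n. ((real n + C) powr \<alpha> - real n powr \<alpha>) * phi G) \<longlonglongrightarrow> 0"
      using powr_increment_tendsto_0[OF \<alpha> a1, of C] C by (intro tendsto_mult_left_zero) simp
  qed simp
qed

lemma exists_homogeneous_levy_measure_nondegenerate:
  assumes a1: "\<alpha> < 1" and L1: "lap R G \<noteq> 1"
  obtains \<Lambda> where "sets \<Lambda> = sets nonzero_radon_algebra"
    "\<And>h. dominated h \<Longrightarrow> (\<integral>\<^sup>+\<mu>. ennreal (1 - eneg (\<integral>\<^sup>+x. h x \<partial>\<mu>)) \<partial>\<Lambda>) = ennreal (phi h)"
proof -
  have pG: "0 < phi G" using lap_G L1 by (simp add: phi_def)
  obtain Q where Q: "prob_space Q" "sets Q = sets radon_algebra" and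
    lapQ': "\<And>h. dominated h \<Longrightarrow> lap Q h = (ln (lap R h) - ln (lap R (\<lambda>x. h x + G x))) / (- ln (lap R G))"
    using exists_tangent_law[OF L1] by blast
  have lapQ: "phi G * lap Q h = phi (\<lambda>x. h x + G x) - phi h" if "dominated h" for h
    using lapQ'[OF that] pG by (simp add: phi_def field_simps)
  interpret Q: prob_space Q by (rule Q)
  have spQ: "space Q = radon_measures" using sets_eq_imp_space_eq[OF Q(2)] by (simp add: space_radon_algebra)
  have nG: "dominated (\<lambda>x. ennreal (real n) * G x)" for n by (intro dominated_cmult dominated_g) simp
  have SucG: "(\<lambda>x. u x + ennreal (real n) * G x + G x) = (\<lambda>x. u x + ennreal (real (Suc n)) * G x)" for n u
  proof
    fix x
    have "ennreal (real (Suc n)) = 1 + ennreal (real n)" by simp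
    then have "ennreal (real (Suc n)) * G x = ennreal (real n) * G x + G x" by (simp only: distrib_right mult_1 add.commute)
    then show "u x + ennreal (real n) * G x + G x = u x + ennreal (real (Suc n)) * G x" by (simp only: add.assoc)
  qed
  have SucG0: "(\<lambda>x. ennreal (real n) * G x + G x) = (\<lambda>x. ennreal (real (Suc n)) * G x)" for n
    using SucG[of "\<lambda>_. 0" n] by simp
  have em: "(\<lambda>\<mu>. eneg (\<integral>\<^sup>+x. h x \<partial>\<mu>)) \<in> borel_measurable Q" if "dominated h" for h
    using measurable_eneg_nn_integral[OF dominated_meas[OF that]] by (simp add: measurable_cong_sets[OF Q(2) refl])
  have ei: "integrable Q (\<lambda>\<mu>. eneg (\<integral>\<^sup>+x. h x \<partial>\<mu>))" if "dominated h" for h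
    using integrable_lap[OF Q dominated_meas[OF that]] .
  \<comment> \<open>An atom at the zero measure would bound \<open>lap Q (n * G)\<close> from below
    by its mass, but this transform is an increment of \<open>phi\<close> divided by
    \<open>phi G\<close> and tends to 0. Hence restricting \<open>Q\<close> to nonzero measures
    loses no mass.\<close>
  have AE_nz: "AE \<mu> in Q. \<mu> \<noteq> zero_measure"
  proof -
    let ?Z = "{zero_measure} :: 'a measure set"
    have Z: "?Z \<in> sets Q"
    proof -
      have "radon_measures - (radon_measures - ?Z) \<in> sets radon_algebra"
        using sets.compl_sets[OF nonzero_radon_sets] by (simp add: space_radon_algebra)
      also have "radon_measures - (radon_measures - ?Z) = ?Z" by auto
      finally show ?thesis by (simp add: Q(2))
    qed
    have "measure Q ?Z \<le> lap Q (\<lambda>x. ennreal (real n) * G x)" for n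
    proof -
      have "measure Q ?Z = (\<integral>\<mu>. indicator ?Z \<mu> \<partial>Q)" using Z by simp
      also have "\<dots> \<le> lap Q (\<lambda>x. ennreal (real n) * G x)"
        unfolding lap_def
      proof (rule integral_mono)
        show "integrable Q (indicat_real ?Z)"
          using Z by (intro integrable_real_indicator) (simp_all add: Q.emeasure_eq_measure)
        show "indicat_real ?Z \<mu> \<le> eneg (\<integral>\<^sup>+x. ennreal (real n) * G x \<partial>\<mu>)" for \<mu>
          by (auto simp: indicator_def)
      qed (rule ei[OF nG])
      finally show ?thesis .
    qed
    moreover have "(\<lambda>n. lap Q (\<lambda>x. ennreal (real n) * G x)) \<longlonglongrightarrow> 0"
    proof -
      have e: "lap Q (\<lambda>x. ennreal (real n) * G x) = (phi (\<lambda>x. G x + ennreal (real n) * G x) - phi (\<lambda>x. ennreal (real n) * G x)) / phi G" for n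
        using lapQ[OF nG[of n]] pG by (simp add: field_simps add.commute)
      show ?thesis unfolding e using phi_increment_tendsto_0[OF a1 dominated_g] by (rule tendsto_divide_zero)
    qed
    ultimately have "measure Q ?Z \<le> 0" by (intro LIMSEQ_le_const) auto
    then have "emeasure Q ?Z = 0" by (simp add: Q.emeasure_eq_measure measure_le_0_iff)
    then show ?thesis using Z by (intro AE_I[of _ _ ?Z]) auto
  qed
  \<comment> \<open>The factor \<open>phi G\<close> undoes the normalization that made
    \<open>Q\<close> a probability measure.\<close>
  define w where "w \<mu> = phi G / (1 - eneg (\<integral>\<^sup>+x. G x \<partial>\<mu>))" for \<mu>
  define \<Lambda> where "\<Lambda> = density (restrict_space Q (radon_measures - {zero_measure})) (\<lambda>\<mu>. ennreal (w \<mu>))"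
  have s: "sets \<Lambda> = sets nonzero_radon_algebra"
    unfolding \<Lambda>_def nonzero_radon_algebra_def by (simp add: sets_restrict_space_cong[OF Q(2)])
  have w0: "0 \<le> w \<mu>" for \<mu> using pG by (simp add: w_def)
  have wm: "w \<in> borel_measurable Q" unfolding w_def using em[OF dominated_g] by measurable
  have "(\<integral>\<^sup>+\<mu>. ennreal (1 - eneg (\<integral>\<^sup>+x. h x \<partial>\<mu>)) \<partial>\<Lambda>) = ennreal (phi h)" if h: "dominated h" for h
  proof -
    have hnG: "dominated (\<lambda>x. h x + ennreal (real n) * G x)" for n by (intro dominated_add nG h)
    let ?u = "\<lambda>k \<mu>. phi G * (eneg (\<integral>\<^sup>+x. ennreal (real k) * G x \<partial>\<mu>) - eneg (\<integral>\<^sup>+x. h x + ennreal (real k) * G x \<partial>\<mu>))"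
    have u0: "0 \<le> ?u k \<mu>" for k \<mu>
      using pG by (intro mult_nonneg_nonneg) (auto intro!: eneg_antimono nn_integral_mono)
    have um: "?u k \<in> borel_measurable Q" for k using em[OF nG] em[OF hnG] by measurable
    have nz: "radon_measures - {zero_measure} \<in> sets Q" using nonzero_radon_sets by (simp add: Q(2))
    have "(\<integral>\<^sup>+\<mu>. ennreal (1 - eneg (\<integral>\<^sup>+x. h x \<partial>\<mu>)) \<partial>\<Lambda>)
        = (\<integral>\<^sup>+\<mu>. ennreal (w \<mu>) * ennreal (1 - eneg (\<integral>\<^sup>+x. h x \<partial>\<mu>)) \<partial>restrict_space Q (radon_measures - {zero_measure}))"
      unfolding \<Lambda>_def using wm em[OF h]
      by (intro nn_integral_density measurable_restrict_space1) auto
    also have "\<dots> = (\<integral>\<^sup>+\<mu>. ennreal (w \<mu>) * ennreal (1 - eneg (\<integral>\<^sup>+x. h x \<partial>\<mu>)) * indicator (radon_measures - {zero_measure}) \<mu> \<partial>Q)"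
      using nz by (intro nn_integral_restrict_space) (simp add: spQ Int_absorb2)
    also have "\<dots> = (\<integral>\<^sup>+\<mu>. (\<Sum>k. ennreal (?u k \<mu>)) \<partial>Q)"
    proof (intro nn_integral_cong_AE)
      show "AE \<mu> in Q. ennreal (w \<mu>) * ennreal (1 - eneg (\<integral>\<^sup>+x. h x \<partial>\<mu>)) * indicator (radon_measures - {zero_measure}) \<mu> = (\<Sum>k. ennreal (?u k \<mu>))"
        using AE_nz AE_space
      proof eventually_elim
        fix \<mu> assume \<mu>: "\<mu> \<noteq> zero_measure" "\<mu> \<in> space Q"
        have r: "\<mu> \<in> radon_measures" using \<mu> by (simp add: spQ)
        note [measurable_cong] = sets_radon[OF r]
        note [measurable] = dominated_meas[OF h]
        have nzG: "(\<integral>\<^sup>+x. G x \<partial>\<mu>) \<noteq> 0" by (rule nn_integral_pos_radon[OF g g_pos r \<mu>(1)])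
        have "(\<lambda>k. phi G * (eneg (ennreal (real k) * (\<integral>\<^sup>+x. G x \<partial>\<mu>)) - eneg ((\<integral>\<^sup>+x. h x \<partial>\<mu>) + ennreal (real k) * (\<integral>\<^sup>+x. G x \<partial>\<mu>))))
           sums (phi G * ((1 - eneg (\<integral>\<^sup>+x. h x \<partial>\<mu>)) / (1 - eneg (\<integral>\<^sup>+x. G x \<partial>\<mu>))))"
          by (intro sums_mult geometric_expansion_eneg nzG)
        then have "(\<lambda>k. ?u k \<mu>) sums (w \<mu> * (1 - eneg (\<integral>\<^sup>+x. h x \<partial>\<mu>)))"
          by (simp add: nn_integral_cmult nn_integral_add w_def)
        then have "(\<Sum>k. ennreal (?u k \<mu>)) = ennreal (w \<mu> * (1 - eneg (\<integral>\<^sup>+x. h x \<partial>\<mu>)))"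
          using u0 by (intro suminf_ennreal_eq) auto
        then show "ennreal (w \<mu>) * ennreal (1 - eneg (\<integral>\<^sup>+x. h x \<partial>\<mu>)) * indicator (radon_measures - {zero_measure}) \<mu> = (\<Sum>k. ennreal (?u k \<mu>))"
          using r \<mu>(1) w0[of \<mu>] by (simp add: ennreal_mult)
      qed
    qed
    also have "\<dots> = (\<Sum>k. \<integral>\<^sup>+\<mu>. ennreal (?u k \<mu>) \<partial>Q)"
      using um by (intro nn_integral_suminf) simp
    also have "\<dots> = (\<Sum>k. ennreal ((phi (\<lambda>x. h x + ennreal (real k) * G x) - phi (\<lambda>x. ennreal (real k) * G x))
      - (phi (\<lambda>x. h x + ennreal (real (Suc k)) * G x) - phi (\<lambda>x. ennreal (real (Suc k)) * G x))))"
    proof (intro suminf_cong)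
      fix k
      have "(\<integral>\<^sup>+\<mu>. ennreal (?u k \<mu>) \<partial>Q) = ennreal (\<integral>\<mu>. ?u k \<mu> \<partial>Q)"
        using u0 ei[OF nG] ei[OF hnG] by (intro nn_integral_eq_integral) auto
      also have "(\<integral>\<mu>. ?u k \<mu> \<partial>Q) = phi G * lap Q (\<lambda>x. ennreal (real k) * G x) - phi G * lap Q (\<lambda>x. h x + ennreal (real k) * G x)"
        using ei[OF nG] ei[OF hnG] by (simp add: lap_def right_diff_distrib)
      also have "\<dots> = (phi (\<lambda>x. h x + ennreal (real k) * G x) - phi (\<lambda>x. ennreal (real k) * G x))
        - (phi (\<lambda>x. h x + ennreal (real (Suc k)) * G x) - phi (\<lambda>x. ennreal (real (Suc k)) * G x))"
        unfolding lapQ[OF nG] lapQ[OF hnG] SucG SucG0 by simp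
      finally show "(\<integral>\<^sup>+\<mu>. ennreal (?u k \<mu>) \<partial>Q) = ennreal ((phi (\<lambda>x. h x + ennreal (real k) * G x) - phi (\<lambda>x. ennreal (real k) * G x))
        - (phi (\<lambda>x. h x + ennreal (real (Suc k)) * G x) - phi (\<lambda>x. ennreal (real (Suc k)) * G x)))" .
    qed
    also have "\<dots> = ennreal (phi h)"
    proof (rule suminf_ennreal_eq)
      \<comment> \<open>The terms are \<open>a k - a (k + 1)\<close> with
        \<open>a k = phi (h + k * G) - phi (k * G)\<close>. Since \<open>a k\<close> tends to 0, the
        sum is \<open>a 0\<close>, which is \<open>phi h\<close> because \<open>phi\<close> vanishes
        at the zero function.\<close>
      show "(\<lambda>k. (phi (\<lambda>x. h x + ennreal (real k) * G x) - phi (\<lambda>x. ennreal (real k) * G x))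
        - (phi (\<lambda>x. h x + ennreal (real (Suc k)) * G x) - phi (\<lambda>x. ennreal (real (Suc k)) * G x))) sums (phi h)"
        using telescope_sums'[OF phi_increment_tendsto_0[OF a1 h]] by (simp add: phi_def lap_0)
      fix k
      have "0 \<le> (\<integral>\<mu>. ?u k \<mu> \<partial>Q)" using u0 by (intro Bochner_Integration.integral_nonneg)
      also have "(\<integral>\<mu>. ?u k \<mu> \<partial>Q) = phi G * lap Q (\<lambda>x. ennreal (real k) * G x) - phi G * lap Q (\<lambda>x. h x + ennreal (real k) * G x)"
        using ei[OF nG] ei[OF hnG] by (simp add: lap_def right_diff_distrib)
      also have "\<dots> = (phi (\<lambda>x. h x + ennreal (real k) * G x) - phi (\<lambda>x. ennreal (real k) * G x))
        - (phi (\<lambda>x. h x + ennreal (real (Suc k)) * G x) - phi (\<lambda>x. ennreal (real (Suc k)) * G x))"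
        unfolding lapQ[OF nG] lapQ[OF hnG] SucG SucG0 by simp
      finally show "0 \<le> (phi (\<lambda>x. h x + ennreal (real k) * G x) - phi (\<lambda>x. ennreal (real k) * G x))
        - (phi (\<lambda>x. h x + ennreal (real (Suc k)) * G x) - phi (\<lambda>x. ennreal (real (Suc k)) * G x))" .
    qed
    finally show ?thesis .
  qed
  then show thesis using s by (intro that)
qed

end

section \<open>Stability and the Levy representation\<close>

lemma scale_measure_nonzero:
  assumes c: "0 < c" and \<mu>: "\<mu> \<in> radon_measures - {zero_measure}"
  shows "scale_measure (ennreal c) \<mu> \<in> radon_measures - {zero_measure}"
proof -
  have "emeasure \<mu> UNIV \<noteq> 0" using \<mu> measure_eq_0_iff_null_measure[OF sets_radon, of \<mu>] by auto
  then have "emeasure (scale_measure (ennreal c) \<mu>) UNIV \<noteq> 0" using c by (simp add: ennreal_eq_0_iff)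
  then have "scale_measure (ennreal c) \<mu> \<noteq> zero_measure" by (metis emeasure_null_measure)
  then show ?thesis using scale_measure_radon[of \<mu> c] \<mu> by simp
qed

lemma measurable_scale_nonzero:
  "0 < c \<Longrightarrow> scale_measure (ennreal c) \<in> measurable nonzero_radon_algebra nonzero_radon_algebra"
  unfolding nonzero_radon_algebra_def
  by (intro measurable_restrict_space2 measurable_restrict_space1 measurable_scale_measure)
     (auto simp: space_restrict_space space_radon_algebra dest: scale_measure_nonzero)

lemma scale_measure_inverse:
  assumes "0 < c" shows "scale_measure (ennreal c) (scale_measure (ennreal (1 / c)) \<mu>) = \<mu>"
  using assms by (simp add: scale_scale_measure ennreal_mult[symmetric])

text \<open>Homogeneity speaks of images \<open>c A\<close>, push-forward measures of preimages;
  scaling by \<open>1 / c\<close> inverts scaling by \<open>c\<close> and converts one into the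
  other.\<close>

lemma scale_image_eq_vimage:
  assumes c: "0 < c" and A: "A \<subseteq> radon_measures - {zero_measure}"
  shows "scale_measure (ennreal c) ` A = scale_measure (ennreal (1 / c)) -` A \<inter> (radon_measures - {zero_measure})"
proof
  show "scale_measure (ennreal c) ` A \<subseteq> scale_measure (ennreal (1 / c)) -` A \<inter> (radon_measures - {zero_measure})"
  proof
    fix \<mu> assume "\<mu> \<in> scale_measure (ennreal c) ` A"
    then obtain \<nu> where \<nu>: "\<nu> \<in> A" "\<mu> = scale_measure (ennreal c) \<nu>" by blast
    have "scale_measure (ennreal (1 / c)) \<mu> = \<nu>"
      using scale_measure_inverse[of "1 / c" \<nu>] c unfolding \<nu>(2) by simp
    then show "\<mu> \<in> scale_measure (ennreal (1 / c)) -` A \<inter> (radon_measures - {zero_measure})"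
      using \<nu> A scale_measure_nonzero[OF c, of \<nu>] by auto
  qed
  show "scale_measure (ennreal (1 / c)) -` A \<inter> (radon_measures - {zero_measure}) \<subseteq> scale_measure (ennreal c) ` A"
  proof
    fix \<mu> assume \<mu>: "\<mu> \<in> scale_measure (ennreal (1 / c)) -` A \<inter> (radon_measures - {zero_measure})"
    then have "\<mu> = scale_measure (ennreal c) (scale_measure (ennreal (1 / c)) \<mu>)" by (simp only: scale_measure_inverse[OF c])
    then show "\<mu> \<in> scale_measure (ennreal c) ` A" using \<mu> by blast
  qed
qed

lemma emeasure_distr_scale:
  assumes c: "0 < c" and s: "sets \<Lambda> = sets nonzero_radon_algebra" and A: "A \<in> sets nonzero_radon_algebra"
  shows "emeasure (distr \<Lambda> nonzero_radon_algebra (scale_measure (ennreal (1 / c)))) A = emeasure \<Lambda> (scale_measure (ennreal c) ` A)"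
proof -
  have sp: "space \<Lambda> = radon_measures - {zero_measure}"
    using sets_eq_imp_space_eq[OF s] by (simp add: space_nonzero_radon_algebra)
  have "emeasure (distr \<Lambda> nonzero_radon_algebra (scale_measure (ennreal (1 / c)))) A =
    emeasure \<Lambda> (scale_measure (ennreal (1 / c)) -` A \<inter> space \<Lambda>)"
    using A c measurable_scale_nonzero[of "1 / c"] by (intro emeasure_distr) (simp_all add: measurable_cong_sets[OF s refl])
  also have "scale_measure (ennreal (1 / c)) -` A \<inter> space \<Lambda> = scale_measure (ennreal c) ` A"
    using scale_image_eq_vimage[OF c, of A] A sp by (simp add: sets_nonzero_radon_algebra_iff)
  finally show ?thesis .
qed

lemma pairing_scale_measure:
  assumes "h \<in> BM" "0 \<le> c" "\<mu> \<in> radon_measures"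
  shows "pairing h (scale_measure (ennreal c) \<mu>) = pairing (\<lambda>x. c * h x) \<mu>"
proof -
  have "ennreal (pairing h (scale_measure (ennreal c) \<mu>)) = (\<integral>\<^sup>+x. ennreal (h x) \<partial>scale_measure (ennreal c) \<mu>)"
    using BM_nn_integral_finite(2)[OF assms(1) scale_measure_radon[OF assms(3)]] by simp
  also have "\<dots> = ennreal c * ennreal (pairing h \<mu>)"
    using nn_integral_radon_scale[OF assms(3) ennreal_BM_measurable[OF assms(1)]] BM_nn_integral_finite(2)[OF assms(1,3)] by simp
  also have "\<dots> = ennreal (pairing (\<lambda>x. c * h x) \<mu>)"
    using assms(2) BM_nn_integral_finite(3)[OF assms(1,3)] by (simp add: ennreal_mult pairing_def)
  finally show ?thesis
    using BM_nn_integral_finite(3)[OF assms(1) scale_measure_radon[OF assms(3), of c]] BM_nn_integral_finite(3)[OF BM_cmult[OF assms(1,2)] assms(3)]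
    by simp
qed

context weighted_stable_laplace
begin

text \<open>Only the degenerate case is new. There \<open>phi G = 0\<close>, so the tangent law
  cannot be normalized; but then \<open>phi\<close> vanishes on all dominated functions, and the
  null measure represents it.\<close>

lemma exists_homogeneous_levy_measure:
  assumes a1: "\<alpha> < 1"
  obtains \<Lambda> where "sets \<Lambda> = sets nonzero_radon_algebra"
    "\<And>h. dominated h \<Longrightarrow> (\<integral>\<^sup>+\<mu>. ennreal (1 - eneg (\<integral>\<^sup>+x. h x \<partial>\<mu>)) \<partial>\<Lambda>) = ennreal (phi h)"
proof (cases "lap R G = 1")
  case True
  have "phi h = 0" if h: "dominated h" for h
  proof -
    obtain C where C: "C > 0" "\<And>x. h x \<le> ennreal (C * g x)" using h by (auto simp: dominated_def)
    have "phi h \<le> phi (\<lambda>x. ennreal C * G x)"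
      using C g_pos by (intro phi_mono h dominated_cmult dominated_g) (simp_all add: ennreal_mult[symmetric] less_imp_le)
    also have "\<dots> = C powr \<alpha> * phi G" using C by (intro phi_cmult dominated_g) simp
    also have "\<dots> = 0" using True by (simp add: phi_def)
    finally show ?thesis using phi_nonneg[OF h] by simp
  qed
  then show thesis by (intro that[of "null_measure nonzero_radon_algebra"]) (simp_all add: nn_integral_null_measure)
next
  case False
  show thesis by (rule exists_homogeneous_levy_measure_nondegenerate[OF a1 False]) (rule that)
qed

theorem levy_representation:
  assumes a1: "\<alpha> < 1"
  obtains \<Lambda> where "levy_measure \<Lambda>" "homogeneous (- \<alpha>) \<Lambda>"
    "\<And>h. h \<in> BM \<Longrightarrow> lap R (\<lambda>x. ennreal (h x)) = exp (- (\<integral>\<mu>. (1 - exp (- pairing h \<mu>)) \<partial>\<Lambda>))"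
proof -
  obtain \<Lambda> where s: "sets \<Lambda> = sets (nonzero_radon_algebra :: 'a measure measure)"
    and \<Lambda>: "\<And>h. dominated h \<Longrightarrow> (\<integral>\<^sup>+\<mu>. ennreal (1 - eneg (\<integral>\<^sup>+x. h x \<partial>\<mu>)) \<partial>\<Lambda>) = ennreal (phi h)"
    using exists_homogeneous_levy_measure[OF a1] by blast
  have sp: "space \<Lambda> = radon_measures - {zero_measure}"
    using sets_eq_imp_space_eq[OF s] by (simp add: space_nonzero_radon_algebra)
  have BM: "(\<integral>\<^sup>+\<mu>. ennreal (1 - exp (- pairing h \<mu>)) \<partial>\<Lambda>) = ennreal (phi (\<lambda>x. ennreal (h x)))" if h: "h \<in> BM" for h
    unfolding \<Lambda>[OF dominated_BM[OF h], symmetric]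
    by (intro nn_integral_cong) (simp add: sp eneg_BM[OF h])
  show thesis
  proof
    show "levy_measure \<Lambda>" using BM by (intro levy_measureI[OF lc s]) simp
    fix h :: "'a \<Rightarrow> real" assume h: "h \<in> BM"
    have "(\<lambda>\<mu>. 1 - exp (- pairing h \<mu>)) \<in> borel_measurable \<Lambda>"
    proof -
      have "(\<lambda>\<mu>. 1 - eneg (\<integral>\<^sup>+x. ennreal (h x) \<partial>\<mu>)) \<in> borel_measurable \<Lambda>"
        using measurable_eneg_nonzero[OF ennreal_BM_measurable[OF h]] by (simp add: measurable_cong_sets[OF s refl])
      also have "?this \<longleftrightarrow> ?thesis" by (intro measurable_cong) (simp add: sp eneg_BM[OF h])
      finally show ?thesis .
    qed
    then have "(\<integral>\<mu>. (1 - exp (- pairing h \<mu>)) \<partial>\<Lambda>) = enn2real (\<integral>\<^sup>+\<mu>. ennreal (1 - exp (- pairing h \<mu>)) \<partial>\<Lambda>)"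
      using BM_nn_integral_finite(3)[OF h] by (intro integral_eq_nn_integral) (auto simp: sp)
    then show "lap R (\<lambda>x. ennreal (h x)) = exp (- (\<integral>\<mu>. (1 - exp (- pairing h \<mu>)) \<partial>\<Lambda>))"
      using phi_nonneg[OF dominated_BM[OF h]] exp_phi[OF dominated_BM[OF h]] by (simp add: BM[OF h])
  next
    show "homogeneous (- \<alpha>) \<Lambda>"
      unfolding homogeneous_def
    proof (intro ballI allI impI)
      fix A and t :: real assume A: "A \<in> sets \<Lambda>" and t: "0 < t"
      \<comment> \<open>\<open>\<Lambda>1\<close> gives \<open>A\<close> the mass that \<Lambda>
        gives to \<open>t A\<close>. By the scaling of \<open>phi\<close>, both
        \<open>\<Lambda>1\<close> and \<open>\<Lambda>2\<close> have the exponent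
        \<open>t powr - \<alpha> * phi h\<close>, so uniqueness identifies them.\<close>
      define \<Lambda>1 where "\<Lambda>1 = distr \<Lambda> nonzero_radon_algebra (scale_measure (ennreal (1 / t)))"
      define \<Lambda>2 where "\<Lambda>2 = scale_measure (ennreal (t powr - \<alpha>)) \<Lambda>"
      have s12: "sets \<Lambda>1 = sets nonzero_radon_algebra" "sets \<Lambda>2 = sets nonzero_radon_algebra"
        by (simp_all add: \<Lambda>1_def \<Lambda>2_def s)
      have em: "(\<lambda>\<mu>. ennreal (1 - eneg (\<integral>\<^sup>+x. h x \<partial>\<mu>))) \<in> borel_measurable nonzero_radon_algebra" if "dominated h" for h
        using measurable_eneg_nonzero[OF dominated_meas[OF that]] by measurable
      have 1: "(\<integral>\<^sup>+\<mu>. ennreal (1 - eneg (\<integral>\<^sup>+x. h x \<partial>\<mu>)) \<partial>\<Lambda>1) = ennreal (t powr - \<alpha> * phi h)" if h: "dominated h" for h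
      proof -
        have "(\<integral>\<^sup>+\<mu>. ennreal (1 - eneg (\<integral>\<^sup>+x. h x \<partial>\<mu>)) \<partial>\<Lambda>1) = (\<integral>\<^sup>+\<mu>. ennreal (1 - eneg (\<integral>\<^sup>+x. h x \<partial>scale_measure (ennreal (1 / t)) \<mu>)) \<partial>\<Lambda>)"
          unfolding \<Lambda>1_def using em[OF h] t measurable_scale_nonzero[of "1 / t"]
          by (intro nn_integral_distr) (simp_all add: measurable_cong_sets[OF s refl])
        also have "\<dots> = (\<integral>\<^sup>+\<mu>. ennreal (1 - eneg (\<integral>\<^sup>+x. ennreal (1 / t) * h x \<partial>\<mu>)) \<partial>\<Lambda>)"
        proof (intro nn_integral_cong)
          fix \<mu> assume "\<mu> \<in> space \<Lambda>"
          then have \<mu>: "\<mu> \<in> radon_measures" by (simp add: sp)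
          then have "h \<in> borel_measurable \<mu>" using dominated_meas[OF h] by (simp add: measurable_cong_sets[OF sets_radon refl])
          then show "ennreal (1 - eneg (\<integral>\<^sup>+x. h x \<partial>scale_measure (ennreal (1 / t)) \<mu>)) = ennreal (1 - eneg (\<integral>\<^sup>+x. ennreal (1 / t) * h x \<partial>\<mu>))"
            by (simp only: nn_integral_radon_scale[OF \<mu> dominated_meas[OF h]] nn_integral_cmult)
        qed
        also have "\<dots> = ennreal (phi (\<lambda>x. ennreal (1 / t) * h x))" using t by (intro \<Lambda> dominated_cmult h) simp
        also have "phi (\<lambda>x. ennreal (1 / t) * h x) = (1 / t) powr \<alpha> * phi h" using t by (intro phi_cmult h) simp
        also have "(1 / t) powr \<alpha> = t powr - \<alpha>" using t by (simp add: powr_minus powr_divide field_simps)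
        finally show ?thesis .
      qed
      have 2: "(\<integral>\<^sup>+\<mu>. ennreal (1 - eneg (\<integral>\<^sup>+x. h x \<partial>\<mu>)) \<partial>\<Lambda>2) = ennreal (t powr - \<alpha> * phi h)" if h: "dominated h" for h
        unfolding \<Lambda>2_def using em[OF h] \<Lambda>[OF h] phi_nonneg[OF h]
        by (subst nn_integral_scale_measure) (simp_all add: measurable_cong_sets[OF s refl] ennreal_mult)
      \<comment> \<open>The tilted integrand is the difference of the integrands
        \<open>1 - eneg\<close> belonging to \<open>h + g\<close> and to \<open>h\<close>, so the
        exponent determines the integrals that \<open>levy_measure_unique\<close> compares. The
        subtraction is legitimate because the integral for \<open>h\<close> is finite.\<close>
      have tilted: "(\<integral>\<^sup>+\<mu>. ennreal (eneg (\<integral>\<^sup>+x. ennreal (h x) \<partial>\<mu>) * (1 - eneg (\<integral>\<^sup>+x. G x \<partial>\<mu>))) \<partial>M)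
          = ennreal (t powr - \<alpha> * phi (\<lambda>x. ennreal (h x) + G x)) - ennreal (t powr - \<alpha> * phi (\<lambda>x. ennreal (h x)))"
        if h: "h \<in> BM" and M: "sets M = sets nonzero_radon_algebra"
          and E: "\<And>h. dominated h \<Longrightarrow> (\<integral>\<^sup>+\<mu>. ennreal (1 - eneg (\<integral>\<^sup>+x. h x \<partial>\<mu>)) \<partial>M) = ennreal (t powr - \<alpha> * phi h)" for h M
      proof -
        let ?h = "\<lambda>x. ennreal (h x)"
        have dh: "dominated ?h" by (rule dominated_BM[OF h])
        have spM: "space M = radon_measures - {zero_measure}"
          using sets_eq_imp_space_eq[OF M] by (simp add: space_nonzero_radon_algebra)
        have [measurable]: "(\<lambda>\<mu>. eneg (\<integral>\<^sup>+x. ?h x \<partial>\<mu>)) \<in> borel_measurable M" "(\<lambda>\<mu>. eneg (\<integral>\<^sup>+x. G x \<partial>\<mu>)) \<in> borel_measurable M"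
          using measurable_eneg_nonzero[OF dominated_meas[OF dh]] measurable_eneg_nonzero[OF dominated_meas[OF dominated_g]]
          by (simp_all add: measurable_cong_sets[OF M refl])
        have "(\<integral>\<^sup>+\<mu>. ennreal (1 - eneg (\<integral>\<^sup>+x. ?h x + G x \<partial>\<mu>)) \<partial>M) =
          (\<integral>\<^sup>+\<mu>. ennreal (eneg (\<integral>\<^sup>+x. ?h x \<partial>\<mu>) * (1 - eneg (\<integral>\<^sup>+x. G x \<partial>\<mu>))) + ennreal (1 - eneg (\<integral>\<^sup>+x. ?h x \<partial>\<mu>)) \<partial>M)"
        proof (intro nn_integral_cong)
          fix \<mu> assume "\<mu> \<in> space M"
          then have \<mu>: "\<mu> \<in> radon_measures" by (simp add: spM)
          then have "(\<integral>\<^sup>+x. ?h x + G x \<partial>\<mu>) = (\<integral>\<^sup>+x. ?h x \<partial>\<mu>) + (\<integral>\<^sup>+x. G x \<partial>\<mu>)"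
            using dominated_meas[OF dh] by (intro nn_integral_add) (simp_all add: measurable_cong_sets[OF sets_radon refl])
          then have "1 - eneg (\<integral>\<^sup>+x. ?h x + G x \<partial>\<mu>) =
            eneg (\<integral>\<^sup>+x. ?h x \<partial>\<mu>) * (1 - eneg (\<integral>\<^sup>+x. G x \<partial>\<mu>)) + (1 - eneg (\<integral>\<^sup>+x. ?h x \<partial>\<mu>))"
            by (simp add: eneg_add algebra_simps)
          then show "ennreal (1 - eneg (\<integral>\<^sup>+x. ?h x + G x \<partial>\<mu>)) =
            ennreal (eneg (\<integral>\<^sup>+x. ?h x \<partial>\<mu>) * (1 - eneg (\<integral>\<^sup>+x. G x \<partial>\<mu>))) + ennreal (1 - eneg (\<integral>\<^sup>+x. ?h x \<partial>\<mu>))"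
            by (simp add: ennreal_plus[symmetric] del: ennreal_plus)
        qed
        also have "\<dots> = (\<integral>\<^sup>+\<mu>. ennreal (eneg (\<integral>\<^sup>+x. ?h x \<partial>\<mu>) * (1 - eneg (\<integral>\<^sup>+x. G x \<partial>\<mu>))) \<partial>M) + (\<integral>\<^sup>+\<mu>. ennreal (1 - eneg (\<integral>\<^sup>+x. ?h x \<partial>\<mu>)) \<partial>M)"
          by (intro nn_integral_add) measurable
        finally show ?thesis
          unfolding E[OF dh] E[OF dominated_add[OF dh dominated_g]] by simp
      qed
      have "\<Lambda>1 = \<Lambda>2"
      proof (rule levy_measure_unique[OF lc s12 g g_pos])
        show "(\<integral>\<^sup>+\<mu>. ennreal (eneg (\<integral>\<^sup>+x. ennreal (h x) \<partial>\<mu>) * (1 - eneg (\<integral>\<^sup>+x. ennreal (g x) \<partial>\<mu>))) \<partial>\<Lambda>1)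
          = (\<integral>\<^sup>+\<mu>. ennreal (eneg (\<integral>\<^sup>+x. ennreal (h x) \<partial>\<mu>) * (1 - eneg (\<integral>\<^sup>+x. ennreal (g x) \<partial>\<mu>))) \<partial>\<Lambda>2)" if "h \<in> BM" for h
          using tilted[OF that s12(1) 1] tilted[OF that s12(2) 2] by simp
        show "(\<integral>\<^sup>+\<mu>. ennreal (1 - eneg (\<integral>\<^sup>+x. ennreal (g x) \<partial>\<mu>)) \<partial>\<Lambda>1) < \<infinity>"
          using 1[OF dominated_g] by simp
      qed
      then have "emeasure \<Lambda>1 A = emeasure \<Lambda>2 A" by simp
      then show "emeasure \<Lambda> (scale_measure (ennreal t) ` A) = ennreal (t powr - \<alpha>) * emeasure \<Lambda> A"
        using emeasure_distr_scale[OF t s, of A] A by (simp add: \<Lambda>1_def \<Lambda>2_def s)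
    qed
  qed
qed

end

text \<open>Homogeneity says that the image of \<Lambda> under multiplication by \<open>c\<close> is
  \<open>c powr \<alpha>\<close> times \<Lambda>; the identity is then a change of variables. For
  \<open>c = 0\<close> both sides vanish.\<close>

lemma homogeneous_exponent_scale:
  fixes \<Lambda> :: "'a::topological_space measure measure"
  assumes levy: "levy_measure \<Lambda>" and hom: "homogeneous (- \<alpha>) \<Lambda>" and h: "h \<in> BM" and c: "0 \<le> c"
  shows "(\<integral>\<mu>. (1 - exp (- pairing (\<lambda>x. c * h x) \<mu>)) \<partial>\<Lambda>) = c powr \<alpha> * (\<integral>\<mu>. (1 - exp (- pairing h \<mu>)) \<partial>\<Lambda>)"
proof (cases "c = 0")
  case True
  then show ?thesis by (simp add: pairing_def)
next
  case False
  with c have c0: "0 < c" by simp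
  have s: "sets \<Lambda> = sets nonzero_radon_algebra" using levy by (simp add: levy_measure_def radon_measure_on_def)
  have sp: "space \<Lambda> = radon_measures - {zero_measure}"
    using sets_eq_imp_space_eq[OF s] by (simp add: space_nonzero_radon_algebra)
  have m: "(\<lambda>\<mu>. 1 - exp (- pairing h \<mu>)) \<in> borel_measurable nonzero_radon_algebra"
  proof -
    have "(\<lambda>\<mu>. 1 - eneg (\<integral>\<^sup>+x. ennreal (h x) \<partial>\<mu>)) \<in> borel_measurable nonzero_radon_algebra"
      using measurable_eneg_nonzero[OF ennreal_BM_measurable[OF h]] by measurable
    also have "?this \<longleftrightarrow> ?thesis" by (intro measurable_cong) (simp add: space_nonzero_radon_algebra eneg_BM[OF h])
    finally show ?thesis .
  qed
  have "distr \<Lambda> nonzero_radon_algebra (scale_measure (ennreal c)) = scale_measure (ennreal (c powr \<alpha>)) \<Lambda>"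
  proof (rule measure_eqI)
    fix A assume "A \<in> sets (distr \<Lambda> nonzero_radon_algebra (scale_measure (ennreal c)))"
    then have A: "A \<in> sets nonzero_radon_algebra" by simp
    have "emeasure (distr \<Lambda> nonzero_radon_algebra (scale_measure (ennreal c))) A = emeasure \<Lambda> (scale_measure (ennreal (1 / c)) ` A)"
      using emeasure_distr_scale[of "1 / c", OF _ s A] c0 by simp
    also have "\<dots> = ennreal ((1 / c) powr - \<alpha>) * emeasure \<Lambda> A"
      using hom A c0 unfolding homogeneous_def s by simp
    also have "(1 / c) powr - \<alpha> = c powr \<alpha>" using c0 by (simp add: powr_minus powr_divide)
    finally show "emeasure (distr \<Lambda> nonzero_radon_algebra (scale_measure (ennreal c))) A = emeasure (scale_measure (ennreal (c powr \<alpha>)) \<Lambda>) A"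
      by simp
  qed (simp add: s)
  note d = this
  have ssc: "sets (scale_measure (ennreal (c powr \<alpha>)) \<Lambda>) = sets nonzero_radon_algebra" by (simp add: s)
  have ms: "scale_measure (ennreal c) \<in> measurable \<Lambda> nonzero_radon_algebra"
    using measurable_scale_nonzero[OF c0] by (simp add: measurable_cong_sets[OF s refl])
  have "(\<integral>\<mu>. (1 - exp (- pairing (\<lambda>x. c * h x) \<mu>)) \<partial>\<Lambda>) = (\<integral>\<mu>. (1 - exp (- pairing h (scale_measure (ennreal c) \<mu>))) \<partial>\<Lambda>)"
    by (intro Bochner_Integration.integral_cong) (auto simp: sp pairing_scale_measure[OF h c])
  also have "\<dots> = (\<integral>\<mu>. (1 - exp (- pairing h \<mu>)) \<partial>distr \<Lambda> nonzero_radon_algebra (scale_measure (ennreal c)))"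
    by (rule integral_distr[OF ms m, symmetric])
  also have "\<dots> = enn2real (\<integral>\<^sup>+\<mu>. ennreal (1 - exp (- pairing h \<mu>)) \<partial>scale_measure (ennreal (c powr \<alpha>)) \<Lambda>)"
    unfolding d using m BM_nn_integral_finite(3)[OF h]
    by (intro integral_eq_nn_integral) (auto simp: sp space_scale_measure measurable_cong_sets[OF ssc refl])
  also have "\<dots> = enn2real (ennreal (c powr \<alpha>) * (\<integral>\<^sup>+\<mu>. ennreal (1 - exp (- pairing h \<mu>)) \<partial>\<Lambda>))"
    using m by (subst nn_integral_scale_measure) (simp_all add: measurable_cong_sets[OF s refl])
  also have "\<dots> = c powr \<alpha> * enn2real (\<integral>\<^sup>+\<mu>. ennreal (1 - exp (- pairing h \<mu>)) \<partial>\<Lambda>)"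
    by (simp add: enn2real_mult)
  also have "enn2real (\<integral>\<^sup>+\<mu>. ennreal (1 - exp (- pairing h \<mu>)) \<partial>\<Lambda>) = (\<integral>\<mu>. (1 - exp (- pairing h \<mu>)) \<partial>\<Lambda>)"
    using m BM_nn_integral_finite(3)[OF h]
    by (intro integral_eq_nn_integral[symmetric]) (auto simp: sp measurable_cong_sets[OF s refl])
  finally show ?thesis .
qed

section \<open>Strict stability of a random measure in terms of the Laplace transform of its
  law\<close>

context
  fixes P :: "'o measure" and \<zeta> :: "'o \<Rightarrow> 'a::{second_countable_topology, t2_space} measure"
  assumes lc: "locally_compact_space (euclidean :: 'a topology)" and \<zeta>: "random_measure P \<zeta>"
begin

abbreviation (input) "law \<equiv> distr P radon_algebra \<zeta>"

lemma prob_space_law: "prob_space law" "sets law = sets radon_algebra"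
  using \<zeta> by (auto simp: random_measure_def intro: prob_space.prob_space_distr)

lemma laplace_functional_eq_lap: "h \<in> BM \<Longrightarrow> laplace_functional P \<zeta> h = lap law (\<lambda>x. ennreal (h x))"
proof -
  assume h: "h \<in> BM"
  have m: "\<zeta> \<in> measurable P radon_algebra" using \<zeta> by (simp add: random_measure_def)
  have "lap law (\<lambda>x. ennreal (h x)) = (\<integral>\<omega>. eneg (\<integral>\<^sup>+x. ennreal (h x) \<partial>\<zeta> \<omega>) \<partial>P)"
    unfolding lap_def by (intro integral_distr m measurable_eneg_nn_integral ennreal_BM_measurable h)
  also have "\<dots> = laplace_functional P \<zeta> h"
    unfolding laplace_functional_def using measurable_space[OF m]
    by (intro Bochner_Integration.integral_cong) (auto simp: space_radon_algebra eneg_BM[OF h])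
  finally show ?thesis by simp
qed

lemma lap_stable_combination:
  assumes h: "h \<in> borel_measurable borel"
  shows "lap (distr (P \<Otimes>\<^sub>M P) radon_algebra (\<lambda>(\<omega>', \<omega>''). stable_combination \<alpha> t (\<zeta> \<omega>') (\<zeta> \<omega>''))) h
    = lap law (\<lambda>x. ennreal (t powr (1 / \<alpha>)) * h x) * lap law (\<lambda>x. ennreal ((1 - t) powr (1 / \<alpha>)) * h x)"
proof -
  interpret P: prob_space P using \<zeta> by (simp add: random_measure_def)
  have m: "\<zeta> \<in> measurable P radon_algebra" using \<zeta> by (simp add: random_measure_def)
  define S where "S c = (scale_measure (ennreal c) :: 'a measure \<Rightarrow> 'a measure)" for c
  have Sm: "S c \<in> measurable radon_algebra radon_algebra" for c unfolding S_def by (rule measurable_scale_measure)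
  have Sz: "(\<lambda>\<omega>. S c (\<zeta> \<omega>)) \<in> measurable P radon_algebra" for c by (rule measurable_compose[OF m Sm])
  let ?a = "t powr (1 / \<alpha>)" and ?b = "(1 - t) powr (1 / \<alpha>)"
  have ds: "distr P radon_algebra (\<lambda>\<omega>. S c (\<zeta> \<omega>)) = distr law radon_algebra (S c)" for c
    by (subst distr_distr[OF Sm m]) (simp add: comp_def)
  have pr: "prob_space (distr law radon_algebra (S c))" for c
    by (rule prob_space.prob_space_distr[OF prob_space_law(1)]) (simp add: Sm)
  have "distr P radon_algebra (\<lambda>\<omega>. S ?a (\<zeta> \<omega>)) \<Otimes>\<^sub>M distr P radon_algebra (\<lambda>\<omega>. S ?b (\<zeta> \<omega>)) =
     distr (P \<Otimes>\<^sub>M P) (radon_algebra \<Otimes>\<^sub>M radon_algebra) (\<lambda>(x, y). (S ?a (\<zeta> x), S ?b (\<zeta> y)))"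
    using Sz pr ds by (intro pair_measure_distr) (auto simp: prob_space_def finite_measure_def)
  note pd = this
  have pm: "(\<lambda>(x, y). (S ?a (\<zeta> x), S ?b (\<zeta> y))) \<in> measurable (P \<Otimes>\<^sub>M P) (radon_algebra \<Otimes>\<^sub>M radon_algebra)"
    using measurable_Pair[OF measurable_compose[OF measurable_fst Sz] measurable_compose[OF measurable_snd Sz]]
    by (simp add: case_prod_beta')
  have "distr (P \<Otimes>\<^sub>M P) radon_algebra (\<lambda>(\<omega>', \<omega>''). stable_combination \<alpha> t (\<zeta> \<omega>') (\<zeta> \<omega>'')) =
    distr (distr law radon_algebra (S ?a) \<Otimes>\<^sub>M distr law radon_algebra (S ?b)) radon_algebra (\<lambda>(\<mu>, \<nu>). add_measure \<mu> \<nu>)"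
    unfolding ds[symmetric] pd
    by (subst distr_distr[OF measurable_add_measure pm]) (simp add: comp_def case_prod_beta' stable_combination_def S_def)
  then show ?thesis
    using lap_convolution[OF pr _ pr _ h] lap_distr_scale[OF prob_space_law h] unfolding S_def by simp
qed

lemma strictly_stable_lap:
  assumes "strictly_stable \<alpha> P \<zeta>" "0 \<le> t" "t \<le> 1" "h \<in> borel_measurable borel"
  shows "lap law (\<lambda>x. ennreal (t powr (1 / \<alpha>)) * h x) * lap law (\<lambda>x. ennreal ((1 - t) powr (1 / \<alpha>)) * h x) = lap law h"
  using assms lap_stable_combination[OF assms(4), of \<alpha> t] by (simp add: strictly_stable_def)

text \<open>Laws on Radon measures are determined by their transforms on \<open>BM\<close>, and
  independence makes the transform of the stable combination a product.\<close>

lemma strictly_stableI: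
  assumes "\<And>t h. 0 \<le> t \<Longrightarrow> t \<le> 1 \<Longrightarrow> h \<in> BM \<Longrightarrow>
    lap law (\<lambda>x. ennreal (t powr (1 / \<alpha>)) * ennreal (h x)) * lap law (\<lambda>x. ennreal ((1 - t) powr (1 / \<alpha>)) * ennreal (h x)) = lap law (\<lambda>x. ennreal (h x))"
  shows "strictly_stable \<alpha> P \<zeta>"
  unfolding strictly_stable_def
proof
  fix t :: real assume t: "t \<in> {0..1}"
  interpret P: prob_space P using \<zeta> by (simp add: random_measure_def)
  interpret PP: pair_prob_space P P ..
  have m: "\<zeta> \<in> measurable P radon_algebra" using \<zeta> by (simp add: random_measure_def)
  have "(\<lambda>(\<omega>', \<omega>''). (\<zeta> \<omega>', \<zeta> \<omega>'')) \<in> measurable (P \<Otimes>\<^sub>M P) (radon_algebra \<Otimes>\<^sub>M radon_algebra)"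
    using measurable_Pair[OF measurable_compose[OF measurable_fst m] measurable_compose[OF measurable_snd m]]
    by (simp add: case_prod_beta')
  from measurable_compose[OF this measurable_stable_combination[of \<alpha> t]]
  have cm: "(\<lambda>(\<omega>', \<omega>''). stable_combination \<alpha> t (\<zeta> \<omega>') (\<zeta> \<omega>'')) \<in> measurable (P \<Otimes>\<^sub>M P) radon_algebra"
    by (simp add: case_prod_beta')
  show "distr (P \<Otimes>\<^sub>M P) radon_algebra (\<lambda>(\<omega>', \<omega>''). stable_combination \<alpha> t (\<zeta> \<omega>') (\<zeta> \<omega>'')) = law"
  proof (rule laplace_unique[OF lc])
    show "finite_measure (distr (P \<Otimes>\<^sub>M P) radon_algebra (\<lambda>(\<omega>', \<omega>''). stable_combination \<alpha> t (\<zeta> \<omega>') (\<zeta> \<omega>'')))"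
      using PP.prob_space_distr[OF cm] by (simp add: prob_space_def)
    show "finite_measure law" using prob_space_law(1) by (simp add: prob_space_def)
  qed (use t in \<open>simp_all add: lap_stable_combination[OF ennreal_BM_measurable] assms\<close>)
qed

lemma strictly_1_stable_imp_deterministic:
  assumes st: "strictly_stable 1 P \<zeta>"
  shows "deterministic P \<zeta>"
proof -
  interpret L: prob_space law by (rule prob_space_law)
  have m: "\<zeta> \<in> measurable P radon_algebra" using \<zeta> by (simp add: random_measure_def)
  interpret P: prob_space P using \<zeta> by (simp add: random_measure_def)
  have const: "AE \<mu> in law. eneg (\<integral>\<^sup>+x. h x \<partial>\<mu>) = lap law h" if h: "h \<in> borel_measurable borel" for h
  proof -
    have hh: "(\<lambda>x. 2 * h x) \<in> borel_measurable borel" using h by measurable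
    have half: "ennreal (1 / 2) * (2 * y) = y" for y
      using ennreal_mult[of "1 / 2" 2] by (simp add: mult.assoc[symmetric])
    \<comment> \<open>Stability is applied to \<open>2 * h\<close>, where both scaling factors are
      1/2. The transform at \<open>2 * h\<close> is the second moment of exp (- \<langle>h,
      \<mu>\<rangle>), and \<open>lap law h\<close> is its mean.\<close>
    have "lap law h * lap law h = lap law (\<lambda>x. 2 * h x)"
      using strictly_stable_lap[OF st _ _ hh, of "1 / 2"] by (simp add: half del: ennreal_half)
    moreover have "lap law (\<lambda>x. 2 * h x) = (\<integral>\<mu>. (eneg (\<integral>\<^sup>+x. h x \<partial>\<mu>))\<^sup>2 \<partial>law)"
      unfolding lap_def
    proof (intro Bochner_Integration.integral_cong refl)
      fix \<mu> assume "\<mu> \<in> space law"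
      then have "\<mu> \<in> radon_measures" by (simp add: space_radon_algebra)
      then have "h \<in> borel_measurable \<mu>" using h by (simp add: measurable_cong_sets[OF sets_radon refl])
      then have "(\<integral>\<^sup>+x. 2 * h x \<partial>\<mu>) = 2 * (\<integral>\<^sup>+x. h x \<partial>\<mu>)" by (rule nn_integral_cmult)
      then show "eneg (\<integral>\<^sup>+x. 2 * h x \<partial>\<mu>) = (eneg (\<integral>\<^sup>+x. h x \<partial>\<mu>))\<^sup>2"
        by (simp only: mult_2 eneg_add power2_eq_square)
    qed
    ultimately have sq: "(\<integral>\<mu>. (eneg (\<integral>\<^sup>+x. h x \<partial>\<mu>))\<^sup>2 \<partial>law) = (lap law h)\<^sup>2" by (simp add: power2_eq_square)
    have i1: "integrable law (\<lambda>\<mu>. eneg (\<integral>\<^sup>+x. h x \<partial>\<mu>))" by (rule integrable_lap[OF prob_space_law h])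
    have i2: "integrable law (\<lambda>\<mu>. (eneg (\<integral>\<^sup>+x. h x \<partial>\<mu>))\<^sup>2)"
      using borel_measurable_integrable[OF i1]
      by (intro L.integrable_const_bound[where B=1]) (auto simp: power_le_one)
    have "(\<integral>\<mu>. (eneg (\<integral>\<^sup>+x. h x \<partial>\<mu>) - lap law h)\<^sup>2 \<partial>law) = 0"
      using i1 i2 sq L.prob_space by (simp add: power2_diff lap_def[symmetric]) (simp add: power2_eq_square)
    moreover have "integrable law (\<lambda>\<mu>. (eneg (\<integral>\<^sup>+x. h x \<partial>\<mu>) - lap law h)\<^sup>2)"
      using i1 i2 by (simp add: power2_diff)
    ultimately have "AE \<mu> in law. (eneg (\<integral>\<^sup>+x. h x \<partial>\<mu>) - lap law h)\<^sup>2 = 0"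
      by (subst (asm) integral_nonneg_eq_0_iff_AE) auto
    then show ?thesis by simp
  qed
  \<comment> \<open>The exceptional null set in \<open>const\<close> depends on \<open>h\<close>.
    Only the countably many indicators behind the coordinates of the code are used, so one null set
    suffices, and the constant code decodes to the deterministic value.\<close>
  obtain code :: "'a measure \<Rightarrow> (nat \<times> rat \<Rightarrow> real)" and dec where
    dec: "dec \<in> measurable borel radon_algebra" "\<And>\<mu>. \<mu> \<in> radon_measures \<Longrightarrow> dec (code \<mu>) = \<mu>" and
    code: "\<And>i. \<exists>B\<in>sets borel. compact (closure B) \<and> (\<forall>\<mu>. code \<mu> i = measure \<mu> B)"
    by (rule exists_additive_code[OF lc]) (rule that)
  have "\<exists>c. AE \<mu> in law. code \<mu> i = c" for i
  proof -
    obtain B where B: "B \<in> sets borel" "compact (closure B)" "\<And>\<mu>. code \<mu> i = measure \<mu> B" using code[of i] by blast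
    have ib: "indicator B \<in> borel_measurable borel" using B by simp
    have "AE \<mu> in law. code \<mu> i = - ln (lap law (indicator B))"
      using const[OF ib] AE_space
    proof eventually_elim
      case (elim \<mu>)
      then have \<mu>: "\<mu> \<in> radon_measures" by (simp add: space_radon_algebra)
      have "emeasure \<mu> B \<noteq> \<top>" using \<mu> B(1,2) by (simp add: radon_measures_iff less_top)
      then have "(\<integral>\<^sup>+x. indicator B x \<partial>\<mu>) = ennreal (measure \<mu> B)"
        using B(1) sets_radon[OF \<mu>] by (simp add: emeasure_eq_ennreal_measure)
      then have "eneg (\<integral>\<^sup>+x. indicator B x \<partial>\<mu>) = exp (- measure \<mu> B)" by (simp add: eneg_ennreal)
      with elim(1) have "lap law (indicator B) = exp (- measure \<mu> B)" by (rule trans[OF sym])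
      then show ?case using B(3) by simp
    qed
    then show ?thesis by blast
  qed
  then obtain c where c: "\<And>i. AE \<mu> in law. code \<mu> i = c i" by metis
  then have "AE \<mu> in law. \<forall>i. code \<mu> i = c i" by (simp add: AE_all_countable)
  then have "AE \<omega> in P. \<forall>i. code (\<zeta> \<omega>) i = c i" by (rule AE_distrD[OF m])
  then have "AE \<omega> in P. \<zeta> \<omega> = dec c"
    using AE_space
  proof eventually_elim
    case (elim \<omega>)
    then have "code (\<zeta> \<omega>) = c" by auto
    moreover have "\<zeta> \<omega> \<in> radon_measures" using measurable_space[OF m elim(2)] by (simp add: space_radon_algebra)
    ultimately show ?case using dec(2)[of "\<zeta> \<omega>"] by simp
  qed
  moreover have "dec c \<in> radon_measures" using measurable_space[OF dec(1)] by (simp add: space_radon_algebra)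
  ultimately show ?thesis unfolding deterministic_def by blast
qed

lemma deterministic_imp_strictly_1_stable:
  assumes "deterministic P \<zeta>"
  shows "strictly_stable 1 P \<zeta>"
proof (rule strictly_stableI)
  obtain \<mu> where \<mu>: "\<mu> \<in> radon_measures" "AE \<omega> in P. \<zeta> \<omega> = \<mu>" using assms by (auto simp: deterministic_def)
  interpret P: prob_space P using \<zeta> by (simp add: random_measure_def)
  have m: "\<zeta> \<in> measurable P radon_algebra" using \<zeta> by (simp add: random_measure_def)
  have L: "lap law h = eneg (\<integral>\<^sup>+x. h x \<partial>\<mu>)" if h: "h \<in> borel_measurable borel" for h
  proof -
    have e: "(\<lambda>\<omega>. eneg (\<integral>\<^sup>+x. h x \<partial>\<zeta> \<omega>)) \<in> borel_measurable P"
      by (rule measurable_compose[OF m measurable_eneg_nn_integral[OF h]])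
    have "lap law h = (\<integral>\<omega>. eneg (\<integral>\<^sup>+x. h x \<partial>\<zeta> \<omega>) \<partial>P)"
      unfolding lap_def by (intro integral_distr m measurable_eneg_nn_integral h)
    also have "\<dots> = (\<integral>\<omega>. eneg (\<integral>\<^sup>+x. h x \<partial>\<mu>) \<partial>P)"
      using e \<mu>(2) by (intro integral_cong_AE) auto
    finally show ?thesis by (simp add: P.prob_space)
  qed
  fix t :: real and h :: "'a \<Rightarrow> real" assume t: "0 \<le> t" "t \<le> 1" and h: "h \<in> BM"
  have [measurable]: "h \<in> borel_measurable borel" using h by (simp add: BM_def)
  have hm: "(\<lambda>x. ennreal (h x)) \<in> borel_measurable \<mu>" using \<mu>(1) by (simp add: measurable_cong_sets[OF sets_radon refl])
  let ?I = "\<integral>\<^sup>+x. ennreal (h x) \<partial>\<mu>"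
  have "lap law (\<lambda>x. ennreal (t powr (1 / 1)) * ennreal (h x)) * lap law (\<lambda>x. ennreal ((1 - t) powr (1 / 1)) * ennreal (h x))
     = eneg (ennreal t * ?I) * eneg (ennreal (1 - t) * ?I)"
    using t hm by (simp add: L nn_integral_cmult)
  also have "\<dots> = eneg ((ennreal t + ennreal (1 - t)) * ?I)" by (simp add: eneg_add distrib_right)
  also have "ennreal t + ennreal (1 - t) = 1" using t by (simp add: ennreal_plus[symmetric] del: ennreal_plus)
  finally show "lap law (\<lambda>x. ennreal (t powr (1 / 1)) * ennreal (h x)) * lap law (\<lambda>x. ennreal ((1 - t) powr (1 / 1)) * ennreal (h x))
     = lap law (\<lambda>x. ennreal (h x))"
    by (simp add: L)
qed

lemma strictly_stable_imp_levy_representation: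
  assumes st: "strictly_stable \<alpha> P \<zeta>" and pos: "0 < \<alpha>" and less1: "\<alpha> < 1"
  shows "\<exists>\<Lambda>. levy_measure \<Lambda> \<and> homogeneous (- \<alpha>) \<Lambda> \<and>
    (\<forall>h\<in>BM. laplace_functional P \<zeta> h = exp (- (\<integral>\<mu>. (1 - exp (- pairing h \<mu>)) \<partial>\<Lambda>)))"
proof -
  obtain D :: "nat \<Rightarrow> 'a set" where D: "bounded_partition D" using exists_bounded_partition[OF lc] by blast
  obtain g :: "'a \<Rightarrow> real" where g: "g \<in> borel_measurable borel" "\<And>x. 0 < g x"
    "AE \<mu> in law. (\<integral>\<^sup>+x. ennreal (g x) \<partial>\<mu>) < \<infinity>" "\<And>h. h \<in> BM \<Longrightarrow> \<exists>C>0. \<forall>x. h x \<le> C * g x"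
    by (rule exists_integrable_weight[OF D prob_space_law]) (rule that)
  interpret weighted_stable_laplace law \<alpha> g
    by (intro weighted_stable_laplace.intro stable_laplace.intro weighted_stable_laplace_axioms.intro lc prob_space_law pos g strictly_stable_lap[OF st])
  obtain \<Lambda> where "levy_measure \<Lambda>" "homogeneous (- \<alpha>) \<Lambda>"
    "\<And>h. h \<in> BM \<Longrightarrow> lap law (\<lambda>x. ennreal (h x)) = exp (- (\<integral>\<mu>. (1 - exp (- pairing h \<mu>)) \<partial>\<Lambda>))"
    by (rule levy_representation[OF less1]) (rule that)
  then show ?thesis by (intro exI[of _ \<Lambda>]) (simp add: laplace_functional_eq_lap)
qed

lemma levy_representation_imp_strictly_stable:
  assumes \<alpha>: "0 < \<alpha>" and levy: "levy_measure \<Lambda>" and hom: "homogeneous (- \<alpha>) \<Lambda>"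
    and lap: "\<And>h. h \<in> BM \<Longrightarrow> laplace_functional P \<zeta> h = exp (- (\<integral>\<mu>. (1 - exp (- pairing h \<mu>)) \<partial>\<Lambda>))"
  shows "strictly_stable \<alpha> P \<zeta>"
proof (rule strictly_stableI)
  fix t :: real and h :: "'a \<Rightarrow> real" assume t: "0 \<le> t" "t \<le> 1" and h: "h \<in> BM"
  let ?\<psi> = "\<integral>\<mu>. (1 - exp (- pairing h \<mu>)) \<partial>\<Lambda>"
  have h0: "0 \<le> h x" for x using h by (simp add: BM_def)
  have L: "lap law (\<lambda>x. ennreal (u powr (1 / \<alpha>)) * ennreal (h x)) = exp (- (u * ?\<psi>))" if u: "0 \<le> u" for u
  proof -
    have c: "0 \<le> u powr (1 / \<alpha>)" by simp
    have "lap law (\<lambda>x. ennreal (u powr (1 / \<alpha>)) * ennreal (h x)) = lap law (\<lambda>x. ennreal (u powr (1 / \<alpha>) * h x))"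
      using h0 by (simp add: ennreal_mult)
    also have "\<dots> = exp (- (\<integral>\<mu>. (1 - exp (- pairing (\<lambda>x. u powr (1 / \<alpha>) * h x) \<mu>)) \<partial>\<Lambda>))"
      using lap[OF BM_cmult[OF h c]] laplace_functional_eq_lap[OF BM_cmult[OF h c]] by simp
    also have "\<dots> = exp (- (u * ?\<psi>))"
      using u \<alpha> by (simp add: homogeneous_exponent_scale[OF levy hom h c] powr_powr)
    finally show ?thesis .
  qed
  show "lap law (\<lambda>x. ennreal (t powr (1 / \<alpha>)) * ennreal (h x)) * lap law (\<lambda>x. ennreal ((1 - t) powr (1 / \<alpha>)) * ennreal (h x)) = lap law (\<lambda>x. ennreal (h x))"
    using t L[of t] L[of "1 - t"] L[of 1] by (simp add: exp_add[symmetric] algebra_simps)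
qed

end

theorem theorem2:
  fixes P :: "'o measure"
    and \<zeta> :: "'o \<Rightarrow> 'a::{second_countable_topology, t2_space} measure"
  assumes "locally_compact_space (euclidean :: 'a topology)"
    and "random_measure P \<zeta>"
  shows "(strictly_stable 1 P \<zeta> \<longleftrightarrow> deterministic P \<zeta>) \<and>
    (\<forall>\<alpha>. 0 < \<alpha> \<and> \<alpha> < 1 \<longrightarrow>
      (strictly_stable \<alpha> P \<zeta> \<longleftrightarrow>
        (\<exists>\<Lambda>. levy_measure \<Lambda> \<and> homogeneous (- \<alpha>) \<Lambda> \<and>
          (\<forall>h\<in>BM. laplace_functional P \<zeta> h =
                   exp (- (\<integral>\<mu>. (1 - exp (- pairing h \<mu>)) \<partial>\<Lambda>))))))"
proof (intro conjI allI impI iffI)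
  show "strictly_stable 1 P \<zeta> \<Longrightarrow> deterministic P \<zeta>"
    by (rule strictly_1_stable_imp_deterministic[OF assms])
  show "deterministic P \<zeta> \<Longrightarrow> strictly_stable 1 P \<zeta>"
    by (rule deterministic_imp_strictly_1_stable[OF assms])
next
  fix \<alpha> :: real assume \<alpha>: "0 < \<alpha> \<and> \<alpha> < 1" and "strictly_stable \<alpha> P \<zeta>"
  then show "\<exists>\<Lambda>. levy_measure \<Lambda> \<and> homogeneous (- \<alpha>) \<Lambda> \<and>
      (\<forall>h\<in>BM. laplace_functional P \<zeta> h = exp (- (\<integral>\<mu>. (1 - exp (- pairing h \<mu>)) \<partial>\<Lambda>)))"
    by (intro strictly_stable_imp_levy_representation[OF assms]) auto
next
  fix \<alpha> :: real assume \<alpha>: "0 < \<alpha> \<and> \<alpha> < 1" and "\<exists>\<Lambda>. levy_measure \<Lambda> \<and> homogeneous (- \<alpha>) \<Lambda> \<and>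
      (\<forall>h\<in>BM. laplace_functional P \<zeta> h = exp (- (\<integral>\<mu>. (1 - exp (- pairing h \<mu>)) \<partial>\<Lambda>)))"
  then obtain \<Lambda> where "levy_measure \<Lambda>" "homogeneous (- \<alpha>) \<Lambda>"
    "\<forall>h\<in>BM. laplace_functional P \<zeta> h = exp (- (\<integral>\<mu>. (1 - exp (- pairing h \<mu>)) \<partial>\<Lambda>))" by blast
  then show "strictly_stable \<alpha> P \<zeta>"
    using \<alpha> by (intro levy_representation_imp_strictly_stable[OF assms, of \<alpha> \<Lambda>]) auto
qed

end
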